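(* Let $q\in\mathbb{C}$, $q\neq0$, not be a root of unity, and $N\ge2$. Then the quantized enveloping algebra $U_q(\mathfrak{sl}_N)$ over $\mathbb{C}$ is $LD$-stable and $LD\,U_q(\mathfrak{sl}_N)=N^2-1$.
   Context: $U_q(\mathfrak{sl}_N)$ is the quantized enveloping algebra of $\mathfrak{sl}_N$ given by the quantum Chevalley–Serre relations. $GK$ is Gelfand–Kirillov dimension over $\mathbb{C}$: $GK\,A=\sup_V\limsup_m \log(\dim V^m)/\log m$ over subframes $V$ (finite-dimensional subspaces containing $1$). Lower transcendence degree $LD$: if every subframe $V$ admits a finite-dimensional nonzero $W$ with $\dim VW=\dim W$, then $LD\,A=0$; otherwise $LD\,A=\sup_V\sup\{d>0:\exists c>0,\ \dim VW\ge\dim W+c(\dim W)^{(d-1)/d}\text{ for all finite-dimensional }W\neq0\}$. $A$ is $LD$-stable if $LD\,A=GK\,A$. *)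

theory Defs
  imports Complex_Main "HOL-Library.Extended_Real" "HOL-Library.Liminf_Limsup"
begin

text \<open>Elements of the free algebra are finitely supported functions from words
  (lists of generators) to complex coefficients.\<close>

type_synonym 'g fa = "'g list \<Rightarrow> complex"

definition FA :: "'g fa set" where
  "FA = {f. finite {w. f w \<noteq> 0}}"

definition fa_zero :: "'g fa" where "fa_zero = (\<lambda>w. 0)"
definition fa_one :: "'g fa" where "fa_one = (\<lambda>w. if w = [] then 1 else 0)"
definition fa_add :: "'g fa \<Rightarrow> 'g fa \<Rightarrow> 'g fa" where "fa_add f g = (\<lambda>w. f w + g w)"
definition fa_scale :: "complex \<Rightarrow> 'g fa \<Rightarrow> 'g fa" where "fa_scale c f = (\<lambda>w. c * f w)"
definition fa_mult :: "'g fa \<Rightarrow> 'g fa \<Rightarrow> 'g fa" where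
  "fa_mult f g = (\<lambda>w. \<Sum>i\<le>length w. f (take i w) * g (drop i w))"

definition lin :: "(complex \<times> 'g list) list \<Rightarrow> 'g fa" where
  "lin ts = (\<lambda>w. sum_list (map (\<lambda>(c,u). if u = w then c else 0) ts))"

inductive_set fa_ideal :: "'g fa set \<Rightarrow> 'g fa set" for R :: "'g fa set" where
  zero: "fa_zero \<in> fa_ideal R"
| gen: "r \<in> R \<Longrightarrow> r \<in> fa_ideal R"
| add: "a \<in> fa_ideal R \<Longrightarrow> b \<in> fa_ideal R \<Longrightarrow> fa_add a b \<in> fa_ideal R"
| scale: "a \<in> fa_ideal R \<Longrightarrow> fa_scale c a \<in> fa_ideal R"
| lmult: "a \<in> fa_ideal R \<Longrightarrow> u \<in> FA \<Longrightarrow> fa_mult u a \<in> fa_ideal R"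
| rmult: "a \<in> fa_ideal R \<Longrightarrow> u \<in> FA \<Longrightarrow> fa_mult a u \<in> fa_ideal R"

definition indep_mod :: "'g fa set \<Rightarrow> 'g fa set \<Rightarrow> bool" where
  "indep_mod I B \<longleftrightarrow> finite B \<and>
     (\<forall>c. (\<lambda>w. \<Sum>b\<in>B. c b * b w) \<in> I \<longrightarrow> (\<forall>b\<in>B. c b = 0))"

text \<open>Dimension of the image in FA/I of the linear span of X (used for finite X).\<close>
definition dim_mod :: "'g fa set \<Rightarrow> 'g fa set \<Rightarrow> nat" where
  "dim_mod I X = Sup (card ` {B. B \<subseteq> X \<and> indep_mod I B})"

definition set_mult :: "'g fa set \<Rightarrow> 'g fa set \<Rightarrow> 'g fa set" where
  "set_mult S T = {fa_mult a b | a b. a \<in> S \<and> b \<in> T}"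

text \<open>Products of m elements of S; its span is V^m when V = span S.\<close>
fun prods :: "'g fa set \<Rightarrow> nat \<Rightarrow> 'g fa set" where
  "prods S 0 = {fa_one}"
| "prods S (Suc m) = set_mult (prods S m) S"

text \<open>Subframes of A = FA / I are exactly the images of spans of finite sets S \<subseteq> FA
  containing 1.\<close>
definition frame :: "'g fa set \<Rightarrow> bool" where
  "frame S \<longleftrightarrow> finite S \<and> S \<subseteq> FA \<and> fa_one \<in> S"

text \<open>Finite-dimensional nonzero subspaces W of A are images of spans of finite T \<subseteq> FA
  with nonzero image.\<close>
definition fdsub :: "'g fa set \<Rightarrow> 'g fa set \<Rightarrow> bool" where
  "fdsub I T \<longleftrightarrow> finite T \<and> T \<subseteq> FA \<and> dim_mod I T > 0"

definition GK :: "'g fa set \<Rightarrow> ereal" where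
  "GK R = (SUP S\<in>{S. frame S}.
      limsup (\<lambda>m. ereal (ln (real (dim_mod (fa_ideal R) (prods S m))) / ln (real m))))"

definition LD :: "'g fa set \<Rightarrow> ereal" where
  "LD R = (let I = fa_ideal R in
     if (\<forall>S. frame S \<longrightarrow> (\<exists>T. fdsub I T \<and> dim_mod I (set_mult S T) = dim_mod I T))
     then 0
     else (SUP S\<in>{S. frame S}. Sup {ereal d | d. d > 0 \<and>
             (\<exists>c>0. \<forall>T. fdsub I T \<longrightarrow>
                real (dim_mod I (set_mult S T))
                  \<ge> real (dim_mod I T) + c * real (dim_mod I T) powr ((d - 1) / d))}))"

definition LD_stable :: "'g fa set \<Rightarrow> bool" where
  "LD_stable R \<longleftrightarrow> LD R = GK R"

text \<open>Generators E_i, F_i, K_i, K_i^{-1}; indices i are 0-based, 0 \<le> i < N-1.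
  Generators with out-of-range index are set to zero by the relations,
  so they do not contribute.\<close>
datatype gen = E nat | F nat | K nat | Kinv nat

definition cartan :: "nat \<Rightarrow> nat \<Rightarrow> int" where
  "cartan i j = (if i = j then 2 else if i = j + 1 \<or> j = i + 1 then -1 else 0)"

definition Uq_sl_rel :: "complex \<Rightarrow> nat \<Rightarrow> gen fa set" where
  "Uq_sl_rel q N =
     {lin [(1, [K i, Kinv i]), (-1, [])] | i. i < N - 1}
   \<union> {lin [(1, [Kinv i, K i]), (-1, [])] | i. i < N - 1}
   \<union> {lin [(1, [K i, K j]), (-1, [K j, K i])] | i j. i < N - 1 \<and> j < N - 1}
   \<union> {lin [(1, [K i, E j, Kinv i]), (- (q powi cartan i j), [E j])] | i j. i < N - 1 \<and> j < N - 1}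
   \<union> {lin [(1, [K i, F j, Kinv i]), (- (q powi (- cartan i j)), [F j])] | i j. i < N - 1 \<and> j < N - 1}
   \<union> {lin [(1, [E i, F j]), (-1, [F j, E i])] | i j. i < N - 1 \<and> j < N - 1 \<and> i \<noteq> j}
   \<union> {lin [(1, [E i, F i]), (-1, [F i, E i]),
            (- 1 / (q - inverse q), [K i]), (1 / (q - inverse q), [Kinv i])] | i. i < N - 1}
   \<union> {lin [(1, [E i, E i, E j]), (- (q + inverse q), [E i, E j, E i]), (1, [E j, E i, E i])]
        | i j. i < N - 1 \<and> j < N - 1 \<and> cartan i j = -1}
   \<union> {lin [(1, [F i, F i, F j]), (- (q + inverse q), [F i, F j, F i]), (1, [F j, F i, F i])]
        | i j. i < N - 1 \<and> j < N - 1 \<and> cartan i j = -1}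
   \<union> {lin [(1, [E i, E j]), (-1, [E j, E i])] | i j. i < N - 1 \<and> j < N - 1 \<and> cartan i j = 0}
   \<union> {lin [(1, [F i, F j]), (-1, [F j, F i])] | i j. i < N - 1 \<and> j < N - 1 \<and> cartan i j = 0}
   \<union> {lin [(1, [g])] | g i. N - 1 \<le> i \<and> g \<in> {E i, F i, K i, Kinv i}}"

end

theory Submission
  imports Defs "HOL-Library.Function_Algebras" "HOL-Library.FuncSet" "HOL-Library.Multiset"
    "HOL-Computational_Algebra.Polynomial"
begin

text \<open>Tensoring \<open>2 (N - 1)\<close> copies of the q-oscillator representation sends \<open>E\<^sub>i\<close> and
  \<open>F\<^sub>i\<close> to sums of monomials and \<open>K\<^sub>i\<close> to a monomial of a quantum torus. In the image of a root
  vector exactly the monomials belonging to decreasing chains of oscillator copies survive, and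
  for a suitable lexicographic order on exponents the leading exponents of the \<open>N\<^sup>2 - 1\<close> root
  vectors and \<open>K\<^sub>i\<close> are linearly independent. Straightening by the Serre relations shows that the
  ordered monomials in these elements span, without raising degrees. Hence they form a basis, the
  representation is faithful, leading exponents add under multiplication and range in a free
  abelian group of rank \<open>N\<^sup>2 - 1\<close>, and the dimension of a subspace is its number of leading
  exponents. For the frame \<open>V\<close> spanned by 1 and the generators, \<open>dim V W - dim W\<close> is then bounded
  below by a discrete isoperimetric inequality, which gives the lower bound on \<open>LD\<close>. Counting
  monomials bounds \<open>GK\<close> from above, and applying an expansion estimate to \<open>W = V\<^sup>m\<close> turns it into
  growth of \<open>dim V\<^sup>m\<close>, so that \<open>LD\<close> cannot exceed \<open>GK\<close>.\<close>

section \<open>The free algebra\<close>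

text \<open>The obstacle is that a root vector is an iterated q-commutator: the top terms of its two
  products may cancel, so its leading exponent is not simply the sum of those of its factors. The
  support is therefore determined exactly. Monomials of neighbouring simple roots commute up to
  \<open>q\<close> or \<open>inverse q\<close>, the q-commutator annihilates the pairs of the first
  kind, and different surviving chains never share an exponent. Many copies are needed because one
  copy supplies only \<open>2 * n\<close> coordinates, with \<open>n = N - 1\<close>, whereas
  \<open>n * n + 2 * n\<close> independent leading exponents are required. Their number is
  \<open>2 * n\<close> so that \<open>E\<close> root vectors lead in the lower half of the copies
  and \<open>F\<close> root vectors in the upper half. Independence then becomes triangular: shift
  coordinates determine the exponents of the root vectors, and the diagonal part determines those of
  the \<open>K i\<close> through the Cartan matrix. The order has to single out copy
  \<open>k\<close> for a root starting at \<open>k\<close>, for both halves at once; the weights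
  placed above the actual coordinates serve this purpose.\<close>

definition fscale :: "complex \<Rightarrow> ('a \<Rightarrow> complex) \<Rightarrow> 'a \<Rightarrow> complex" where
  "fscale c f = (\<lambda>x. c * f x)"

lemma fscale_apply: "fscale c f x = c * f x"
  by (simp add: fscale_def)

text \<open>The underlying set of the functions is arbitrary, so span, independence and dimension
  from the library serve both for functions on words and for functions on torus exponents.\<close>

interpretation fs: vector_space fscale
  by unfold_locales (auto simp: fscale_def fun_eq_iff algebra_simps)

notation fa_mult (infixl "\<star>" 70)

lemma fa_ops: "fa_add f g = f + g" "fa_scale = fscale" "fa_zero = 0"
  by (auto simp: fa_add_def fa_scale_def fa_zero_def fscale_def fun_eq_iff)

lemma sum_apply: "(\<Sum>a\<in>A. f a) x = (\<Sum>a\<in>A. f a x)"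
  for f :: "'a \<Rightarrow> 'b \<Rightarrow> 'c::comm_monoid_add"
  by (induction A rule: infinite_finite_induct) auto

lemma fa_mult_Nil: "(f \<star> g) [] = f [] * g []"
  by (simp add: fa_mult_def)

text \<open>The cut in front of the word is split off and all other cuts fall into the tail. This
  recursion on the word replaces the reindexing of double sums in associativity and in the unit
  laws.\<close>

lemma fa_mult_Cons: "(f \<star> g) (x # w) = f [] * g (x # w) + ((\<lambda>u. f (x # u)) \<star> g) w"
  unfolding fa_mult_def length_Cons sum.atMost_Suc_shift by simp

lemma fa_mult_add_left: "(f + g) \<star> h = f \<star> h + g \<star> h"
  and fa_mult_add_right: "f \<star> (g + h) = f \<star> g + f \<star> h"
  and fa_mult_diff_left: "(f - g) \<star> h = f \<star> h - g \<star> h"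
  and fa_mult_diff_right: "f \<star> (g - h) = f \<star> g - f \<star> h"
  and fa_mult_minus_left: "(- f) \<star> h = - (f \<star> h)"
  and fa_mult_minus_right: "f \<star> (- h) = - (f \<star> h)"
  and fa_mult_scale_left: "fscale c f \<star> h = fscale c (f \<star> h)"
  and fa_mult_scale_right: "f \<star> fscale c h = fscale c (f \<star> h)"
  and fa_mult_zero_left: "0 \<star> f = 0"
  and fa_mult_zero_right: "f \<star> 0 = 0"
  by (auto simp: fa_mult_def fun_eq_iff fscale_def algebra_simps sum.distrib sum_distrib_left
      sum_subtractf sum_negf)

lemma fa_mult_assoc: "(f \<star> g) \<star> h = f \<star> (g \<star> h)"
proof
  fix w show "((f \<star> g) \<star> h) w = (f \<star> (g \<star> h)) w"
  proof (induction w arbitrary: f)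
    case Nil then show ?case by (simp add: fa_mult_Nil)
  next
    case (Cons x w)
    have *: "(\<lambda>u. (f \<star> g) (x # u)) = fscale (f []) (\<lambda>u. g (x # u)) + (\<lambda>u. f (x # u)) \<star> g"
      by (auto simp: fa_mult_Cons fscale_def)
    have "((f \<star> g) \<star> h) (x # w) = (f \<star> g) [] * h (x # w)
        + f [] * ((\<lambda>u. g (x # u)) \<star> h) w + ((\<lambda>u. f (x # u)) \<star> (g \<star> h)) w"
      unfolding fa_mult_Cons[of "f \<star> g"] * fa_mult_add_left fa_mult_scale_left
      by (simp add: Cons.IH fscale_def)
    then show ?case
      by (simp add: fa_mult_Cons[of f] fa_mult_Nil fa_mult_Cons[of g] algebra_simps)
  qed
qed

lemma fa_mult_one_left [simp]: "fa_one \<star> f = f"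
proof
  have *: "(\<lambda>u. fa_one (x # u)) = 0" for x :: 'a by (auto simp: fa_one_def)
  fix w show "(fa_one \<star> f) w = f w"
    by (cases w) (auto simp: fa_mult_Nil fa_mult_Cons * fa_mult_zero_left, auto simp: fa_one_def)
qed

lemma fa_mult_one_right [simp]: "f \<star> fa_one = f"
proof
  fix w show "(f \<star> fa_one) w = f w"
    by (induction w arbitrary: f) (auto simp: fa_mult_Nil fa_mult_Cons fa_one_def)
qed

lemmas fa_mult_simps = fa_mult_add_left fa_mult_add_right fa_mult_diff_left fa_mult_diff_right
  fa_mult_minus_left fa_mult_minus_right fa_mult_scale_left fa_mult_scale_right
  fa_mult_zero_left fa_mult_zero_right fa_mult_assoc

lemma FA_subspace: "fs.subspace FA"
proof -
  have "finite {w. f w + g w \<noteq> 0}" if "finite {w. f w \<noteq> 0}" "finite {w. g w \<noteq> 0}"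
    for f g :: "'a fa"
    by (rule finite_subset[OF _ finite_UnI[OF that]]) auto
  then show ?thesis
    by (auto simp: fs.subspace_def FA_def fscale_def)
qed

lemmas FA_add = fs.subspace_add[OF FA_subspace]
  and FA_diff = fs.subspace_diff[OF FA_subspace]
  and FA_scale = fs.subspace_scale[OF FA_subspace]
  and FA_sum = fs.subspace_sum[OF FA_subspace]
  and FA_zero = fs.subspace_0[OF FA_subspace]

lemma FA_mult:
  assumes "f \<in> FA" "g \<in> FA" shows "f \<star> g \<in> FA"
proof -
  have "{w. (f \<star> g) w \<noteq> 0} \<subseteq> (\<lambda>(u, v). u @ v) ` ({w. f w \<noteq> 0} \<times> {w. g w \<noteq> 0})"
  proof
    fix w assume "w \<in> {w. (f \<star> g) w \<noteq> 0}"
    then obtain i where "f (take i w) * g (drop i w) \<noteq> 0"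
      unfolding fa_mult_def by (auto elim: sum.not_neutral_contains_not_neutral)
    then show "w \<in> (\<lambda>(u, v). u @ v) ` ({w. f w \<noteq> 0} \<times> {w. g w \<noteq> 0})"
      by (intro image_eqI[of _ _ "(take i w, drop i w)"]) auto
  qed
  then show ?thesis
    using assms finite_subset unfolding FA_def by blast
qed

lemma FA_one: "fa_one \<in> FA"
  by (auto simp: FA_def fa_one_def)

definition word :: "'g list \<Rightarrow> 'g fa" where
  "word u = (\<lambda>w. if u = w then 1 else 0)"

lemma word_Nil: "word [] = fa_one"
  by (auto simp: word_def fa_one_def)

lemma word_FA [simp]: "word u \<in> FA"
  by (auto simp: FA_def word_def)

lemma word_append: "word (u @ v) = word u \<star> word v"
proof
  fix w show "word (u @ v) w = (word u \<star> word v) w"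
  proof (induction u arbitrary: w)
    case Nil then show ?case by (simp add: word_Nil)
  next
    case (Cons x u)
    have *: "(\<lambda>v. word (x # u) (y # v)) = (if x = y then word u else 0)" for y
      by (auto simp: word_def)
    show ?case
    proof (cases w)
      case Nil then show ?thesis by (simp add: fa_mult_Nil word_def)
    next
      case (Cons y w')
      then show ?thesis
        by (simp add: fa_mult_Cons * fa_mult_zero_left flip: Cons.IH) (simp add: word_def)
    qed
  qed
qed

lemma word_Cons: "word (x # u) = word [x] \<star> word u"
  using word_append[of "[x]" u] by simp

lemma lin_word: "lin ts = sum_list (map (\<lambda>(c, u). fscale c (word u)) ts)"
proof (induction ts)
  case (Cons t ts)
  have "lin (t # ts) = fscale (fst t) (word (snd t)) + lin ts"
    by (cases t) (auto simp: lin_def fun_eq_iff fscale_def word_def)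
  then show ?case by (simp add: Cons split: prod.splits)
qed (auto simp: lin_def)

lemma fa_expand:
  assumes "finite A" "{w. f w \<noteq> 0} \<subseteq> A"
  shows "f = (\<Sum>w\<in>A. fscale (f w) (word w))"
proof
  fix v
  have "(\<Sum>w\<in>A. fscale (f w) (word w)) v = (\<Sum>w\<in>A. if w = v then f w else 0)"
    by (simp add: sum_apply) (auto intro: sum.cong simp: fscale_def word_def)
  also have "\<dots> = f v" using assms by (auto simp: sum.delta)
  finally show "f v = (\<Sum>w\<in>A. fscale (f w) (word w)) v" by simp
qed

section \<open>Straightening modulo an ideal\<close>

text \<open>With \<open>[a, b]_s = a b - s b a\<close> this is the nested commutator
  \<open>[x, [x, y]_q]_(1/q)\<close>, the form in which \<open>rv_qcomm_first\<close> uses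
  it.\<close>

definition serre :: "complex \<Rightarrow> 'g fa \<Rightarrow> 'g fa \<Rightarrow> 'g fa" where
  "serre q x y = x \<star> x \<star> y - fscale (q + inverse q) (x \<star> y \<star> x) + y \<star> x \<star> x"

text \<open>\<open>rootvec q e k d\<close> belongs to the root \<open>\<alpha>\<^sub>k + \<dots> + \<alpha>\<^sub>k\<^sub>+\<^sub>d\<close>.\<close>

fun rootvec :: "complex \<Rightarrow> (nat \<Rightarrow> 'g fa) \<Rightarrow> nat \<Rightarrow> nat \<Rightarrow> 'g fa" where
  "rootvec q e k 0 = e k"
| "rootvec q e k (Suc d) =
     e k \<star> rootvec q e (Suc k) d - fscale q (rootvec q e (Suc k) d \<star> e k)"

declare rootvec.simps [simp del]

lemmas rootvec_0 [simp] = rootvec.simps(1)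
  and rootvec_Suc = rootvec.simps(2)

definition fa_prod :: "('i \<Rightarrow> 'g fa) \<Rightarrow> 'i list \<Rightarrow> 'g fa" where
  "fa_prod x is = foldr (\<lambda>i a. x i \<star> a) is fa_one"

lemma fa_prod_simps [simp]:
  "fa_prod x [] = fa_one" "fa_prod x (i # is) = x i \<star> fa_prod x is"
  by (simp_all add: fa_prod_def)

lemma fa_prod_append: "fa_prod x (is @ js) = fa_prod x is \<star> fa_prod x js"
  by (induction "is") (auto simp: fa_mult_assoc)

lemma FA_prod: "(\<And>i. i \<in> set is \<Longrightarrow> x i \<in> FA) \<Longrightarrow> fa_prod x is \<in> FA"
  by (induction "is") (auto intro: FA_mult FA_one)

lemma rootvec_FA: "(\<And>i. e i \<in> FA) \<Longrightarrow> rootvec q e k d \<in> FA"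
  by (induction d arbitrary: k) (auto simp: rootvec_Suc intro!: FA_diff FA_scale FA_mult)

locale fa_quotient =
  fixes I :: "'g fa set"
  assumes I_subspace: "fs.subspace I"
    and I_lmult: "a \<in> I \<Longrightarrow> u \<in> FA \<Longrightarrow> u \<star> a \<in> I"
    and I_rmult: "a \<in> I \<Longrightarrow> u \<in> FA \<Longrightarrow> a \<star> u \<in> I"
begin

lemmas I_add = fs.subspace_add[OF I_subspace]
  and I_diff = fs.subspace_diff[OF I_subspace]
  and I_scale = fs.subspace_scale[OF I_subspace]
  and I_neg = fs.subspace_neg[OF I_subspace]
  and I_zero = fs.subspace_0[OF I_subspace]

text \<open>Membership means being congruent modulo \<open>I\<close> to a linear combination of
  \<open>X\<close>. Computations in the quotient are carried out with this set instead of a quotient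
  type.\<close>

definition spanI :: "'g fa set \<Rightarrow> 'g fa set" where
  "spanI X = fs.span (X \<union> I)"

lemma spanI_base: "x \<in> X \<Longrightarrow> x \<in> spanI X"
  and spanI_I: "x \<in> I \<Longrightarrow> x \<in> spanI X"
  and spanI_add: "x \<in> spanI X \<Longrightarrow> y \<in> spanI X \<Longrightarrow> x + y \<in> spanI X"
  and spanI_diff: "x \<in> spanI X \<Longrightarrow> y \<in> spanI X \<Longrightarrow> x - y \<in> spanI X"
  and spanI_scale: "x \<in> spanI X \<Longrightarrow> fscale c x \<in> spanI X"
  unfolding spanI_def
  by (auto intro: fs.span_base fs.span_add fs.span_diff fs.span_scale)

lemma spanI_mono: "X \<subseteq> Y \<Longrightarrow> spanI X \<subseteq> spanI Y"
  unfolding spanI_def by (intro fs.span_mono) auto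

lemma spanI_cong: "x - y \<in> I \<Longrightarrow> y \<in> spanI X \<Longrightarrow> x \<in> spanI X"
  using spanI_add[OF spanI_I[of "x - y" X], of y] by simp

lemma spanI_trans: "x \<in> spanI X \<Longrightarrow> (\<And>y. y \<in> X \<Longrightarrow> y \<in> spanI Y) \<Longrightarrow> x \<in> spanI Y"
  unfolding spanI_def
  using fs.span_minimal[of "X \<union> I" "fs.span (Y \<union> I)"]
  by (auto simp: fs.subspace_span intro: fs.span_base)

lemma spanI_lmult:
  assumes "u \<in> FA" "x \<in> spanI X" "\<And>y. y \<in> X \<Longrightarrow> u \<star> y \<in> spanI Y"
  shows "u \<star> x \<in> spanI Y"
proof -
  have "fs.subspace {x. u \<star> x \<in> spanI Y}"
    by (auto simp: fs.subspace_def fa_mult_simps intro: spanI_add spanI_scale spanI_I I_zero)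
  then have "fs.span (X \<union> I) \<subseteq> {x. u \<star> x \<in> spanI Y}"
    using assms by (intro fs.span_minimal) (auto intro: spanI_I I_lmult)
  then show ?thesis using assms(2) by (auto simp: spanI_def)
qed

lemma spanI_rmult:
  assumes "u \<in> FA" "x \<in> spanI X" "\<And>y. y \<in> X \<Longrightarrow> y \<star> u \<in> spanI Y"
  shows "x \<star> u \<in> spanI Y"
proof -
  have "fs.subspace {x. x \<star> u \<in> spanI Y}"
    by (auto simp: fs.subspace_def fa_mult_simps intro: spanI_add spanI_scale spanI_I I_zero)
  then have "fs.span (X \<union> I) \<subseteq> {x. x \<star> u \<in> spanI Y}"
    using assms by (intro fs.span_minimal) (auto intro: spanI_I I_rmult)
  then show ?thesis using assms(2) by (auto simp: spanI_def)
qed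

definition qcomm :: "complex \<Rightarrow> 'g fa \<Rightarrow> 'g fa \<Rightarrow> bool" where
  "qcomm s x y \<longleftrightarrow> x \<star> y - fscale s (y \<star> x) \<in> I"

lemma qcomm_mult:
  assumes "qcomm s x a" "qcomm t x b" "a \<in> FA" "b \<in> FA"
  shows "qcomm (s * t) x (a \<star> b)"
proof -
  have "x \<star> (a \<star> b) - fscale (s * t) (a \<star> b \<star> x) =
      (x \<star> a - fscale s (a \<star> x)) \<star> b + fscale s (a \<star> (x \<star> b - fscale t (b \<star> x)))"
    by (rule ext) (simp add: fa_mult_simps fscale_apply algebra_simps)
  moreover have "(x \<star> a - fscale s (a \<star> x)) \<star> b \<in> I"
    using assms by (auto simp: qcomm_def intro: I_rmult)
  moreover have "fscale s (a \<star> (x \<star> b - fscale t (b \<star> x))) \<in> I"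
    using assms by (auto simp: qcomm_def intro: I_scale I_lmult)
  ultimately show ?thesis by (simp only: qcomm_def I_add)
qed

lemma qcomm_diff: "qcomm s x a \<Longrightarrow> qcomm s x b \<Longrightarrow> qcomm s x (a - fscale r b)"
proof -
  have "x \<star> (a - fscale r b) - fscale s ((a - fscale r b) \<star> x) =
      (x \<star> a - fscale s (a \<star> x)) - fscale r (x \<star> b - fscale s (b \<star> x))"
    by (rule ext) (simp add: fa_mult_simps fscale_apply algebra_simps)
  then show "qcomm s x a \<Longrightarrow> qcomm s x b \<Longrightarrow> qcomm s x (a - fscale r b)"
    by (auto simp: qcomm_def intro!: I_diff I_scale)
qed

lemma qcomm_bracket:
  assumes "qcomm s x a" "qcomm t x b" "a \<in> FA" "b \<in> FA"
  shows "qcomm (s * t) x (a \<star> b - fscale r (b \<star> a))"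
proof -
  have "qcomm (s * t) x (b \<star> a)"
    using qcomm_mult[OF assms(2,1,4,3)] by (simp add: mult.commute)
  then show ?thesis using qcomm_mult[OF assms] by (rule qcomm_diff[rotated])
qed

lemma qcomm_sym:
  assumes "qcomm s x y" "s \<noteq> 0" shows "qcomm (inverse s) y x"
proof -
  have "y \<star> x - fscale (inverse s) (x \<star> y) = fscale (- inverse s) (x \<star> y - fscale s (y \<star> x))"
    using assms(2) by (intro ext) (simp add: fscale_apply algebra_simps)
  then show ?thesis using assms(1) unfolding qcomm_def by (simp only: I_scale)
qed

text \<open>Modulo \<open>I\<close> the elements \<open>a\<close> and \<open>c\<close> commute, so
  multiplication by \<open>c\<close> from either side passes through the second argument of the
  Serre expression. The terms with \<open>z\<close> are the exact price of that exchange.\<close>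

lemma serre_bracket:
  assumes "serre q a b \<in> I" "qcomm 1 a c" "a \<in> FA" "b \<in> FA" "c \<in> FA"
  shows "serre q a (b \<star> c - fscale r (c \<star> b)) \<in> I"
proof -
  define z where "z = a \<star> c - c \<star> a"
  have z: "z \<in> I" using assms(2) by (simp add: z_def qcomm_def)
  let ?t = "q + inverse q"
  have "serre q a (b \<star> c - fscale r (c \<star> b)) =
      serre q a b \<star> c - fscale r (c \<star> serre q a b)
      + fscale ?t (a \<star> (b \<star> z)) - b \<star> (a \<star> z + z \<star> a)
      - fscale r ((a \<star> z + z \<star> a) \<star> b - fscale ?t (z \<star> (b \<star> a)))"
    by (rule ext) (simp add: serre_def z_def fa_mult_simps fscale_apply algebra_simps)
  then show ?thesis
    using assms z by (simp add: I_add I_diff I_scale I_lmult I_rmult FA_mult)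
qed

end

section \<open>Commutation rules for root vectors in an algebra with quantum Serre relations\<close>

locale serre_system = fa_quotient I for I :: "'g fa set" +
  fixes q :: complex and n :: nat and e :: "nat \<Rightarrow> 'g fa"
  assumes q_nz: "q \<noteq> 0" and q2_nz: "q + inverse q \<noteq> 0"
    and e_FA [simp]: "\<And>i. e i \<in> FA"
    and e_comm: "\<And>i j. i < n \<Longrightarrow> j < n \<Longrightarrow> i + 1 < j \<or> j + 1 < i \<Longrightarrow> qcomm 1 (e i) (e j)"
    and e_serre: "\<And>i j. i < n \<Longrightarrow> j < n \<Longrightarrow> i + 1 = j \<or> j + 1 = i \<Longrightarrow> serre q (e i) (e j) \<in> I"
begin

abbreviation "rv \<equiv> rootvec q e"

lemma rv_FA [simp]: "rv k d \<in> FA"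
  by (rule rootvec_FA) simp

lemma rv_comm_below: "i + 1 < k \<Longrightarrow> k + d < n \<Longrightarrow> qcomm 1 (e i) (rv k d)"
proof (induction d arbitrary: k)
  case (Suc d)
  have "qcomm (1 * 1) (e i) (rv k (Suc d))"
    unfolding rootvec_Suc using Suc by (intro qcomm_bracket e_comm) auto
  then show ?case by simp
qed (auto intro: e_comm)

text \<open>Only the first simple factor of \<open>rv (Suc k) d\<close> is a neighbour of
  \<open>e k\<close> and the rest commutes with \<open>e k\<close>, so \<open>serre_bracket\<close>
  reduces the claim to a given Serre relation.\<close>

lemma serre_rv: "Suc k + d < n \<Longrightarrow> serre q (e k) (rv (Suc k) d) \<in> I"
  by (cases d) (auto simp: rootvec_Suc intro!: e_serre serre_bracket rv_comm_below)

text \<open>The two nested commutators, with parameters \<open>q\<close> and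
  \<open>inverse q\<close>, multiply out to the Serre expression of \<open>e k\<close> and the
  shorter root vector.\<close>

lemma rv_qcomm_first:
  assumes "k + Suc d < n" shows "qcomm (inverse q) (e k) (rv k (Suc d))"
proof -
  let ?y = "rv (Suc k) d"
  have "e k \<star> rv k (Suc d) - fscale (inverse q) (rv k (Suc d) \<star> e k) = serre q (e k) ?y"
    using q_nz by (intro ext) (simp add: serre_def rootvec_Suc fa_mult_simps fscale_apply algebra_simps)
  then show ?thesis using serre_rv[of k d] assms by (simp add: qcomm_def)
qed

text \<open>The commutator is a combination of the Serre relations between neighbours only after
  multiplication by \<open>q + q\<^sup>-\<^sup>1\<close>, as for the classical relation \<open>[b, [a, [b, c]]] = 0\<close>.\<close>

lemma rv_comm_second:
  assumes "k + Suc (Suc d) < n" shows "qcomm 1 (e (Suc k)) (rv k (Suc (Suc d)))"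
proof -
  define a b c where "a = e k" and "b = e (Suc k)" and "c = rv (Suc (Suc k)) d"
  define z where "z = a \<star> c - c \<star> a"
  have FAs: "a \<in> FA" "b \<in> FA" "c \<in> FA" by (simp_all add: a_def b_def c_def)
  have z: "z \<in> I"
    using rv_comm_below[of k "Suc (Suc k)" d] assms by (simp add: z_def qcomm_def a_def c_def)
  have Sba: "serre q b a \<in> I" unfolding a_def b_def using assms by (intro e_serre) auto
  have Sbc: "serre q b c \<in> I" unfolding b_def c_def using assms by (intro serre_rv) auto
  let ?t = "q + inverse q" and ?y = "rv k (Suc (Suc d))"
  have y: "?y = a \<star> (b \<star> c - fscale q (c \<star> b)) - fscale q ((b \<star> c - fscale q (c \<star> b)) \<star> a)"
    by (simp add: a_def b_def c_def rootvec_Suc)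
  define X where "X = b \<star> (b \<star> z) - fscale (q * q + 1) (b \<star> (z \<star> b)) + fscale (q * q) (z \<star> (b \<star> b))
      - serre q b a \<star> c - fscale (q * q) (serre q b c \<star> a) + a \<star> serre q b c
      + fscale (q * q) (c \<star> serre q b a)"
  have "X \<in> I" unfolding X_def
    using FAs z Sba Sbc by (simp add: I_add I_diff I_scale I_lmult I_rmult FA_mult)
  moreover have "b \<star> ?y - fscale 1 (?y \<star> b) = fscale (inverse ?t) X"
  proof
    fix w
    have t: "q * q + 1 = q * ?t" using q_nz by (simp add: field_simps)
    have "X w = ?t * (b \<star> ?y - fscale 1 (?y \<star> b)) w"
      unfolding X_def y using q_nz
      by (simp add: serre_def z_def fa_mult_simps fscale_apply) (simp add: field_simps)
    then show "(b \<star> ?y - fscale 1 (?y \<star> b)) w = fscale (inverse ?t) X w"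
      using q2_nz by (simp add: fscale_apply)
  qed
  ultimately show ?thesis by (simp only: qcomm_def b_def[symmetric] I_scale)
qed

text \<open>Peeling off simple vectors on the left keeps \<open>i\<close> inside the root until it
  is second from the left; that is the hard case \<open>rv_comm_second\<close>.\<close>

lemma rv_comm_inner: "k < i \<Longrightarrow> i < k + d \<Longrightarrow> k + d < n \<Longrightarrow> qcomm 1 (e i) (rv k d)"
proof (induction d arbitrary: k)
  case (Suc d)
  show ?case
  proof (cases "i = Suc k")
    case True
    then obtain d' where "d = Suc d'" using Suc.prems by (cases d) auto
    then show ?thesis using rv_comm_second[of k d'] True Suc.prems by auto
  next
    case False
    have "qcomm (1 * 1) (e i) (rv k (Suc d))"
      unfolding rootvec_Suc using Suc False by (intro qcomm_bracket e_comm) auto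
    then show ?thesis by simp
  qed
qed auto

text \<open>The factor \<open>q\<close> is due to the two rightmost simple vectors: their bracket is
  the base case, a Serre relation with exchanged roles, and every further simple vector on the left
  commutes with the last one.\<close>

lemma rv_qcomm_last: "k + Suc d < n \<Longrightarrow> qcomm q (e (k + Suc d)) (rv k (Suc d))"
proof (induction d arbitrary: k)
  case 0
  let ?a = "e k" and ?b = "e (Suc k)"
  have "?b \<star> rv k (Suc 0) - fscale q (rv k (Suc 0) \<star> ?b) = fscale (- q) (serre q ?b ?a)"
    using q_nz by (intro ext) (simp add: serre_def rootvec_Suc fa_mult_simps fscale_apply algebra_simps)
  moreover have "serre q ?b ?a \<in> I" using 0 by (intro e_serre) auto
  ultimately show ?case by (simp add: qcomm_def I_scale I_neg)
next
  case (Suc d)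
  have "qcomm (1 * q) (e (k + Suc (Suc d))) (rv k (Suc (Suc d)))"
    unfolding rootvec_Suc[of q e k "Suc d"]
    using Suc.IH[of "Suc k"] Suc.prems by (intro qcomm_bracket e_comm) auto
  then show ?case by simp
qed

text \<open>Both roots end at the same index. All simple vectors of the shorter root except the last
  are inner to the longer one and commute with it, so a single factor \<open>inverse q\<close>
  remains. This is what allows root vectors with a common end to be sorted.\<close>

lemma rv_qcomm_rv:
  "k < l \<Longrightarrow> k + m = l + d \<Longrightarrow> l + d < n \<Longrightarrow> qcomm (inverse q) (rv k m) (rv l d)"
proof (induction d arbitrary: l)
  case 0
  then obtain m' where m: "m = Suc m'" by (cases m) auto
  have "qcomm q (e (k + Suc m')) (rv k (Suc m'))" using 0 m by (intro rv_qcomm_last) auto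
  then show ?case using qcomm_sym[OF _ q_nz] 0 m by auto
next
  case (Suc d)
  have "qcomm (1::complex) (e l) (rv k m)" using Suc.prems by (intro rv_comm_inner) auto
  then have 1: "qcomm (1::complex) (rv k m) (e l)" using qcomm_sym[of 1] by simp
  have "qcomm (1 * inverse q) (rv k m) (rv l (Suc d))"
    unfolding rootvec_Suc[of q e l d] using Suc by (intro qcomm_bracket 1) auto
  then show ?case by simp
qed

end

section \<open>Ordered monomials in root vectors and straightening\<close>

definition spread :: "('r \<Rightarrow> nat) \<Rightarrow> 'r list \<Rightarrow> 'r list" where
  "spread c rs = concat (map (\<lambda>r. replicate (c r) r) rs)"

lemma spread_simps [simp]:
  "spread c [] = []" "spread c (r # rs) = replicate (c r) r @ spread c rs"
  "spread c (rs @ ss) = spread c rs @ spread c ss"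
  by (simp_all add: spread_def)

lemma set_spread: "set (spread c rs) \<subseteq> set rs"
  by (auto simp: spread_def)

lemma spread_cong: "(\<And>r. r \<in> set rs \<Longrightarrow> c r = c' r) \<Longrightarrow> spread c rs = spread c' rs"
  by (induction rs) auto

lemma map_spread: "map f (spread (\<lambda>r. c (f r)) rs) = spread c (map f rs)"
  by (induction rs) auto

lemma sorted_spread: "sorted rs \<Longrightarrow> sorted (spread c rs)"
  using set_spread[of c] by (induction rs) (fastforce simp: sorted_append)+

lemma count_spread: "distinct rs \<Longrightarrow>
    count (mset (spread c rs)) x = (if x \<in> set rs then c x else 0)"
  by (induction rs) auto

lemma spread_count:
  assumes "sorted ks" "set ks \<subseteq> {..<m}"
  shows "spread (count (mset ks)) [0..<m] = (ks :: nat list)"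
proof -
  have "mset (spread (count (mset ks)) [0..<m]) = mset ks"
  proof (rule multiset_eqI)
    fix x show "count (mset (spread (count (mset ks)) [0..<m])) x = count (mset ks) x"
      using assms(2) count_spread[of "[0..<m]" "count (mset ks)" x]
      by (auto simp: count_eq_zero_iff)
  qed
  then show ?thesis
    using properties_for_sort[of "spread (count (mset ks)) [0..<m]" ks] assms(1)
      sorted_spread[of "[0..<m]"] by (simp add: sorted_sort_id)
qed

text \<open>The entry \<open>(k, d)\<close> stands for the root from \<open>k\<close> to
  \<open>k + d\<close>. Ordering by the last index first matches the straightening, which collects
  the root vectors with the largest last index at the right end.\<close>

definition roots :: "nat \<Rightarrow> (nat \<times> nat) list" where
  "roots J = concat (map (\<lambda>j. map (\<lambda>k. (k, j - k)) [0..<Suc j]) [0..<J])"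

lemma roots_Suc: "roots (Suc J) = roots J @ map (\<lambda>k. (k, J - k)) [0..<Suc J]"
  by (simp add: roots_def)

lemma set_roots: "set (roots J) = {(k, d). k + d < J}"
proof -
  have "(k, d) \<in> set (roots J) \<longleftrightarrow> k + d < J" for k d
    by (induction J) (auto simp: roots_def)
  then show ?thesis by auto
qed

lemma distinct_roots: "distinct (roots J)"
  using set_roots by (induction J) (auto simp: roots_Suc distinct_map inj_on_def, simp add: roots_def)

context fa_quotient
begin

lemma qcomm_span: "qcomm s x y \<Longrightarrow> x \<star> y \<in> spanI {y \<star> x}"
  unfolding qcomm_def by (rule spanI_cong) (auto intro: spanI_scale spanI_base)

end

context serre_system
begin

definition yv :: "nat \<Rightarrow> nat \<Rightarrow> 'g fa" where
  "yv j k = rv k (j - k)"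

text \<open>Counts the simple roots in a product of root vectors ending at \<open>j\<close>, that
  is, the letters it stands for. It is the degree that bounds the exponents in
  \<open>eprod_pbw\<close>.\<close>

definition ht :: "nat \<Rightarrow> nat list \<Rightarrow> nat" where
  "ht j ks = sum_list (map (\<lambda>k. Suc j - k) ks)"

lemma ht_simps [simp]: "ht j [] = 0" "ht j (k # ks) = Suc j - k + ht j ks"
  "ht j (ks @ ls) = ht j ks + ht j ls"
  by (simp_all add: ht_def)

lemma ht_mset: "mset ks = mset ls \<Longrightarrow> ht j ks = ht j ls"
  unfolding ht_def by (metis mset_map sum_mset_sum_list)

lemma yv_FA [simp]: "yv j k \<in> FA"
  by (simp add: yv_def)

lemma yprod_FA [simp]: "fa_prod (yv j) ks \<in> FA" and eprod_FA [simp]: "fa_prod e is \<in> FA"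
  by (auto intro: FA_prod)

text \<open>Up to a scalar \<open>e i\<close> passes every such root vector except the one starting
  right behind \<open>i\<close>. There the definition of \<open>rootvec\<close> is itself the
  exchange rule and produces the longer root vector \<open>yv j i\<close>.\<close>

lemma yv_mult_e:
  assumes "i < j" "k \<le> j" "j < n"
  shows "yv j k \<star> e i \<in> spanI (insert (e i \<star> yv j k) (if k = Suc i then {yv j i} else {}))"
proof (cases "k = Suc i")
  case True
  have "j - i = Suc (j - k)" using True assms by simp
  then have "yv j i = e i \<star> yv j k - fscale q (yv j k \<star> e i)"
    by (simp add: yv_def rootvec_Suc True)
  then have "yv j k \<star> e i = fscale (inverse q) (e i \<star> yv j k - yv j i)"
    using q_nz by (simp add: fun_eq_iff fscale_apply)
  then show ?thesis using True by (auto intro!: spanI_scale spanI_diff intro: spanI_base)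
next
  case False
  consider "i = k" | "k < i" | "i + 1 < k" using False by linarith
  then have "\<exists>s. s \<noteq> 0 \<and> qcomm s (e i) (yv j k)"
  proof cases
    case 1
    then obtain d where "j - k = Suc d" using assms by (cases "j - k") auto
    then show ?thesis using rv_qcomm_first[of k d] 1 assms q_nz
      by (intro exI[of _ "inverse q"]) (auto simp: yv_def)
  next
    case 2
    then show ?thesis using rv_comm_inner[of k i "j - k"] assms
      by (intro exI[of _ 1]) (auto simp: yv_def)
  next
    case 3
    then show ?thesis using rv_comm_below[of i k "j - k"] assms
      by (intro exI[of _ 1]) (auto simp: yv_def)
  qed
  then show ?thesis using qcomm_span[OF qcomm_sym] False by auto
qed

text \<open>On its way to the left \<open>e i\<close> either gets past all factors or is absorbed by
  one of them, which then contains one more simple root.\<close>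

lemma yprod_mult_e:
  assumes "i < j" "j < n" "set ks \<subseteq> {..j}"
  shows "fa_prod (yv j) ks \<star> e i \<in> spanI (insert (e i \<star> fa_prod (yv j) ks)
    {fa_prod (yv j) ls | ls. set ls \<subseteq> {..j} \<and> ht j ls = Suc (ht j ks)})"
  using assms(3)
proof (induction ks)
  case Nil then show ?case by (auto intro: spanI_base)
next
  case (Cons k ks)
  let ?S = "insert (e i \<star> fa_prod (yv j) (k # ks))
    {fa_prod (yv j) ls | ls. set ls \<subseteq> {..j} \<and> ht j ls = Suc (ht j (k # ks))}"
  have k: "k \<le> j" using Cons.prems by simp
  have "yv j k \<star> (fa_prod (yv j) ks \<star> e i) \<in> spanI ?S"
  proof (rule spanI_lmult[OF yv_FA Cons.IH], goal_cases)
    case 1 then show ?case using Cons.prems by simp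
  next
    case (2 y)
    then consider "y = e i \<star> fa_prod (yv j) ks"
      | ls where "y = fa_prod (yv j) ls" "set ls \<subseteq> {..j}" "ht j ls = Suc (ht j ks)" by auto
    then show ?case
    proof cases
      case 1
      have "(yv j k \<star> e i) \<star> fa_prod (yv j) ks \<in> spanI ?S"
      proof (rule spanI_rmult[OF _ yv_mult_e[OF assms(1) k assms(2)]], goal_cases)
        case (2 z)
        show ?case
        proof (cases "z = e i \<star> yv j k")
          case True then show ?thesis by (auto intro: spanI_base simp: fa_mult_assoc)
        next
          case False
          then have "z = yv j i" "k = Suc i" using 2 by (auto split: if_splits)
          then have "z \<star> fa_prod (yv j) ks = fa_prod (yv j) (i # ks)" by simp
          moreover have "ht j (i # ks) = Suc (ht j (k # ks))" using \<open>k = Suc i\<close> assms by simp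
          ultimately show ?thesis using assms Cons.prems
            by (intro spanI_base insertI2) (fastforce intro!: exI[of _ "i # ks"])
        qed
      qed simp
      then show ?thesis by (simp add: 1 fa_mult_assoc)
    next
      case 2
      then have "yv j k \<star> y = fa_prod (yv j) (k # ls)" "set (k # ls) \<subseteq> {..j}"
        "ht j (k # ls) = Suc (ht j (k # ks))" using k by auto
      then show ?thesis by (intro spanI_base insertI2) blast
    qed
  qed
  then show ?case by (simp add: fa_mult_assoc)
qed

lemma yv_swap: "k \<le> j \<Longrightarrow> l \<le> j \<Longrightarrow> j < n \<Longrightarrow> yv j k \<star> yv j l \<in> spanI {yv j l \<star> yv j k}"
proof (cases k l rule: linorder_cases)
  case less
  assume "k \<le> j" "l \<le> j" "j < n"
  with less show ?thesis
    unfolding yv_def by (intro qcomm_span[of "inverse q"] rv_qcomm_rv) auto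
next
  case greater
  assume "k \<le> j" "l \<le> j" "j < n"
  with greater have "qcomm (inverse q) (rv l (j - l)) (rv k (j - k))"
    by (intro rv_qcomm_rv) auto
  then show ?thesis
    using qcomm_span[OF qcomm_sym] q_nz unfolding yv_def by simp
qed (auto intro: spanI_base)

lemma yprod_insort:
  assumes "k \<le> j" "set ks \<subseteq> {..j}" "j < n"
  shows "fa_prod (yv j) (k # ks) \<in> spanI {fa_prod (yv j) (insort k ks)}"
  using assms(2)
proof (induction ks)
  case Nil then show ?case by (auto intro: spanI_base)
next
  case (Cons l ks)
  show ?case
  proof (cases "k \<le> l")
    case True then show ?thesis by (auto intro: spanI_base)
  next
    case False
    have "yv j l \<star> fa_prod (yv j) (k # ks) \<in> spanI {yv j l \<star> fa_prod (yv j) (insort k ks)}"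
      using Cons by (intro spanI_lmult[OF yv_FA Cons.IH]) (auto intro: spanI_base)
    moreover have "(yv j k \<star> yv j l) \<star> fa_prod (yv j) ks
        \<in> spanI {yv j l \<star> fa_prod (yv j) (k # ks)}"
      using Cons.prems assms
      by (intro spanI_rmult[OF _ yv_swap]) (auto intro: spanI_base simp: fa_mult_assoc)
    ultimately show ?thesis using False
      by (auto intro: spanI_trans simp: fa_mult_assoc)
  qed
qed

lemma yprod_sort:
  "set ks \<subseteq> {..j} \<Longrightarrow> j < n \<Longrightarrow> fa_prod (yv j) ks \<in> spanI {fa_prod (yv j) (sort ks)}"
proof (induction ks)
  case (Cons k ks)
  have "yv j k \<star> fa_prod (yv j) ks \<in> spanI {fa_prod (yv j) (k # sort ks)}"
    using Cons by (intro spanI_lmult[OF yv_FA Cons.IH]) (auto intro: spanI_base)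
  moreover have "fa_prod (yv j) (k # sort ks) \<in> spanI {fa_prod (yv j) (insort k (sort ks))}"
    using Cons by (intro yprod_insort) auto
  ultimately show ?case by (auto intro: spanI_trans)
qed (auto intro: spanI_base)

text \<open>Letters are processed from left to right. A letter \<open>j\<close> is the root vector
  \<open>yv j j\<close>, last in the order, and is appended; a smaller letter travels left. Each
  letter becomes one unit of length or of height, so the total remains
  \<open>length w\<close>.\<close>

lemma eprod_stage:
  assumes "j < n" "set w \<subseteq> {..j}"
  shows "fa_prod e w \<in> spanI {fa_prod e u \<star> fa_prod (yv j) ks | u ks.
     set u \<subseteq> {..<j} \<and> set ks \<subseteq> {..j} \<and> sorted ks \<and> length u + ht j ks = length w}"
  (is "_ \<in> spanI (?S (length w))")
  using assms(2)
proof (induction w rule: rev_induct)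
  case Nil
  have "fa_one = fa_prod e [] \<star> fa_prod (yv j) []" by simp
  then have "fa_one \<in> ?S 0" by fastforce
  then show ?case by (auto intro: spanI_base)
next
  case (snoc i w)
  have "fa_prod e w \<star> e i \<in> spanI (?S (Suc (length w)))"
  proof (rule spanI_rmult[OF e_FA snoc.IH], goal_cases)
    case 1 then show ?case using snoc.prems by simp
  next
    case (2 y)
    then obtain u ks where y: "y = fa_prod e u \<star> fa_prod (yv j) ks" "set u \<subseteq> {..<j}"
      "set ks \<subseteq> {..j}" "sorted ks" "length u + ht j ks = length w" by blast
    show ?case
    proof (cases "i = j")
      case True
      have "y \<star> e i = fa_prod e u \<star> fa_prod (yv j) (ks @ [j])"
        by (simp add: y True fa_prod_append fa_mult_assoc yv_def)
      moreover have "sorted (ks @ [j])" using y(3,4) by (auto simp: sorted_append)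
      ultimately have "y \<star> e i \<in> ?S (Suc (length w))"
        using y by (intro CollectI exI[of _ u] exI[of _ "ks @ [j]"]) auto
      then show ?thesis by (rule spanI_base)
    next
      case False
      then have i: "i < j" using snoc.prems by auto
      have "fa_prod e u \<star> (fa_prod (yv j) ks \<star> e i) \<in> spanI (?S (Suc (length w)))"
      proof (rule spanI_lmult[OF _ yprod_mult_e[OF i assms(1) y(3)]], goal_cases)
        case (2 z)
        then consider "z = e i \<star> fa_prod (yv j) ks"
          | ls where "z = fa_prod (yv j) ls" "set ls \<subseteq> {..j}" "ht j ls = Suc (ht j ks)" by auto
        then show ?case
        proof cases
          case 1
          have "fa_prod e u \<star> z = fa_prod e (u @ [i]) \<star> fa_prod (yv j) ks"
            by (simp add: 1 fa_prod_append fa_mult_assoc)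
          then have "fa_prod e u \<star> z \<in> ?S (Suc (length w))"
            using y i by (intro CollectI exI[of _ "u @ [i]"] exI[of _ ks]) auto
          then show ?thesis by (rule spanI_base)
        next
          case 2
          have "ht j (sort ls) = ht j ls" by (rule ht_mset) simp
          then have "fa_prod e u \<star> fa_prod (yv j) (sort ls) \<in> ?S (Suc (length w))"
            using y 2 by (intro CollectI exI[of _ u] exI[of _ "sort ls"]) auto
          then show ?thesis unfolding 2(1)
            by (intro spanI_lmult[OF _ yprod_sort[OF 2(2) assms(1)]]) (auto intro: spanI_base)
        qed
      qed simp
      then show ?thesis by (simp add: y(1) fa_mult_assoc)
    qed
  qed
  then show ?case by (simp add: fa_prod_append)
qed

lemma count_le_ht: "set ks \<subseteq> {..j} \<Longrightarrow> count (mset ks) k \<le> ht j ks"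
  by (induction ks) auto

text \<open>Stages run from the largest index downwards: the left factor left over by
  \<open>eprod_stage\<close> has smaller letters only. The bound on the exponents is carried along
  for the upper growth bound.\<close>

lemma eprod_pbw:
  assumes "J \<le> n" "set w \<subseteq> {..<J}"
  shows "fa_prod e w \<in> spanI {fa_prod (case_prod rv) (spread c (roots J)) | c.
    \<forall>r. c r \<le> length w}"
  using assms
proof (induction J arbitrary: w)
  case 0
  have "fa_prod (case_prod rv) (spread (\<lambda>_. 0) (roots 0)) = fa_prod e w"
    using 0 by (simp add: roots_def)
  then show ?case by (intro spanI_base CollectI exI[of _ "\<lambda>_. 0"]) auto
next
  case (Suc j)
  have j: "j < n" and w: "set w \<subseteq> {..j}" using Suc.prems by auto
  show ?case
  proof (rule spanI_trans[OF eprod_stage[OF j w]], goal_cases)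
    case (1 y)
    then obtain u ks where y: "y = fa_prod e u \<star> fa_prod (yv j) ks" "set u \<subseteq> {..<j}"
      "set ks \<subseteq> {..j}" "sorted ks" "length u + ht j ks = length w" by blast
    show ?case unfolding y(1)
    proof (rule spanI_rmult[OF _ Suc.IH[OF less_imp_le[OF j] y(2)]], goal_cases)
      case (2 z)
      then obtain c where z: "z = fa_prod (case_prod rv) (spread c (roots j))"
        "\<And>r. c r \<le> length u" by auto
      \<comment> \<open>Roots ending at \<open>j\<close> take their exponents from the present
        stage, all others from the induction hypothesis.\<close>
      define c' where "c' = (\<lambda>(k, d). if k + d = j then count (mset ks) k else c (k, d))"
      have 1: "spread c' (roots j) = spread c (roots j)"
        by (rule spread_cong) (auto simp: c'_def set_roots)
      have "spread c' (map (\<lambda>k. (k, j - k)) [0..<Suc j])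
          = map (\<lambda>k. (k, j - k)) (spread (\<lambda>k. c' (k, j - k)) [0..<Suc j])"
        by (rule map_spread[symmetric])
      also have "spread (\<lambda>k. c' (k, j - k)) [0..<Suc j] = spread (count (mset ks)) [0..<Suc j]"
        by (rule spread_cong) (auto simp: c'_def)
      also have "\<dots> = ks" using y(3,4) by (intro spread_count) auto
      finally have 2: "fa_prod (case_prod rv) (spread c' (map (\<lambda>k. (k, j - k)) [0..<Suc j]))
          = fa_prod (yv j) ks"
        by (simp add: fa_prod_def foldr_map comp_def yv_def)
      have "z \<star> fa_prod (yv j) ks = fa_prod (case_prod rv) (spread c' (roots (Suc j)))"
        unfolding roots_Suc spread_simps fa_prod_append 1 2 z(1) ..
      moreover have "c' r \<le> length w" for r
        using count_le_ht[OF y(3), of "fst r"] z(2)[of r] y(5)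
        by (cases r) (auto simp: c'_def)
      ultimately show ?case by (intro spanI_base) blast
    qed simp
  qed
qed

end

section \<open>Spanning monomials of the quantized enveloping algebra\<close>

lemma fa_ideal_quotient: "fa_quotient (fa_ideal R)"
proof
  show "fs.subspace (fa_ideal R)"
    using fa_ideal.zero[of R] fa_ideal.add[of _ R] fa_ideal.scale[of _ R]
    by (auto simp: fs.subspace_def fa_ops)
qed (auto intro: fa_ideal.intros)

lemma FA_sum_list: "(\<And>x. x \<in> set xs \<Longrightarrow> x \<in> FA) \<Longrightarrow> sum_list xs \<in> FA"
proof (induction xs)
  case Nil show ?case by (simp only: sum_list.Nil FA_zero)
next
  case (Cons x xs)
  then have "x + sum_list xs \<in> FA" by (intro FA_add) auto
  then show ?case by (simp only: sum_list.Cons)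
qed

lemma lin_FA: "lin ts \<in> FA"
  unfolding lin_word by (rule FA_sum_list) (auto intro: FA_scale)

lemma Uq_sl_rel_FA: "Uq_sl_rel q N \<subseteq> FA"
  by (auto simp: Uq_sl_rel_def lin_FA)

lemma fa_prod_word: "fa_prod (\<lambda>i. word [f i]) is = word (map f is)"
proof (induction "is")
  case (Cons i "is") then show ?case by (simp add: word_Cons[of "f i" "map f is"])
qed (simp add: word_Nil)

context fa_quotient
begin

lemma qcomm_inverse:
  assumes "qcomm s k x" "k \<star> k' - fa_one \<in> I" "k' \<star> k - fa_one \<in> I" "s \<noteq> 0"
    and "k \<in> FA" "k' \<in> FA" "x \<in> FA"
  shows "qcomm (inverse s) k' x"
proof -
  have "k' \<star> x - fscale (inverse s) (x \<star> k') =
      fscale (inverse s) ((k' \<star> k - fa_one) \<star> x \<star> k') - (k' \<star> x) \<star> (k \<star> k' - fa_one)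
      - fscale (inverse s) (k' \<star> (k \<star> x - fscale s (x \<star> k)) \<star> k')"
    using assms(4) by (intro ext) (simp add: fa_mult_simps fscale_apply field_simps)
  then show ?thesis
    using assms by (simp add: qcomm_def I_diff I_scale I_lmult I_rmult FA_mult)
qed

lemma qcomm_conj:
  assumes "k \<star> x \<star> k' - fscale s x \<in> I" "k' \<star> k - fa_one \<in> I"
    and "k \<in> FA" "k' \<in> FA" "x \<in> FA"
  shows "qcomm s k x"
proof -
  have "k \<star> x - fscale s (x \<star> k) =
      (k \<star> x \<star> k' - fscale s x) \<star> k - (k \<star> x) \<star> (k' \<star> k - fa_one)"
    by (intro ext) (simp add: fa_mult_simps fscale_apply field_simps)
  then show ?thesis
    using assms by (simp add: qcomm_def I_diff I_scale I_lmult I_rmult FA_mult)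
qed

lemma qcomm_prod_span:
  assumes "\<And>x. x \<in> set xs \<Longrightarrow> \<exists>s. s \<noteq> 0 \<and> qcomm s (word [g]) (word [x])"
  shows "word [g] \<star> word xs \<in> spanI {word xs \<star> word [g]}"
    and "word xs \<star> word [g] \<in> spanI {word [g] \<star> word xs}"
proof -
  have "\<exists>s. s \<noteq> 0 \<and> qcomm s (word [g]) (word xs)"
    using assms
  proof (induction xs)
    case Nil
    show ?case by (auto intro!: exI[of _ 1] simp: qcomm_def word_Nil I_zero)
  next
    case (Cons x xs)
    obtain s where s: "s \<noteq> 0" "qcomm s (word [g]) (word [x])" using Cons.prems by auto
    have "\<exists>t. t \<noteq> 0 \<and> qcomm t (word [g]) (word xs)"
      by (rule Cons.IH) (rule Cons.prems, simp)
    then obtain t where t: "t \<noteq> 0" "qcomm t (word [g]) (word xs)" by blast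
    have "qcomm (s * t) (word [g]) (word (x # xs))"
      using qcomm_mult[OF s(2) t(2)] by (simp add: word_Cons[of x xs])
    then show ?case using s(1) t(1) by (intro exI[of _ "s * t"]) simp
  qed
  then obtain s where s: "s \<noteq> 0" "qcomm s (word [g]) (word xs)" by blast
  show "word [g] \<star> word xs \<in> spanI {word xs \<star> word [g]}"
    using s(2) by (rule qcomm_span)
  show "word xs \<star> word [g] \<in> spanI {word [g] \<star> word xs}"
    using qcomm_sym[OF s(2,1)] by (rule qcomm_span)
qed

end

datatype pbw_index = FR "nat \<times> nat" | KR nat | ER "nat \<times> nat"

fun index :: "gen \<Rightarrow> nat" where
  "index (E i) = i" | "index (F i) = i" | "index (K i) = i" | "index (Kinv i) = i"

fun torus_gen :: "gen \<Rightarrow> bool" where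
  "torus_gen (K i) = True" | "torus_gen (Kinv i) = True" | "torus_gen _ = False"

definition torus_block :: "(nat \<Rightarrow> int) \<Rightarrow> nat \<Rightarrow> gen list" where
  "torus_block z i = replicate (nat (z i)) (K i) @ replicate (nat (- z i)) (Kinv i)"

definition torus_word :: "nat \<Rightarrow> (nat \<Rightarrow> int) \<Rightarrow> gen list" where
  "torus_word n z = concat (map (torus_block z) [0..<n])"

locale uq_sl =
  fixes q :: complex and N :: nat
  assumes q_nonzero: "q \<noteq> 0" and q_generic: "\<And>m::nat. m > 0 \<Longrightarrow> q ^ m \<noteq> 1"
    and N_ge_2: "N \<ge> 2"
begin

definition n :: nat where "n = N - 1"

abbreviation "Uq_ideal \<equiv> fa_ideal (Uq_sl_rel q N)"

sublocale fa_quotient Uq_ideal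
  by (rule fa_ideal_quotient)

lemma q_sum_nonzero: "q + inverse q \<noteq> 0"
proof
  assume "q + inverse q = 0"
  then have "q * q = - 1" using q_nonzero by (simp add: field_simps eq_neg_iff_add_eq_0)
  then have "q ^ 4 = 1" by (simp add: eval_nat_numeral mult.assoc[symmetric])
  then show False using q_generic[of 4] by simp
qed

lemma q_diff_nonzero: "q - inverse q \<noteq> 0"
proof
  assume "q - inverse q = 0"
  then have "q ^ 2 = 1" using q_nonzero by (simp add: field_simps power2_eq_square)
  then show False using q_generic[of 2] by simp
qed

lemma lin_in_ideal: "lin ts \<in> Uq_sl_rel q N \<Longrightarrow>
    sum_list (map (\<lambda>(c, u). fscale c (word u)) ts) \<in> Uq_ideal"
  using fa_ideal.gen[of "lin ts"] by (simp add: lin_word)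

lemma word2: "word [a, b] = word [a] \<star> word [b]"
  and word3: "word [a, b, c] = word [a] \<star> word [b] \<star> word [c]"
  by (simp_all flip: word_append)

lemma Uq_relations:
  "i < n \<Longrightarrow> lin [(1, [K i, Kinv i]), (-1, [])] \<in> Uq_sl_rel q N"
  "i < n \<Longrightarrow> lin [(1, [Kinv i, K i]), (-1, [])] \<in> Uq_sl_rel q N"
  "i < n \<Longrightarrow> j < n \<Longrightarrow> lin [(1, [K i, K j]), (-1, [K j, K i])] \<in> Uq_sl_rel q N"
  "i < n \<Longrightarrow> j < n \<Longrightarrow>
    lin [(1, [K i, E j, Kinv i]), (- (q powi cartan i j), [E j])] \<in> Uq_sl_rel q N"
  "i < n \<Longrightarrow> j < n \<Longrightarrow>
    lin [(1, [K i, F j, Kinv i]), (- (q powi (- cartan i j)), [F j])] \<in> Uq_sl_rel q N"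
  "i < n \<Longrightarrow> j < n \<Longrightarrow> i \<noteq> j \<Longrightarrow> lin [(1, [E i, F j]), (-1, [F j, E i])] \<in> Uq_sl_rel q N"
  "i < n \<Longrightarrow> lin [(1, [E i, F i]), (-1, [F i, E i]), (- 1 / (q - inverse q), [K i]),
      (1 / (q - inverse q), [Kinv i])] \<in> Uq_sl_rel q N"
  "i < n \<Longrightarrow> j < n \<Longrightarrow> cartan i j = -1 \<Longrightarrow>
    lin [(1, [E i, E i, E j]), (- (q + inverse q), [E i, E j, E i]), (1, [E j, E i, E i])]
      \<in> Uq_sl_rel q N"
  "i < n \<Longrightarrow> j < n \<Longrightarrow> cartan i j = -1 \<Longrightarrow>
    lin [(1, [F i, F i, F j]), (- (q + inverse q), [F i, F j, F i]), (1, [F j, F i, F i])]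
      \<in> Uq_sl_rel q N"
  "i < n \<Longrightarrow> j < n \<Longrightarrow> cartan i j = 0 \<Longrightarrow>
    lin [(1, [E i, E j]), (-1, [E j, E i])] \<in> Uq_sl_rel q N"
  "i < n \<Longrightarrow> j < n \<Longrightarrow> cartan i j = 0 \<Longrightarrow>
    lin [(1, [F i, F j]), (-1, [F j, F i])] \<in> Uq_sl_rel q N"
  "n \<le> i \<Longrightarrow> g \<in> {E i, F i, K i, Kinv i} \<Longrightarrow> lin [(1, [g])] \<in> Uq_sl_rel q N"
  unfolding Uq_sl_rel_def n_def
  by (((rule UnI2)?, intro CollectI exI conjI, rule refl, assumption+) | rule UnI1)+

lemmas ideal_relations = Uq_relations[THEN lin_in_ideal]

lemma K_Kinv: "i < n \<Longrightarrow> word [K i] \<star> word [Kinv i] - fa_one \<in> Uq_ideal"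
  and Kinv_K: "i < n \<Longrightarrow> word [Kinv i] \<star> word [K i] - fa_one \<in> Uq_ideal"
  using ideal_relations(1,2)[of i] by (simp_all add: word2 word_Nil)

lemma out_of_range: "n \<le> index g \<Longrightarrow> word [g] \<in> Uq_ideal"
  using ideal_relations(12)[of "index g" g] by (cases g) simp_all

lemma K_K: "i < n \<Longrightarrow> j < n \<Longrightarrow> qcomm 1 (word [K i]) (word [K j])"
  using ideal_relations(3)[of i j] by (simp add: word2 qcomm_def)

lemma K_E: "i < n \<Longrightarrow> j < n \<Longrightarrow> qcomm (q powi cartan i j) (word [K i]) (word [E j])"
  using ideal_relations(4)[of i j] by (intro qcomm_conj[OF _ Kinv_K]) (simp_all add: word3)

lemma K_F: "i < n \<Longrightarrow> j < n \<Longrightarrow> qcomm (q powi (- cartan i j)) (word [K i]) (word [F j])"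
  using ideal_relations(5)[of i j] by (intro qcomm_conj[OF _ Kinv_K]) (simp_all add: word3)

lemma E_F: "i < n \<Longrightarrow> j < n \<Longrightarrow> i \<noteq> j \<Longrightarrow> qcomm 1 (word [E i]) (word [F j])"
  using ideal_relations(6)[of i j] by (simp add: word2 qcomm_def)

lemma E_F_same:
  assumes "i < n"
  shows "word [E i] \<star> word [F i] - (word [F i] \<star> word [E i]
    + fscale (1 / (q - inverse q)) (word [K i]) - fscale (1 / (q - inverse q)) (word [Kinv i]))
    \<in> Uq_ideal"
  using ideal_relations(7)[OF assms] by (simp add: word2 algebra_simps)

lemma cartan_adjacent: "cartan i j = -1 \<longleftrightarrow> i + 1 = j \<or> j + 1 = i"
  and cartan_far: "cartan i j = 0 \<longleftrightarrow> i + 1 < j \<or> j + 1 < i"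
  by (auto simp: cartan_def)

lemma serre_system_E: "serre_system Uq_ideal q n (\<lambda>i. word [E i])"
proof
  fix i j assume "i < n" "j < n" "i + 1 < j \<or> j + 1 < i"
  then show "qcomm 1 (word [E i]) (word [E j])"
    using ideal_relations(10)[of i j] by (simp add: word2 qcomm_def cartan_far)
next
  fix i j assume "i < n" "j < n" "i + 1 = j \<or> j + 1 = i"
  then show "serre q (word [E i]) (word [E j]) \<in> Uq_ideal"
    using ideal_relations(8)[of i j] by (simp add: word3 serre_def cartan_adjacent algebra_simps)
qed (auto simp: q_nonzero q_sum_nonzero)

text \<open>The simple roots are numbered backwards so that these root vectors fit the mirrored
  terms \<open>xF_mirror\<close>. Adjacency is invariant under the reversal, hence the relations
  persist.\<close>

lemma serre_system_F: "serre_system Uq_ideal q n (\<lambda>i. word [F (n - 1 - i)])"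
proof
  fix i j assume "i < n" "j < n" "i + 1 < j \<or> j + 1 < i"
  then have "cartan (n - 1 - i) (n - 1 - j) = 0" by (auto simp: cartan_far)
  then show "qcomm 1 (word [F (n - 1 - i)]) (word [F (n - 1 - j)])"
    using ideal_relations(11)[of "n - 1 - i" "n - 1 - j"] \<open>i < n\<close>
    by (simp add: word2 qcomm_def)
next
  fix i j assume "i < n" "j < n" "i + 1 = j \<or> j + 1 = i"
  then have "cartan (n - 1 - i) (n - 1 - j) = -1" by (auto simp: cartan_adjacent)
  then show "serre q (word [F (n - 1 - i)]) (word [F (n - 1 - j)]) \<in> Uq_ideal"
    using ideal_relations(9)[of "n - 1 - i" "n - 1 - j"] \<open>i < n\<close>
    by (simp add: word3 serre_def algebra_simps)
qed (auto simp: q_nonzero q_sum_nonzero)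

lemma torus_qcomm:
  assumes "torus_gen g" "index g < n" "index x < n"
  shows "\<exists>s. s \<noteq> 0 \<and> qcomm s (word [g]) (word [x])"
proof -
  define sc where "sc g x \<longleftrightarrow> (\<exists>s. s \<noteq> 0 \<and> qcomm s (word [g]) (word [x]))" for g x
  have scI: "sc g x" if "qcomm s (word [g]) (word [x])" "s \<noteq> 0" for g x s
    using that unfolding sc_def by blast
  have sc_sym: "sc x g" if sc: "sc g x" for g x
  proof -
    obtain s where s: "s \<noteq> 0" "qcomm s (word [g]) (word [x])" using sc unfolding sc_def by blast
    show ?thesis by (rule scI[OF qcomm_sym[OF s(2,1)]]) (use s in simp)
  qed
  have inv: "sc (Kinv i) x" if sc: "sc (K i) x" and i: "i < n" for i x
  proof -
    obtain s where s: "s \<noteq> 0" "qcomm s (word [K i]) (word [x])" using sc unfolding sc_def by blast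
    have "qcomm (inverse s) (word [Kinv i]) (word [x])"
      by (rule qcomm_inverse[OF s(2) K_Kinv[OF i] Kinv_K[OF i] s(1)]) simp_all
    then show ?thesis by (rule scI) (use s in simp)
  qed
  have K: "sc (K i) x" if i: "i < n" for i
  proof (cases x)
    case (E j) then show ?thesis using scI[OF K_E[of i j]] i assms(3) q_nonzero by simp
  next
    case (F j) then show ?thesis using scI[OF K_F[of i j]] i assms(3) q_nonzero by simp
  next
    case (K j) then show ?thesis using scI[OF K_K[of i j]] i assms(3) by simp
  next
    case (Kinv j)
    then have j: "j < n" using assms(3) by simp
    have "sc (K j) (K i)" using scI[OF K_K[OF j i]] by simp
    then show ?thesis unfolding Kinv by (rule sc_sym[OF inv[OF _ j]])
  qed
  have "sc g x" using assms(1,2) K inv by (cases g) auto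
  then show ?thesis unfolding sc_def .
qed

text \<open>\<open>F i\<close> passes \<open>E j\<close> freely unless \<open>i = j\<close>. Where
  it meets \<open>E i\<close>, the commutator trades the two letters for \<open>K i\<close> or
  \<open>Kinv i\<close>, which moves to the front up to a scalar; this accounts for the shorter
  \<open>v'\<close>.\<close>

lemma E_word_mult_F:
  assumes "i < n" "set v \<subseteq> {..<n}"
  shows "word (map E v) \<star> word [F i] \<in> spanI (insert (word [F i] \<star> word (map E v))
    {word [g] \<star> word (map E v') | g v'. torus_gen g \<and> index g = i \<and>
       set v' \<subseteq> {..<n} \<and> length v' < length v})"
  using assms(2)
proof (induction v)
  case Nil then show ?case by (auto simp: word_Nil intro: spanI_base)
next
  case (Cons j v)
  let ?S = "\<lambda>v. {word [g] \<star> word (map E v') | g v'. torus_gen g \<and> index g = i \<and>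
       set v' \<subseteq> {..<n} \<and> length v' < length v}"
  let ?T = "insert (word [F i] \<star> word (map E (j # v))) (?S (j # v))"
  have j: "j < n" and v: "set v \<subseteq> {..<n}" using Cons.prems by auto
  have "word [E j] \<star> (word (map E v) \<star> word [F i]) \<in> spanI ?T"
  proof (rule spanI_lmult[OF _ Cons.IH[OF v]], goal_cases)
    case (2 y)
    then consider "y = word [F i] \<star> word (map E v)"
      | g v' where "y = word [g] \<star> word (map E v')" "torus_gen g" "index g = i"
        "set v' \<subseteq> {..<n}" "length v' < length v" by auto
    then show ?case
    proof cases
      case 1
      have top: "word [F i] \<star> word [E j] \<star> word (map E v) \<in> spanI ?T"
        by (auto intro!: spanI_base simp: word_Cons[of "E j" "map E v"] fa_mult_assoc)
      have "(word [E j] \<star> word [F i]) \<star> word (map E v) \<in> spanI ?T"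
      proof (cases "i = j")
        case True
        let ?c = "1 / (q - inverse q)" and ?w = "word (map E v)"
        have "word [K i] \<star> ?w \<in> spanI ?T"
          using v by (intro spanI_base insertI2 CollectI exI[of _ "K i"] exI[of _ v]) simp
        moreover have "word [Kinv i] \<star> ?w \<in> spanI ?T"
          using v by (intro spanI_base insertI2 CollectI exI[of _ "Kinv i"] exI[of _ v]) simp
        ultimately have *: "(word [F i] \<star> word [E i] + fscale ?c (word [K i])
            - fscale ?c (word [Kinv i])) \<star> ?w \<in> spanI ?T"
          using top True unfolding fa_mult_diff_left fa_mult_add_left fa_mult_scale_left
          by (intro spanI_diff spanI_add spanI_scale) simp_all
        show ?thesis
          by (rule spanI_cong[OF _ *])
            (use E_F_same[OF assms(1)] True in \<open>simp flip: fa_mult_diff_left add: I_rmult\<close>)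
      next
        case False
        then have "qcomm 1 (word [E j]) (word [F i])" using E_F assms j by auto
        from qcomm_span[OF this] show ?thesis
          by (rule spanI_rmult[rotated]) (use top in auto)
      qed
      then show ?thesis by (simp add: 1 fa_mult_assoc)
    next
      case 2
      have "\<exists>s. s \<noteq> 0 \<and> qcomm s (word [g]) (word [E j])"
        using torus_qcomm[of g "E j"] 2 assms j by auto
      then have "word [E j] \<star> word [g] \<in> spanI {word [g] \<star> word [E j]}"
        using qcomm_span qcomm_sym by blast
      then have "word [E j] \<star> word [g] \<star> word (map E v') \<in> spanI {word [g] \<star> word (map E (j # v'))}"
        by (rule spanI_rmult[rotated]) (auto intro: spanI_base simp: word_Cons[of "E j" "map E v'"] fa_mult_assoc)
      moreover have "word [g] \<star> word (map E (j # v')) \<in> ?T"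
        using 2 j by (intro insertI2 CollectI exI[of _ g] exI[of _ "j # v'"]) auto
      ultimately show ?thesis
        unfolding 2(1) fa_mult_assoc using spanI_mono[of "{word [g] \<star> word (map E (j # v'))}" ?T]
        by blast
    qed
  qed simp
  then show ?case by (simp add: word_Cons[of "E j" "map E v"] fa_mult_assoc)
qed

text \<open>The spanning half of the triangular decomposition. Appending one letter to the word
  increases the total length of the three parts by at most one, so degrees stay under
  control.\<close>

lemma triangular_span:
  "word w \<in> spanI {word (map F u) \<star> (word zs \<star> word (map E v)) | u zs v.
     set u \<subseteq> {..<n} \<and> set v \<subseteq> {..<n} \<and> (\<forall>g\<in>set zs. torus_gen g \<and> index g < n) \<and>
     length u + length zs + length v \<le> length w}"
  (is "_ \<in> spanI (?S (length w))")
proof (induction w rule: rev_induct)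
  case Nil
  have "word (map F []) \<star> (word [] \<star> word (map E [])) \<in> ?S 0"
    by (intro CollectI exI[of _ "[]"]) auto
  then show ?case by (intro spanI_base) (simp add: word_Nil)
next
  case (snoc g w)
  have inS: "word (map F u) \<star> (word zs \<star> word (map E v)) \<in> spanI (?S m)"
    if "set u \<subseteq> {..<n}" "set v \<subseteq> {..<n}" "\<forall>g\<in>set zs. torus_gen g \<and> index g < n"
      "length u + length zs + length v \<le> m" for u v zs m
    using that by (intro spanI_base) blast
  let ?m = "Suc (length w)"
  show ?case
  proof (cases "index g < n")
    case False
    then show ?thesis unfolding word_append
      by (intro spanI_I I_lmult out_of_range) auto
  next
    case True
    have "word w \<star> word [g] \<in> spanI (?S ?m)"
    proof (rule spanI_rmult[OF _ snoc.IH], goal_cases)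
      case (2 y)
      then obtain u zs v where y: "y = word (map F u) \<star> (word zs \<star> word (map E v))"
        and uv: "set u \<subseteq> {..<n}" "set v \<subseteq> {..<n}" "\<forall>g\<in>set zs. torus_gen g \<and> index g < n"
        "length u + length zs + length v \<le> length w" by blast
      have FAs: "word (map F u) \<star> word zs \<in> FA" by (intro FA_mult) auto
      have torus: "(word (map F u) \<star> word zs) \<star> (word [g] \<star> word (map E v')) \<in> spanI (?S ?m)"
        if "torus_gen g" "index g < n" "set v' \<subseteq> {..<n}" "length v' \<le> length v" for g v'
        using inS[of u v' "zs @ [g]" ?m] that uv by (simp add: word_append fa_mult_assoc)
      have "(word (map F u) \<star> word zs) \<star> (word (map E v) \<star> word [g]) \<in> spanI (?S ?m)"
      proof (cases "torus_gen g")
        case t: True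
        have "word (map E v) \<star> word [g] \<in> spanI {word [g] \<star> word (map E v)}"
          using torus_qcomm[OF t True] uv by (intro qcomm_prod_span) auto
        then show ?thesis
          by (rule spanI_lmult[OF FAs]) (use torus[OF t True uv(2)] in auto)
      next
        case False
        then consider i where "g = E i" | i where "g = F i" by (cases g) auto
        then show ?thesis
        proof cases
          case 1
          then show ?thesis using inS[of u "v @ [i]" zs ?m] uv True
            by (simp add: word_append fa_mult_assoc)
        next
          case (2 i)
          have i: "i < n" using 2 True by simp
          show ?thesis unfolding 2
          proof (rule spanI_lmult[OF FAs E_word_mult_F[OF i uv(2)]], goal_cases)
            case (1 z)
            then consider "z = word [F i] \<star> word (map E v)"
              | g v' where "z = word [g] \<star> word (map E v')" "torus_gen g" "index g = i"
                "set v' \<subseteq> {..<n}" "length v' < length v" by auto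
            then show ?case
            proof cases
              case 1
              have "\<exists>s. s \<noteq> 0 \<and> qcomm s (word [F i]) (word [x])" if "x \<in> set zs" for x
                using torus_qcomm[of x "F i"] uv(3) that i qcomm_sym
                by (metis index.simps(2) nonzero_imp_inverse_nonzero)
              then have "word zs \<star> word [F i] \<in> spanI {word [F i] \<star> word zs}"
                by (intro qcomm_prod_span) auto
              then have "(word zs \<star> word [F i]) \<star> word (map E v)
                  \<in> spanI {word [F i] \<star> (word zs \<star> word (map E v))}"
                by (rule spanI_rmult[rotated]) (auto intro: spanI_base simp: fa_mult_assoc)
              then have "word (map F u) \<star> ((word zs \<star> word [F i]) \<star> word (map E v)) \<in> spanI (?S ?m)"
                by (rule spanI_lmult[rotated])
                  (use inS[of "u @ [i]" v zs ?m] uv i in \<open>auto simp: word_append fa_mult_assoc\<close>)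
              then show ?thesis by (simp add: 1 fa_mult_assoc)
            next
              case 2
              then show ?thesis using torus[of g v'] i by simp
            qed
          qed
        qed
      qed
      then show ?case by (simp add: y fa_mult_assoc)
    qed simp
    then show ?thesis by (simp add: word_append)
  qed
qed

end

section \<open>Twisted group algebras\<close>

definition finsupp :: "('a \<Rightarrow> complex) set" where
  "finsupp = {x. finite {p. x p \<noteq> 0}}"

lemma finsupp_subspace: "fs.subspace finsupp"
proof -
  have "finite {p. x p + y p \<noteq> 0}" if "finite {p. x p \<noteq> 0}" "finite {p. y p \<noteq> 0}"
    for x y :: "'a \<Rightarrow> complex"
    by (rule finite_subset[OF _ finite_UnI[OF that]]) auto
  then show ?thesis by (auto simp: fs.subspace_def finsupp_def fscale_def)
qed

lemmas finsupp_scale = fs.subspace_scale[OF finsupp_subspace]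
  and finsupp_sum = fs.subspace_sum[OF finsupp_subspace]
  and finsupp_zero = fs.subspace_0[OF finsupp_subspace]

definition delta :: "'a \<Rightarrow> 'a \<Rightarrow> complex" where
  "delta p = (\<lambda>r. if p = r then 1 else 0)"

lemma delta_finsupp [simp]: "delta p \<in> finsupp"
  by (auto simp: finsupp_def delta_def)

lemma finsupp_expand:
  assumes "finite A" "{p. x p \<noteq> 0} \<subseteq> A"
  shows "x = (\<Sum>p\<in>A. fscale (x p) (delta p))"
proof
  fix r
  have "(\<Sum>p\<in>A. fscale (x p) (delta p)) r = (\<Sum>p\<in>A. if p = r then x p else 0)"
    by (simp add: sum_apply) (auto intro: sum.cong simp: fscale_def delta_def)
  also have "\<dots> = x r" using assms by (auto simp: sum.delta)
  finally show "x r = (\<Sum>p\<in>A. fscale (x p) (delta p)) r" by simp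
qed

definition leads :: "('g::linorder \<Rightarrow> complex) \<Rightarrow> 'g \<Rightarrow> bool" where
  "leads x p \<longleftrightarrow> x p \<noteq> 0 \<and> (\<forall>r. x r \<noteq> 0 \<longrightarrow> r \<le> p)"

lemma leads_unique: "leads x p \<Longrightarrow> leads x r \<Longrightarrow> p = r"
  unfolding leads_def by (meson antisym)

lemma leads_exists:
  assumes "x \<in> finsupp" "x \<noteq> 0" shows "\<exists>p. leads x p"
proof -
  have fin: "finite {p. x p \<noteq> 0}" and ne: "{p. x p \<noteq> 0} \<noteq> {}"
    using assms by (auto simp: finsupp_def)
  show ?thesis
    using Max_in[OF fin ne] Max_ge[OF fin] by (auto simp: leads_def)
qed

lemma leads_delta: "leads (delta p) p"
  by (auto simp: leads_def delta_def)

text \<open>The cocycle is a bicharacter. Multiplicativity in both arguments yields associativity;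
  that it never vanishes makes leading exponents additive under the translation invariant
  order.\<close>

locale twisted_group =
  fixes \<chi> :: "'g::linordered_ab_group_add \<Rightarrow> 'g \<Rightarrow> complex"
  assumes chi_add_left: "\<chi> (a + b) c = \<chi> a c * \<chi> b c"
    and chi_add_right: "\<chi> a (b + c) = \<chi> a b * \<chi> a c"
    and chi_nonzero: "\<chi> a b \<noteq> 0"
begin

text \<open>Summation over the support of the left factor alone makes right additivity
  unconditional. Left additivity changes that support and therefore requires
  \<open>finsupp\<close>.\<close>

definition tmult :: "('g \<Rightarrow> complex) \<Rightarrow> ('g \<Rightarrow> complex) \<Rightarrow> 'g \<Rightarrow> complex" (infixl "\<odot>" 70) where
  "x \<odot> y = (\<lambda>r. \<Sum>p | x p \<noteq> 0. x p * \<chi> p (r - p) * y (r - p))"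

lemma tmult_superset:
  "finite A \<Longrightarrow> {p. x p \<noteq> 0} \<subseteq> A \<Longrightarrow> (x \<odot> y) r = (\<Sum>p\<in>A. x p * \<chi> p (r - p) * y (r - p))"
  unfolding tmult_def by (rule sum.mono_neutral_left) auto

lemma tmult_zero_left [simp]: "0 \<odot> y = 0" and tmult_zero_right [simp]: "x \<odot> 0 = 0"
  by (auto simp: tmult_def)

lemma tmult_add_right: "x \<odot> (y + z) = x \<odot> y + x \<odot> z"
  and tmult_scale_right: "x \<odot> fscale c y = fscale c (x \<odot> y)"
  by (auto simp: tmult_def fscale_def fun_eq_iff algebra_simps sum.distrib sum_subtractf
      sum_distrib_left)

lemma tmult_add_left:
  assumes "x \<in> finsupp" "y \<in> finsupp" shows "(x + y) \<odot> z = x \<odot> z + y \<odot> z"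
proof
  fix r
  let ?A = "{p. x p \<noteq> 0} \<union> {p. y p \<noteq> 0}"
  have fin: "finite ?A" using assms by (auto simp: finsupp_def)
  have "((x + y) \<odot> z) r = (\<Sum>p\<in>?A. (x + y) p * \<chi> p (r - p) * z (r - p))"
    by (rule tmult_superset[OF fin]) auto
  moreover have "(x \<odot> z) r = (\<Sum>p\<in>?A. x p * \<chi> p (r - p) * z (r - p))"
    by (rule tmult_superset[OF fin]) auto
  moreover have "(y \<odot> z) r = (\<Sum>p\<in>?A. y p * \<chi> p (r - p) * z (r - p))"
    by (rule tmult_superset[OF fin]) auto
  ultimately show "((x + y) \<odot> z) r = (x \<odot> z + y \<odot> z) r"
    by (simp add: algebra_simps sum.distrib)
qed

lemma tmult_scale_left: "fscale c x \<odot> y = fscale c (x \<odot> y)"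
proof (cases "c = 0")
  case False then show ?thesis
    by (auto simp: tmult_def fscale_def sum_distrib_left algebra_simps)
next
  case True
  then show ?thesis by (simp only: fs.scale_zero_left tmult_zero_left)
qed

lemma tmult_sum_left:
  "(\<And>i. i \<in> A \<Longrightarrow> x i \<in> finsupp) \<Longrightarrow> (\<Sum>i\<in>A. x i) \<odot> y = (\<Sum>i\<in>A. x i \<odot> y)"
proof (induction A rule: infinite_finite_induct)
  case (insert i A)
  then have "(x i + sum x A) \<odot> y = x i \<odot> y + sum x A \<odot> y"
    by (intro tmult_add_left finsupp_sum) auto
  with insert.IH insert.prems show ?case by (simp only: sum.insert[OF insert(1,2)] insert_iff simp_thms)
qed simp_all

lemma tmult_sum_right: "x \<odot> (\<Sum>i\<in>A. y i) = (\<Sum>i\<in>A. x \<odot> y i)"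
proof (induction A rule: infinite_finite_induct)
  case (insert i A)
  then show ?case by (simp only: sum.insert[OF insert(1,2)] tmult_add_right)
qed (simp_all only: sum.infinite sum.empty tmult_zero_right not_False_eq_True)

lemma chi_zero [simp]: "\<chi> 0 a = 1" "\<chi> a 0 = 1"
  using chi_add_left[of 0 0 a] chi_add_right[of a 0 0] chi_nonzero[of 0 a] chi_nonzero[of a 0]
  by auto

lemma tmult_delta: "(delta p \<odot> y) r = \<chi> p (r - p) * y (r - p)"
proof -
  have "{s. delta p s \<noteq> 0} = {p}" by (auto simp: delta_def)
  then show ?thesis by (simp add: tmult_def) (simp add: delta_def)
qed

lemma delta_tmult_delta: "delta p \<odot> delta r = fscale (\<chi> p r) (delta (p + r))"
proof
  fix s show "(delta p \<odot> delta r) s = fscale (\<chi> p r) (delta (p + r)) s"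
    by (auto simp: tmult_delta fscale_apply) (auto simp: delta_def)
qed

lemma tmult_one_left [simp]: "delta 0 \<odot> y = y"
  by (auto simp: tmult_delta fun_eq_iff)

lemma tmult_one_right: "x \<in> finsupp \<Longrightarrow> x \<odot> delta 0 = x"
proof -
  assume "x \<in> finsupp"
  then have x: "x = (\<Sum>p | x p \<noteq> 0. fscale (x p) (delta p))"
    by (intro finsupp_expand) (auto simp: finsupp_def)
  show ?thesis
    by (subst (1 2) x) (simp add: tmult_sum_left finsupp_scale tmult_scale_left delta_tmult_delta)
qed

lemma tmult_sums:
  "(\<Sum>i\<in>A. fscale (c i) (delta (a i))) \<odot> (\<Sum>j\<in>B. fscale (d j) (delta (b j))) =
   (\<Sum>i\<in>A. \<Sum>j\<in>B. fscale (c i * d j * \<chi> (a i) (b j)) (delta (a i + b j)))"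
  by (simp add: tmult_sum_left tmult_sum_right finsupp_scale tmult_scale_left tmult_scale_right
      delta_tmult_delta fs.scale_sum_right mult_ac) (rule sum.swap)

lemma tmult_finsupp:
  assumes "x \<in> finsupp" "y \<in> finsupp" shows "x \<odot> y \<in> finsupp"
proof -
  have x: "x = (\<Sum>p | x p \<noteq> 0. fscale (x p) (delta p))"
    and y: "y = (\<Sum>p | y p \<noteq> 0. fscale (y p) (delta p))"
    using assms by (auto intro!: finsupp_expand simp: finsupp_def)
  have "x \<odot> y = (\<Sum>p | x p \<noteq> 0. \<Sum>r | y r \<noteq> 0. fscale (x p * y r * \<chi> p r) (delta (p + r)))"
    unfolding tmult_sums[symmetric] by (rule arg_cong2[of _ _ _ _ "(\<odot>)", OF x y])
  then show ?thesis by (auto intro!: finsupp_sum finsupp_scale)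
qed

lemma tmult_assoc:
  assumes "x \<in> finsupp" "y \<in> finsupp" "z \<in> finsupp"
  shows "(x \<odot> y) \<odot> z = x \<odot> (y \<odot> z)"
proof -
  have x: "x = (\<Sum>p | x p \<noteq> 0. fscale (x p) (delta p))"
    and y: "y = (\<Sum>p | y p \<noteq> 0. fscale (y p) (delta p))"
    and z: "z = (\<Sum>p | z p \<noteq> 0. fscale (z p) (delta p))"
    using assms by (auto intro!: finsupp_expand simp: finsupp_def)
  show ?thesis
    by (subst (1 2) x, subst (1 2) y, subst (1 2) z)
      (simp add: tmult_sum_left tmult_sum_right finsupp_scale finsupp_sum tmult_scale_left
        tmult_scale_right tmult_finsupp delta_tmult_delta fs.scale_sum_right chi_add_left chi_add_right add.assoc mult_ac)
qed

text \<open>Only the two maxima can meet in the exponent \<open>p + r\<close>, so nothing cancels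
  their product there.\<close>

lemma leads_tmult:
  assumes "x \<in> finsupp" "leads x p" "leads y r"
  shows "leads (x \<odot> y) (p + r)"
proof -
  have fin: "finite {p. x p \<noteq> 0}" using assms(1) by (simp add: finsupp_def)
  have le: "s \<le> p + r" if nz: "x t * \<chi> t (s - t) * y (s - t) \<noteq> 0" for s t
  proof -
    have "t \<le> p" "s - t \<le> r" using nz assms by (auto simp: leads_def)
    then have "t + (s - t) \<le> p + r" by (rule add_mono)
    then show ?thesis by simp
  qed
  have eq: "t = p" if nz: "x t * \<chi> t (p + r - t) * y (p + r - t) \<noteq> 0" for t
  proof (rule ccontr)
    assume "t \<noteq> p"
    then have "t < p" "p + r - t \<le> r" using nz assms by (auto simp: leads_def)
    then have "t + (p + r - t) < p + r" by (rule add_less_le_mono)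
    then show False by simp
  qed
  have "(x \<odot> y) (p + r) = (\<Sum>t\<in>{p}. x t * \<chi> t (p + r - t) * y (p + r - t))"
    unfolding tmult_def using assms fin eq
    by (intro sum.mono_neutral_right) (auto simp: leads_def)
  moreover have "\<dots> \<noteq> 0" using assms chi_nonzero by (auto simp: leads_def)
  moreover have "s \<le> p + r" if nz: "(x \<odot> y) s \<noteq> 0" for s
  proof -
    obtain t where "x t * \<chi> t (s - t) * y (s - t) \<noteq> 0"
      using nz unfolding tmult_def by (auto elim: sum.not_neutral_contains_not_neutral)
    then show ?thesis by (rule le)
  qed
  ultimately show ?thesis by (simp add: leads_def)
qed

end

locale fa_representation = twisted_group \<chi>
  for \<chi> :: "'g::linordered_ab_group_add \<Rightarrow> 'g \<Rightarrow> complex" +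
  fixes G :: "'x \<Rightarrow> 'g \<Rightarrow> complex"
  assumes G_finsupp: "G g \<in> finsupp"
begin

definition rep_word :: "'x list \<Rightarrow> 'g \<Rightarrow> complex" where
  "rep_word w = foldr (\<lambda>g x. G g \<odot> x) w (delta 0)"

definition rep :: "'x fa \<Rightarrow> 'g \<Rightarrow> complex" where
  "rep f = (\<Sum>w | f w \<noteq> 0. fscale (f w) (rep_word w))"

lemma rep_word_simps [simp]: "rep_word [] = delta 0" "rep_word (g # w) = G g \<odot> rep_word w"
  by (simp_all add: rep_word_def)

lemma rep_word_finsupp [simp]: "rep_word w \<in> finsupp"
  by (induction w) (auto intro: tmult_finsupp G_finsupp)

lemma rep_word_append: "rep_word (u @ v) = rep_word u \<odot> rep_word v"
  by (induction u) (auto simp: tmult_assoc G_finsupp)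

lemma rep_superset:
  "finite A \<Longrightarrow> {w. f w \<noteq> 0} \<subseteq> A \<Longrightarrow> rep f = (\<Sum>w\<in>A. fscale (f w) (rep_word w))"
  unfolding rep_def by (rule sum.mono_neutral_left) auto

lemma rep_finsupp [simp]: "rep f \<in> finsupp"
  unfolding rep_def by (auto intro!: finsupp_sum finsupp_scale)

lemma rep_zero [simp]: "rep 0 = 0"
  by (simp add: rep_def)

lemma rep_add:
  assumes "f \<in> FA" "g \<in> FA" shows "rep (f + g) = rep f + rep g"
proof -
  let ?A = "{w. f w \<noteq> 0} \<union> {w. g w \<noteq> 0}"
  have fin: "finite ?A" using assms by (auto simp: FA_def)
  have "rep (f + g) = (\<Sum>w\<in>?A. fscale ((f + g) w) (rep_word w))"
    by (rule rep_superset[OF fin]) auto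
  moreover have "rep f = (\<Sum>w\<in>?A. fscale (f w) (rep_word w))"
    by (rule rep_superset[OF fin]) auto
  moreover have "rep g = (\<Sum>w\<in>?A. fscale (g w) (rep_word w))"
    by (rule rep_superset[OF fin]) auto
  ultimately show ?thesis by (simp add: fs.scale_left_distrib sum.distrib)
qed

lemma rep_scale: "rep (fscale c f) = fscale c (rep f)"
proof (cases "c = 0")
  case True
  then show ?thesis by (simp only: fs.scale_zero_left rep_zero)
next
  case False
  then have "{w. fscale c f w \<noteq> 0} = {w. f w \<noteq> 0}" by (auto simp: fscale_def)
  then show ?thesis by (simp add: rep_def fs.scale_sum_right) (simp add: fscale_def)
qed

lemma rep_diff: "f \<in> FA \<Longrightarrow> g \<in> FA \<Longrightarrow> rep (f - g) = rep f - rep g"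
proof -
  assume "f \<in> FA" "g \<in> FA"
  then have "rep (f + fscale (- 1) g) = rep f + fscale (- 1) (rep g)"
    using rep_scale[of "- 1" g] by (simp add: rep_add FA_scale del: fs.scale_minus_left)
  then show ?thesis by simp
qed

lemma rep_sum: "(\<And>i. i \<in> A \<Longrightarrow> f i \<in> FA) \<Longrightarrow> rep (\<Sum>i\<in>A. f i) = (\<Sum>i\<in>A. rep (f i))"
proof (induction A rule: infinite_finite_induct)
  case (insert i A)
  then have "rep (f i + sum f A) = rep (f i) + rep (sum f A)"
    by (intro rep_add FA_sum) auto
  with insert.IH insert.prems show ?case by (simp only: sum.insert[OF insert(1,2)] insert_iff simp_thms)
qed simp_all

lemma rep_of_word [simp]: "rep (word w) = rep_word w"
proof -
  have "{u. word w u \<noteq> 0} = {w}" by (auto simp: word_def)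
  then show ?thesis by (simp add: rep_def) (simp add: word_def)
qed

lemma rep_mult:
  assumes "f \<in> FA" "g \<in> FA" shows "rep (f \<star> g) = rep f \<odot> rep g"
proof -
  have f: "f = (\<Sum>w | f w \<noteq> 0. fscale (f w) (word w))"
    and g: "g = (\<Sum>w | g w \<noteq> 0. fscale (g w) (word w))"
    using assms by (auto intro!: fa_expand simp: FA_def)
  have mult_sum: "(\<Sum>i\<in>A. x i) \<star> y = (\<Sum>i\<in>A. x i \<star> y)" "y \<star> (\<Sum>i\<in>A. x i) = (\<Sum>i\<in>A. y \<star> x i)"
    for A :: "'x list set" and x y
    by (induction A rule: infinite_finite_induct)
      (simp_all only: sum.insert sum.infinite sum.empty fa_mult_simps not_False_eq_True)
  have "f \<star> g = (\<Sum>u | f u \<noteq> 0. \<Sum>v | g v \<noteq> 0. fscale (f u * g v) (word (u @ v)))"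
    by (subst f, subst g) (simp add: mult_sum fa_mult_simps word_append fs.scale_sum_right mult_ac,
        rule sum.swap)
  then have "rep (f \<star> g) = (\<Sum>u | f u \<noteq> 0. \<Sum>v | g v \<noteq> 0. fscale (f u * g v) (rep_word u \<odot> rep_word v))"
    by (simp add: rep_sum FA_sum FA_scale rep_scale rep_word_append)
  also have "\<dots> = rep f \<odot> rep g"
    by (simp add: rep_def tmult_sum_left tmult_sum_right finsupp_scale tmult_scale_left
        tmult_scale_right fs.scale_sum_right mult_ac) (rule sum.swap)
  finally show ?thesis .
qed

lemma rep_one [simp]: "rep fa_one = delta 0"
  using rep_of_word[of "[]"] by (simp add: word_Nil)

lemma rep_ideal:
  assumes "R \<subseteq> FA" "\<And>r. r \<in> R \<Longrightarrow> rep r = 0" "a \<in> fa_ideal R"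
  shows "a \<in> FA \<and> rep a = 0"
  using assms(3)
proof (induction rule: fa_ideal.induct)
  case (gen r) then show ?case using assms(1,2) by blast
qed (simp_all only: fa_ops rep_add rep_scale rep_mult rep_zero FA_add FA_scale FA_zero FA_mult
    tmult_zero_left tmult_zero_right fs.scale_zero_right add_0_left simp_thms)

end

section \<open>The PBW monomials and their exponent vectors\<close>

definition pbw :: "complex \<Rightarrow> nat \<Rightarrow> (pbw_index \<Rightarrow> int) \<Rightarrow> gen fa" where
  "pbw q n x =
    fa_prod (case_prod (rootvec q (\<lambda>i. word [F (n - 1 - i)]))) (spread (\<lambda>r. nat (x (FR r))) (roots n))
    \<star> (word (torus_word n (\<lambda>i. x (KR i)))
    \<star> fa_prod (case_prod (rootvec q (\<lambda>i. word [E i]))) (spread (\<lambda>r. nat (x (ER r))) (roots n)))"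

definition pbw_indices :: "nat \<Rightarrow> pbw_index set" where
  "pbw_indices n = FR ` {(k, d). k + d < n} \<union> KR ` {..<n} \<union> ER ` {(k, d). k + d < n}"

text \<open>All exponents are kept in one integer vector, so that the leading exponent becomes a
  linear function of it; only those of the \<open>K i\<close> may be negative. The box of radius
  \<open>m\<close> is what gets counted for the growth.\<close>

definition pbw_exponents :: "nat \<Rightarrow> nat \<Rightarrow> (pbw_index \<Rightarrow> int) set" where
  "pbw_exponents n m = {x. (\<forall>i. \<bar>x i\<bar> \<le> int m) \<and> (\<forall>i. i \<notin> pbw_indices n \<longrightarrow> x i = 0)
    \<and> (\<forall>r. x (FR r) \<ge> 0 \<and> x (ER r) \<ge> 0)}"

lemma set_torus_word: "g \<in> set (torus_word n z) \<Longrightarrow> torus_gen g \<and> index g < n"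
  by (auto simp: torus_word_def torus_block_def split: if_splits)

lemma torus_word_split:
  "i < n \<Longrightarrow> torus_word n z = concat (map (torus_block z) [0..<i]) @ torus_block z i
     @ concat (map (torus_block z) [Suc i..<n])"
proof -
  assume "i < n"
  then have "[0..<n] = [0..<i] @ i # [Suc i..<n]"
    using upt_add_eq_append[of 0 i "n - i"] by (simp add: upt_conv_Cons)
  then show ?thesis by (simp add: torus_word_def)
qed

lemma (in fa_quotient) cancel_pair:
  "word [a] \<star> word [b] - fa_one \<in> I \<Longrightarrow> word (u @ a # b # v) \<in> spanI {word (u @ v)}"
proof (rule spanI_cong)
  assume *: "word [a] \<star> word [b] - fa_one \<in> I"
  have "word (u @ a # b # v) = word u \<star> (word [a] \<star> word [b]) \<star> word v"
    by (simp flip: word_append)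
  then have "word (u @ a # b # v) - word (u @ v) = word u \<star> (word [a] \<star> word [b] - fa_one) \<star> word v"
    by (simp add: fa_mult_simps word_append)
  then show "word (u @ a # b # v) - word (u @ v) \<in> I"
    using * by (simp add: I_lmult I_rmult)
qed (auto intro: spanI_base)

context uq_sl
begin

text \<open>The new letter either extends the block or cancels its first letter, depending on the
  sign of the exponent.\<close>

lemma torus_gen_mult_block:
  assumes "torus_gen g" "index g = i" "i < n"
  shows "\<exists>c. \<bar>c\<bar> \<le> 1 \<and> word (g # torus_block z i) \<in> spanI {word (torus_block (z(i := z i + c)) i)}"
proof -
  consider "g = K i" "z i \<ge> 0" | "g = K i" "z i < 0" | "g = Kinv i" "z i > 0" | "g = Kinv i" "z i \<le> 0"
    using assms by (cases g) force+
  then show ?thesis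
  proof cases
    case 1
    then have "g # torus_block z i = torus_block (z(i := z i + 1)) i"
      by (simp add: torus_block_def nat_add_distrib)
    then show ?thesis by (intro exI[of _ 1]) (auto intro: spanI_base)
  next
    case 4
    have "nat (1 - z i) = Suc (nat (- z i))" using 4 by simp
    then have "g # torus_block z i = torus_block (z(i := z i + (-1))) i"
      using 4 by (simp add: torus_block_def)
    then show ?thesis by (intro exI[of _ "-1"]) (auto intro: spanI_base)
  next
    case 2
    define m where "m = nat (- z i - 1)"
    have m: "nat (- z i) = Suc m" "nat (- z i - 1) = m" using 2 by (simp_all add: m_def)
    have "word ([] @ K i # Kinv i # replicate m (Kinv i)) \<in> spanI {word ([] @ replicate m (Kinv i))}"
      by (rule cancel_pair[OF K_Kinv[OF assms(3)]])
    then show ?thesis using 2 m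
      by (intro exI[of _ 1]) (simp add: torus_block_def)
  next
    case 3
    define m where "m = nat (z i - 1)"
    have m: "nat (z i) = Suc m" "nat (z i - 1) = m" using 3 by (simp_all add: m_def)
    have "word ([] @ Kinv i # K i # replicate m (K i)) \<in> spanI {word ([] @ replicate m (K i))}"
      by (rule cancel_pair[OF Kinv_K[OF assms(3)]])
    then show ?thesis using 3 m
      by (intro exI[of _ "-1"]) (simp add: torus_block_def)
  qed
qed

lemma torus_normal_form:
  "\<forall>g\<in>set zs. torus_gen g \<and> index g < n \<Longrightarrow>
   word zs \<in> spanI {word (torus_word n z) | z. \<forall>i. \<bar>z i\<bar> \<le> int (length zs)}"
proof (induction zs)
  case Nil
  have "torus_word n (\<lambda>_. 0) = []" by (simp add: torus_word_def torus_block_def)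
  then show ?case by (intro spanI_base CollectI exI[of _ "\<lambda>_. 0"]) auto
next
  case (Cons g zs)
  let ?S = "\<lambda>m. {word (torus_word n z) | z. \<forall>i. \<bar>z i\<bar> \<le> int m}"
  have g: "torus_gen g" "index g < n" using Cons.prems by auto
  have "word [g] \<star> word zs \<in> spanI (?S (length (g # zs)))"
  proof (rule spanI_lmult[OF _ Cons.IH], goal_cases)
    case 2 then show ?case using Cons.prems by simp
  next
    case (3 y)
    then obtain z where z: "y = word (torus_word n z)" "\<And>i. \<bar>z i\<bar> \<le> int (length zs)" by blast
    define i where "i = index g"
    define A B where "A = concat (map (torus_block z) [0..<i])"
      and "B = concat (map (torus_block z) [Suc i..<n])"
    have tw: "torus_word n z = A @ torus_block z i @ B"
      using torus_word_split[of i n z] g by (simp add: i_def A_def B_def)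
    obtain c where c: "\<bar>c\<bar> \<le> 1"
      "word (g # torus_block z i) \<in> spanI {word (torus_block (z(i := z i + c)) i)}"
      using torus_gen_mult_block[OF g(1) i_def[symmetric]] g(2) i_def by blast
    let ?z = "z(i := z i + c)"
    have AB: "A = concat (map (torus_block ?z) [0..<i])" "B = concat (map (torus_block ?z) [Suc i..<n])"
      unfolding A_def B_def by (auto intro!: arg_cong[of _ _ concat] simp: torus_block_def)
    have tw': "torus_word n ?z = A @ torus_block ?z i @ B"
      using torus_word_split[of i n ?z] g unfolding AB by (simp add: i_def)
    have "index x < n" if "x \<in> set A" for x
      using that set_torus_word[of x n z] tw by auto
    then have "word [g] \<star> word A \<in> spanI {word A \<star> word [g]}"
      using torus_qcomm[OF g] by (intro qcomm_prod_span) auto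
    then have 1: "(word [g] \<star> word A) \<star> word (torus_block z i @ B)
        \<in> spanI {word A \<star> (word (g # torus_block z i) \<star> word B)}"
      by (rule spanI_rmult[rotated]) (auto intro!: spanI_base simp flip: word_append simp: fa_mult_assoc)
    have "word (g # torus_block z i) \<star> word B \<in> spanI {word (torus_block ?z i) \<star> word B}"
      using c(2) by (rule spanI_rmult[rotated]) (auto intro: spanI_base)
    then have 2: "word A \<star> (word (g # torus_block z i) \<star> word B) \<in> spanI {word (torus_word n ?z)}"
      by (rule spanI_lmult[rotated]) (auto intro!: spanI_base simp: tw' word_append)
    have "\<forall>j. \<bar>?z j\<bar> \<le> int (length (g # zs))"
    proof
      fix j show "\<bar>?z j\<bar> \<le> int (length (g # zs))" using z(2)[of j] c(1) by (auto split: if_splits)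
    qed
    then have 3: "word (torus_word n ?z) \<in> spanI (?S (length (g # zs)))"
      by (intro spanI_base) blast
    have "word [g] \<star> y = (word [g] \<star> word A) \<star> word (torus_block z i @ B)"
      by (simp add: z(1) tw word_append fa_mult_assoc)
    then show ?case using 1 2 3 by (auto intro: spanI_trans)
  qed simp
  then show ?case by (simp flip: word_append)
qed

text \<open>The three factors of the triangular form are refined separately, the \<open>E\<close>
  and \<open>F\<close> words by \<open>eprod_pbw\<close> and the torus word by
  \<open>torus_normal_form\<close>. Each refinement respects length, which keeps the exponents in
  the box.\<close>

lemma pbw_span: "word w \<in> spanI (pbw q n ` pbw_exponents n (length w))"
proof (rule spanI_trans[OF triangular_span], goal_cases)
  case (1 y)
  then obtain u zs v where y: "y = word (map F u) \<star> (word zs \<star> word (map E v))"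
    and uv: "set u \<subseteq> {..<n}" "set v \<subseteq> {..<n}" "\<forall>g\<in>set zs. torus_gen g \<and> index g < n"
    "length u + length zs + length v \<le> length w" by blast
  interpret SE: serre_system Uq_ideal q n "\<lambda>i. word [E i]" by (rule serre_system_E)
  interpret SF: serre_system Uq_ideal q n "\<lambda>i. word [F (n - 1 - i)]" by (rule serre_system_F)
  let ?PE = "\<lambda>c. fa_prod (case_prod (rootvec q (\<lambda>i. word [E i]))) (spread c (roots n))"
  let ?PF = "\<lambda>c. fa_prod (case_prod (rootvec q (\<lambda>i. word [F (n - 1 - i)]))) (spread c (roots n))"
  let ?T = "pbw q n ` pbw_exponents n (length w)"
  have E: "word (map E v) \<in> spanI {?PE c | c. \<forall>r. c r \<le> length v}"
    using SE.eprod_pbw[of n v] uv(2) by (simp add: fa_prod_word)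
  define u' where "u' = map (\<lambda>i. n - 1 - i) u"
  have u: "map F u = map (\<lambda>i. F (n - 1 - i)) u'" "set u' \<subseteq> {..<n}" "length u' = length u"
    using uv(1) by (auto simp: u'_def)
  have Fs: "word (map F u) \<in> spanI {?PF c | c. \<forall>r. c r \<le> length u}"
    using SF.eprod_pbw[of n u'] u by (simp add: fa_prod_word)
  have PF_FA: "?PF c \<in> FA" and PE_FA: "?PE c \<in> FA" for c
    by (intro FA_prod; clarsimp simp: rootvec_FA)+
  have step: "?PF c \<star> (word (torus_word n z) \<star> ?PE d) \<in> ?T"
    if cd: "\<forall>r. c r \<le> length u" "\<forall>r. d r \<le> length v" "\<forall>i. \<bar>z i\<bar> \<le> int (length zs)" for c d z
  proof -
    define x where "x = (\<lambda>i. if i \<in> pbw_indices n then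
      (case i of FR r \<Rightarrow> int (c r) | KR i \<Rightarrow> z i | ER r \<Rightarrow> int (d r)) else 0)"
    have "x \<in> pbw_exponents n (length w)"
    proof -
      have "\<bar>x i\<bar> \<le> int (length w)" for i
      proof (cases i)
        case (FR r) then show ?thesis using cd(1)[rule_format, of r] uv(4) by (auto simp: x_def)
      next
        case (ER r) then show ?thesis using cd(2)[rule_format, of r] uv(4) by (auto simp: x_def)
      next
        case (KR j) then show ?thesis using cd(3)[rule_format, of j] uv(4) by (auto simp: x_def)
      qed
      then show ?thesis by (auto simp: pbw_exponents_def x_def)
    qed
    moreover have "?PF c \<star> (word (torus_word n z) \<star> ?PE d) = pbw q n x"
    proof -
      have "spread (\<lambda>r. nat (x (FR r))) (roots n) = spread c (roots n)"
        "spread (\<lambda>r. nat (x (ER r))) (roots n) = spread d (roots n)"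
        by (rule spread_cong; auto simp: x_def pbw_indices_def set_roots)+
      moreover have "torus_word n (\<lambda>i. x (KR i)) = torus_word n z"
        unfolding torus_word_def
        by (auto intro!: arg_cong[of _ _ concat] simp: torus_block_def x_def pbw_indices_def)
      ultimately show ?thesis by (simp add: pbw_def)
    qed
    ultimately show ?thesis by simp
  qed
  show ?case unfolding y
  proof (rule spanI_rmult[OF _ Fs], goal_cases)
    case 1 then show ?case by (intro FA_mult) auto
  next
    case (2 f)
    then obtain c where f: "f = ?PF c" "\<forall>r. c r \<le> length u" by blast
    have "f \<in> FA" using PF_FA f by simp
    then show ?case
    proof (rule spanI_lmult[where X = "{word zs \<star> ?PE d | d. \<forall>r. d r \<le> length v}"], goal_cases)
      case 1
      show ?case by (rule spanI_lmult[OF _ E]) (auto intro: spanI_base)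
    next
      case (2 b)
      then obtain d where b: "b = word zs \<star> ?PE d" "\<forall>r. d r \<le> length v" by blast
      have "word zs \<star> ?PE d \<in> spanI {word (torus_word n z) \<star> ?PE d | z. \<forall>i. \<bar>z i\<bar> \<le> int (length zs)}"
        by (rule spanI_rmult[OF PE_FA torus_normal_form[OF uv(3)]]) (auto intro: spanI_base)
      then show ?case unfolding b(1)
        by (rule spanI_lmult[OF \<open>f \<in> FA\<close>]) (use step f b in \<open>auto intro!: spanI_base\<close>)
    qed
  qed
qed

end

section \<open>A representation in a quantum torus\<close>

context twisted_group
begin

lemma tmult_sums3:
  "(\<Sum>i\<in>A. fscale (c i) (delta (a i))) \<odot> ((\<Sum>j\<in>B. fscale (d j) (delta (b j))) \<odot>
      (\<Sum>k\<in>C. fscale (f k) (delta (e k)))) =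
   (\<Sum>i\<in>A. \<Sum>j\<in>B. \<Sum>k\<in>C. fscale (c i * d j * f k * (\<chi> (a i) (b j) * \<chi> (a i) (e k) * \<chi> (b j) (e k)))
      (delta (a i + b j + e k)))" (is "?x \<odot> _ = _")
proof -
  have "?x \<odot> fscale g (delta r) = (\<Sum>i\<in>A. fscale (c i * g * \<chi> (a i) r) (delta (a i + r)))" for g r
    by (simp add: tmult_sum_left finsupp_scale tmult_scale_left tmult_scale_right delta_tmult_delta
        fs.scale_sum_right mult_ac)
  then have "?x \<odot> ((\<Sum>j\<in>B. fscale (d j) (delta (b j))) \<odot> (\<Sum>k\<in>C. fscale (f k) (delta (e k)))) =
      (\<Sum>j\<in>B. \<Sum>k\<in>C. \<Sum>i\<in>A. fscale (c i * (d j * f k * \<chi> (b j) (e k)) * \<chi> (a i) (b j + e k))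
        (delta (a i + (b j + e k))))"
    by (subst tmult_sums) (simp only: tmult_sum_right)
  also have "\<dots> = (\<Sum>j\<in>B. \<Sum>i\<in>A. \<Sum>k\<in>C. fscale (c i * (d j * f k * \<chi> (b j) (e k)) * \<chi> (a i) (b j + e k))
        (delta (a i + (b j + e k))))"
    by (rule sum.cong[OF refl], rule sum.swap)
  also have "\<dots> = (\<Sum>i\<in>A. \<Sum>j\<in>B. \<Sum>k\<in>C. fscale (c i * (d j * f k * \<chi> (b j) (e k)) * \<chi> (a i) (b j + e k))
        (delta (a i + (b j + e k))))"
    by (rule sum.swap)
  finally show ?thesis by (simp add: chi_add_right mult_ac add.assoc)
qed

text \<open>The monomial \<open>a i + a i' + b j\<close> arises from both orders of \<open>i\<close>
  and \<open>i'\<close>, so only the symmetrized coefficient has to vanish. If both monomials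
  commute with \<open>b j\<close> up to the same power of \<open>q\<close>, each half vanishes,
  because \<open>q\<close> and \<open>inverse q\<close> are the roots of
  \<open>1 - (q + inverse q) * t + t * t\<close>. For opposite powers the halves cancel by
  \<open>aa\<close>.\<close>

lemma serre_monomial_sums:
  fixes q :: complex and u :: "'i \<Rightarrow> 'j \<Rightarrow> int" and c :: "'i \<Rightarrow> complex" and d :: "'j \<Rightarrow> complex"
  assumes "q \<noteq> 0"
    and u: "\<And>i j. i \<in> A \<Longrightarrow> j \<in> B \<Longrightarrow> u i j = 1 \<or> u i j = -1"
    and ba: "\<And>i j. i \<in> A \<Longrightarrow> j \<in> B \<Longrightarrow> \<chi> (b j) (a i) = q powi u i j * \<chi> (a i) (b j)"
    and aa: "\<And>i i' j. i \<in> A \<Longrightarrow> i' \<in> A \<Longrightarrow> j \<in> B \<Longrightarrow> u i j = 1 \<Longrightarrow> u i' j = -1 \<Longrightarrow>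
      \<chi> (a i') (a i) = q powi (-2) * \<chi> (a i) (a i')"
  defines "x \<equiv> \<Sum>i\<in>A. fscale (c i) (delta (a i))"
    and "y \<equiv> \<Sum>j\<in>B. fscale (d j) (delta (b j))"
  shows "x \<odot> (x \<odot> y) - fscale (q + inverse q) (x \<odot> (y \<odot> x)) + y \<odot> (x \<odot> x) = 0"
proof -
  define \<kappa> where "\<kappa> i i' j = \<chi> (a i) (a i') * \<chi> (a i) (b j) * \<chi> (a i') (b j)
    - (q + inverse q) * (\<chi> (a i) (b j) * \<chi> (a i) (a i') * \<chi> (b j) (a i'))
    + \<chi> (b j) (a i) * \<chi> (b j) (a i') * \<chi> (a i) (a i')" for i i' j
  have q_pows: "q powi 1 = q" "q powi (-1) = inverse q" "q powi (-2) = inverse q * inverse q"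
    by (simp_all add: power_int_minus power2_eq_square)
  have sym: "\<kappa> i i' j + \<kappa> i' i j = 0" if ij: "i \<in> A" "i' \<in> A" "j \<in> B" for i i' j
  proof -
    have \<kappa>: "\<kappa> i i' j = \<chi> (a i) (a i') * \<chi> (a i) (b j) * \<chi> (a i') (b j) *
        (1 - (q + inverse q) * q powi u i' j + q powi u i j * q powi u i' j)"
      if "i \<in> A" "i' \<in> A" for i i'
      using that ij by (simp add: \<kappa>_def ba algebra_simps)
    consider "u i j = u i' j" | "u i j = 1" "u i' j = -1" | "u i j = -1" "u i' j = 1"
      using u ij by metis
    then show ?thesis
    proof cases
      case 1
      then have "1 - (q + inverse q) * q powi u i' j + q powi u i j * q powi u i' j = 0"
        using u[OF ij(2,3)] assms(1) by (auto simp: q_pows field_simps)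
      then show ?thesis using \<kappa>[of i i'] \<kappa>[of i' i] ij 1 by simp
    next
      case 2
      have e: "\<chi> (a i') (a i) = inverse q * inverse q * \<chi> (a i) (a i')"
        using aa[OF ij 2] by (simp add: q_pows)
      show ?thesis unfolding \<kappa>[OF ij(1,2)] \<kappa>[OF ij(2,1)] 2 q_pows e
        using assms(1) by (simp add: field_simps)
    next
      case 3
      have e: "\<chi> (a i) (a i') = inverse q * inverse q * \<chi> (a i') (a i)"
        using aa[OF ij(2,1,3) 3(2,1)] by (simp add: q_pows)
      show ?thesis unfolding \<kappa>[OF ij(1,2)] \<kappa>[OF ij(2,1)] 3 q_pows e
        using assms(1) by (simp add: field_simps)
    qed
  qed
  let ?m = "\<lambda>i i' j. delta (a i + a i' + b j)"
  define S where "S = (\<Sum>j\<in>B. \<Sum>i\<in>A. \<Sum>i'\<in>A. fscale (c i * c i' * d j * \<kappa> i i' j) (?m i i' j))"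
  have expand: "x \<odot> (x \<odot> y) = (\<Sum>j\<in>B. \<Sum>i\<in>A. \<Sum>i'\<in>A.
      fscale (c i * c i' * d j * (\<chi> (a i) (a i') * \<chi> (a i) (b j) * \<chi> (a i') (b j))) (?m i i' j))"
    "x \<odot> (y \<odot> x) = (\<Sum>j\<in>B. \<Sum>i\<in>A. \<Sum>i'\<in>A.
      fscale (c i * c i' * d j * (\<chi> (a i) (b j) * \<chi> (a i) (a i') * \<chi> (b j) (a i'))) (?m i i' j))"
    "y \<odot> (x \<odot> x) = (\<Sum>j\<in>B. \<Sum>i\<in>A. \<Sum>i'\<in>A.
      fscale (c i * c i' * d j * (\<chi> (b j) (a i) * \<chi> (b j) (a i') * \<chi> (a i) (a i'))) (?m i i' j))"
    subgoal unfolding x_def y_def tmult_sums3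
      by (subst (2) sum.swap, subst sum.swap) (simp add: mult_ac add_ac)
    subgoal unfolding x_def y_def tmult_sums3
      by (subst sum.swap) (simp add: mult_ac add_ac)
    subgoal unfolding x_def y_def tmult_sums3
      by (simp add: mult_ac add_ac)
    done
  have S: "x \<odot> (x \<odot> y) - fscale (q + inverse q) (x \<odot> (y \<odot> x)) + y \<odot> (x \<odot> x) = S"
    unfolding expand S_def fs.scale_sum_right sum_subtractf[symmetric] sum.distrib[symmetric]
      fs.scale_scale fs.scale_left_diff_distrib[symmetric] fs.scale_left_distrib[symmetric]
    by (intro sum.cong refl arg_cong2[of _ _ _ _ fscale]) (simp add: \<kappa>_def algebra_simps)
  \<comment> \<open>Exchanging the two summation indices fixes the monomial, so doubling the sum
    symmetrizes its coefficients and \<open>sym\<close> applies.\<close>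
  have "S + S = (\<Sum>j\<in>B. \<Sum>i\<in>A. \<Sum>i'\<in>A. fscale (c i * c i' * d j * (\<kappa> i i' j + \<kappa> i' i j)) (?m i i' j))"
  proof -
    have "S = (\<Sum>j\<in>B. \<Sum>i\<in>A. \<Sum>i'\<in>A. fscale (c i * c i' * d j * \<kappa> i' i j) (?m i i' j))"
      unfolding S_def
    proof (rule sum.cong[OF refl], subst sum.swap, intro sum.cong refl)
      fix i i' j
      show "fscale (c i * c i' * d j * \<kappa> i i' j) (?m i i' j) = fscale (c i' * c i * d j * \<kappa> i i' j) (?m i' i j)"
        by (simp add: add.commute mult.commute)
    qed
    then have "S + S = S + (\<Sum>j\<in>B. \<Sum>i\<in>A. \<Sum>i'\<in>A. fscale (c i * c i' * d j * \<kappa> i' i j) (?m i i' j))"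
      by (rule arg_cong)
    then show ?thesis
      unfolding S_def sum.distrib[symmetric] fs.scale_left_distrib[symmetric] distrib_left .
  qed
  also have "\<dots> = 0"
    by (intro sum.neutral ballI) (simp only: sym mult_zero_right fs.scale_zero_left)
  finally have "(S + S) r = 0" for r by (simp only: zero_fun_apply)
  then have "S r = 0" for r by (simp add: mult_2[symmetric])
  then show ?thesis unfolding S by (simp add: fun_eq_iff)
qed

end

text \<open>At the simple root \<open>k\<close> the weight has its unique maximum in copy
  \<open>k\<close>. At a later root \<open>l\<close> it grows up to copy \<open>l\<close>, but a
  chain that started in copy \<open>k\<close> cannot exceed \<open>k\<close>, so copy
  \<open>k\<close> is again the best choice. Copies from \<open>n\<close> on weigh nothing for any
  \<open>k < n\<close>.\<close>

definition idx_height :: "nat \<Rightarrow> nat \<Rightarrow> int" where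
  "idx_height k a = (if a \<le> k then int a + 1 else 0)"

section \<open>Exponents, their order and the bicharacter\<close>

context uq_sl
begin

text \<open>The leading shifts of the \<open>E\<close> root vectors lie in the copies below
  \<open>n\<close>, those of the \<open>F\<close> root vectors in the other \<open>n\<close>
  copies.\<close>

definition M :: nat where "M = 2 * n"

definition wE :: "(nat \<Rightarrow> nat \<Rightarrow> int) \<Rightarrow> nat \<Rightarrow> int" where
  "wE m k = (\<Sum>a<M. idx_height k a * m k a)"

text \<open>The same weights after reversing simple roots and copies. The sign compensates for
  \<open>F\<close> shifting by negative simple roots.\<close>

definition wF :: "(nat \<Rightarrow> nat \<Rightarrow> int) \<Rightarrow> nat \<Rightarrow> int" where
  "wF m k = - (\<Sum>a<M. idx_height k a * m (n - 1 - k) (M - 1 - a))"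

text \<open>Exponents are integer polynomials, which are ordered by the leading coefficient of the
  difference. The lowest \<open>M n\<close> coefficients contain \<open>v\<close>, the pairings of the diagonal part of a
  monomial with the shifts, and the next \<open>M n\<close> contain \<open>m\<close>, the multiplicities of the shift by
  the simple root \<open>j\<close> in copy \<open>b\<close>. The weights \<open>wE\<close> and \<open>wF\<close> above them depend linearly on \<open>m\<close>
  and only serve to decide comparisons.\<close>

definition layout :: "(nat \<Rightarrow> nat \<Rightarrow> int) \<Rightarrow> (nat \<Rightarrow> nat \<Rightarrow> int) \<Rightarrow> nat \<Rightarrow> int" where
  "layout m v i =
    (if i < M * n then v (i div M) (i mod M)
     else if i < 2 * (M * n) then m ((i - M * n) div M) ((i - M * n) mod M)
     else if i < 2 * (M * n) + n then wF m (n - 1 - (i - 2 * (M * n)))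
     else wE m (n - 1 - (i - 2 * (M * n) - n)))"

definition expo :: "(nat \<Rightarrow> nat \<Rightarrow> int) \<Rightarrow> (nat \<Rightarrow> nat \<Rightarrow> int) \<Rightarrow> int poly" where
  "expo m v = Poly (map (layout m v) [0..<2 * (M * n) + 2 * n])"

lemma coeff_expo: "coeff (expo m v) i = (if i < 2 * (M * n) + 2 * n then layout m v i else 0)"
  by (simp add: expo_def nth_default_def)

lemma layout_add: "layout (\<lambda>j b. m j b + m' j b) (\<lambda>j b. v j b + v' j b) i = layout m v i + layout m' v' i"
  by (simp add: layout_def wE_def wF_def distrib_left sum.distrib)

lemma expo_add: "expo m v + expo m' v' = expo (\<lambda>j b. m j b + m' j b) (\<lambda>j b. v j b + v' j b)"
  by (rule poly_eqI) (simp add: coeff_expo layout_add)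

lemma expo_zero: "expo (\<lambda>_ _. 0) (\<lambda>_ _. 0) = 0"
  by (rule poly_eqI) (simp add: coeff_expo layout_def wE_def wF_def)

text \<open>Monomials are thought of with the shifts to the left of the diagonal part. In a product
  the diagonal part of \<open>p\<close> has to pass the shifts of \<open>r\<close>, which costs
  \<open>q\<close> to this power.\<close>

definition pairing :: "int poly \<Rightarrow> int poly \<Rightarrow> int" where
  "pairing p r = (\<Sum>i<M * n. coeff p i * coeff r (M * n + i))"

lemma pairing_add: "pairing (p + p') r = pairing p r + pairing p' r"
  "pairing p (r + r') = pairing p r + pairing p r'"
  by (simp_all add: pairing_def algebra_simps sum.distrib)

lemma index_less: "j < n \<Longrightarrow> b < M \<Longrightarrow> j * M + b < M * n"
proof -
  assume "j < n" "b < M"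
  then have "j * M + b < M * Suc j" by simp
  moreover have "M * Suc j \<le> M * n" using \<open>j < n\<close> by (intro mult_le_mono2) simp
  ultimately show ?thesis by linarith
qed

lemma pairing_expo:
  assumes "j < n" "b < M"
  shows "pairing (expo m v) (expo (\<lambda>i a. if i = j \<and> a = b then c else 0) v') = c * v j b"
proof -
  have eq: "i div M = j \<and> i mod M = b \<longleftrightarrow> i = j * M + b" for i
    using assms by (metis div_mult_self3 div_mult_mod_eq mod_less mod_mult_self3 div_less add.right_neutral add.commute less_nat_zero_code bot_nat_0.not_eq_extremum)
  have "pairing (expo m v) (expo (\<lambda>i a. if i = j \<and> a = b then c else 0) v')
      = (\<Sum>i<M * n. v (i div M) (i mod M) * (if i div M = j \<and> i mod M = b then c else 0))"
    unfolding pairing_def by (intro sum.cong refl) (simp add: coeff_expo layout_def)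
  also have "\<dots> = (\<Sum>i<M * n. if i = j * M + b then c * v j b else 0)"
    using assms by (intro sum.cong refl) (auto simp: eq)
  also have "\<dots> = c * v j b" using index_less[OF assms] by simp
  finally show ?thesis .
qed

lemma pairing_expo_zero: "pairing p (expo (\<lambda>_ _. 0) v) = 0"
  by (simp add: pairing_def coeff_expo layout_def)

definition q_pair :: "int poly \<Rightarrow> int poly \<Rightarrow> complex" where
  "q_pair p r = q powi pairing p r"

sublocale twisted_group q_pair
  by unfold_locales (simp_all add: q_pair_def pairing_add power_int_add q_nonzero)

notation tmult (infixl "\<odot>" 70)

text \<open>In a single copy, \<open>E\<^sub>i\<close> acts as \<open>x\<^sub>i x\<^sub>i\<^sub>+\<^sub>1\<^sup>-\<^sup>1 (D\<^sub>i\<^sub>+\<^sub>1 - D\<^sub>i\<^sub>+\<^sub>1\<^sup>-\<^sup>1) / (q - q\<^sup>-\<^sup>1)\<close> where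
  \<open>D\<^sub>k x\<^sub>k = q x\<^sub>k D\<^sub>k\<close>, and \<open>F\<^sub>i\<close> likewise with \<open>i\<close> and \<open>i + 1\<close> exchanged. A term is given by its
  copy \<open>a\<close> and the sign \<open>s\<close> of the exponent of \<open>D\<close>; the coproduct attaches \<open>K\<^sub>i\<close> of the copies
  before \<open>a\<close> to \<open>E\<^sub>i\<close> and the inverse of \<open>K\<^sub>i\<close> of the copies after \<open>a\<close> to \<open>F\<^sub>i\<close>.\<close>

definition vE :: "nat \<Rightarrow> nat \<Rightarrow> int \<Rightarrow> nat \<Rightarrow> nat \<Rightarrow> int" where
  "vE i a s j b = (if a = b then s * (of_bool (j = i + 1) - of_bool (j = i)) else 0)
     + (if b < a then cartan i j else 0)"

definition vF :: "nat \<Rightarrow> nat \<Rightarrow> int \<Rightarrow> nat \<Rightarrow> nat \<Rightarrow> int" where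
  "vF i a s j b = (if a = b then s * (of_bool (j = i) - of_bool (j + 1 = i)) else 0)
     - (if a < b then cartan i j else 0)"

definition xE :: "nat \<Rightarrow> nat \<times> int \<Rightarrow> int poly" where
  "xE i = (\<lambda>(a, s). expo (\<lambda>j b. if j = i \<and> b = a then 1 else 0) (vE i a s))"

definition xF :: "nat \<Rightarrow> nat \<times> int \<Rightarrow> int poly" where
  "xF i = (\<lambda>(a, s). expo (\<lambda>j b. if j = i \<and> b = a then -1 else 0) (vF i a s))"

definition xK :: "int \<Rightarrow> nat \<Rightarrow> int poly" where
  "xK c i = expo (\<lambda>_ _. 0) (\<lambda>j b. c * cartan i j)"

definition terms :: "(nat \<times> int) set" where
  "terms = {..<M} \<times> {1, -1}"

lemma terms_fst [simp]: "p \<in> terms \<Longrightarrow> fst p < M" by (auto simp: terms_def)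

lemma finite_terms [simp]: "finite terms" by (simp add: terms_def)

definition term_coeff :: "nat \<times> int \<Rightarrow> complex" where
  "term_coeff p = of_int (snd p) / (q - inverse q)"

fun torus_image :: "gen \<Rightarrow> int poly \<Rightarrow> complex" where
  "torus_image (E i) = (if i < n then \<Sum>p\<in>terms. fscale (term_coeff p) (delta (xE i p)) else 0)"
| "torus_image (F i) = (if i < n then \<Sum>p\<in>terms. fscale (term_coeff p) (delta (xF i p)) else 0)"
| "torus_image (K i) = (if i < n then delta (xK 1 i) else 0)"
| "torus_image (Kinv i) = (if i < n then delta (xK (-1) i) else 0)"

declare torus_image.simps [simp del]

sublocale fa_representation q_pair torus_image
proof
  fix g show "torus_image g \<in> finsupp"
    by (cases g) (simp_all add: torus_image.simps finsupp_sum finsupp_scale finsupp_zero)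
qed

lemma pairings:
  assumes "i < n" "j < n" "a < M" "b < M"
  shows "pairing (xE i (a, s)) (xE j (b, t)) = vE i a s j b"
    and "pairing (xF i (a, s)) (xF j (b, t)) = - vF i a s j b"
    and "pairing (xE i (a, s)) (xF j (b, t)) = - vE i a s j b"
    and "pairing (xF i (a, s)) (xE j (b, t)) = vF i a s j b"
    and "pairing (xK c i) (xE j (b, t)) = c * cartan i j"
    and "pairing (xK c i) (xF j (b, t)) = - c * cartan i j"
  using assms by (simp_all add: xE_def xF_def xK_def pairing_expo)

lemma pairing_xK [simp]: "pairing p (xK c i) = 0"
  by (simp add: xK_def pairing_expo_zero)

lemma q_pair_xK [simp]: "q_pair p (xK c i) = 1"
  by (simp add: q_pair_def)

end

section \<open>The defining relations hold in the quantum torus\<close>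

context uq_sl
begin

lemma rep_lin: "rep (lin ts) = sum_list (map (\<lambda>(c, u). fscale c (rep_word u)) ts)"
proof -
  have "lin ts \<in> FA \<and> ?thesis"
  proof (induction ts)
    case Nil
    have "lin [] = (0 :: gen fa)" by (simp only: lin_word list.map sum_list.Nil)
    then show ?case by (simp only: rep_zero list.map sum_list.Nil FA_zero simp_thms)
  next
    case (Cons t ts)
    obtain c u where t: "t = (c, u)" by (cases t)
    have "lin (t # ts) = fscale c (word u) + lin ts"
      by (simp only: lin_word list.map sum_list.Cons t prod.case)
    moreover have "rep (fscale c (word u) + lin ts) = fscale c (rep_word u) + rep (lin ts)"
      using Cons by (simp only: rep_add rep_scale FA_scale word_FA rep_of_word)
    ultimately show ?case using Cons
      by (simp only: list.map sum_list.Cons t prod.case simp_thms FA_add FA_scale word_FA)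
  qed
  then show ?thesis by blast
qed

abbreviation tsum :: "(nat \<times> int \<Rightarrow> int poly) \<Rightarrow> int poly \<Rightarrow> complex" where
  "tsum x \<equiv> \<Sum>p\<in>terms. fscale (term_coeff p) (delta (x p))"

lemma tsum_finsupp [simp]: "tsum x \<in> finsupp"
  by (intro finsupp_sum finsupp_scale delta_finsupp)

lemma xK_add: "xK c i + xK d j = expo (\<lambda>_ _. 0) (\<lambda>k b. c * cartan i k + d * cartan j k)"
  by (simp add: xK_def expo_add)

lemma xK_inverse: "xK c i + xK (- c) i = 0"
  unfolding xK_add using expo_zero by simp

lemma rep_K_inverse:
  "i < n \<Longrightarrow> rep_word [K i, Kinv i] = delta 0" "i < n \<Longrightarrow> rep_word [Kinv i, K i] = delta 0"
proof -
  have e1: "xK 1 i + xK (-1) i = 0" by (rule xK_inverse)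
  then have e2: "xK (-1) i + xK 1 i = 0" by (simp only: add.commute)
  show "i < n \<Longrightarrow> rep_word [K i, Kinv i] = delta 0"
    "i < n \<Longrightarrow> rep_word [Kinv i, K i] = delta 0"
    by (simp_all only: rep_word_simps torus_image.simps if_True tmult_one_right delta_finsupp
        delta_tmult_delta q_pair_xK fs.scale_one chi_zero add_0_right e1 e2)
qed

lemma rep_K_commute: "i < n \<Longrightarrow> j < n \<Longrightarrow> rep_word [K i, K j] = rep_word [K j, K i]"
  by (simp add: torus_image.simps tmult_one_right delta_tmult_delta add.commute)

lemma K_conj_tsum:
  assumes "i < n" and x: "\<And>p. p \<in> terms \<Longrightarrow> pairing (xK 1 i) (x p) = c"
  shows "delta (xK 1 i) \<odot> (tsum x \<odot> delta (xK (-1) i)) = fscale (q powi c) (tsum x)"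
proof -
  have e: "xK 1 i + (r + xK (-1) i) = r" for r
    using xK_inverse[of 1 i] by (metis add.commute add.left_commute add.right_neutral)
  have "delta (xK 1 i) \<odot> (tsum x \<odot> delta (xK (-1) i)) =
      (\<Sum>p\<in>terms. fscale (term_coeff p * q_pair (xK 1 i) (x p + xK (-1) i)) (delta (x p)))"
    by (simp only: tmult_sum_left tmult_sum_right finsupp_scale delta_finsupp tmult_scale_left tmult_scale_right
        delta_tmult_delta fs.scale_scale q_pair_xK e mult_1_right)
  also have "\<dots> = (\<Sum>p\<in>terms. fscale (q powi c) (fscale (term_coeff p) (delta (x p))))"
    by (intro sum.cong refl) (simp add: q_pair_def pairing_add x mult.commute)
  finally show ?thesis by (simp only: fs.scale_sum_right)
qed

lemma pairing_xK_terms: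
  assumes "i < n" "j < n" "p \<in> terms"
  shows "pairing (xK c i) (xE j p) = c * cartan i j" "pairing (xK c i) (xF j p) = - c * cartan i j"
proof -
  obtain a s where p: "p = (a, s)" by (cases p)
  then have "a < M" using assms(3) by (simp add: terms_def)
  then show "pairing (xK c i) (xE j p) = c * cartan i j" "pairing (xK c i) (xF j p) = - c * cartan i j"
    unfolding p by (rule pairings(5,6)[OF assms(1,2) \<open>a < M\<close>])+
qed

lemma tsum_mult: "tsum x \<odot> tsum y =
    (\<Sum>p\<in>terms. \<Sum>r\<in>terms. fscale (term_coeff p * term_coeff r * q_pair (x p) (y r)) (delta (x p + y r)))"
  by (rule tmult_sums)

lemma tsum_commutator: "tsum x \<odot> tsum y - tsum y \<odot> tsum x =
    (\<Sum>p\<in>terms. \<Sum>r\<in>terms. fscale (term_coeff p * term_coeff r * (q_pair (x p) (y r) - q_pair (y r) (x p)))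
      (delta (x p + y r)))"
proof -
  have "tsum y \<odot> tsum x =
    (\<Sum>p\<in>terms. \<Sum>r\<in>terms. fscale (term_coeff p * term_coeff r * q_pair (y r) (x p)) (delta (x p + y r)))"
    unfolding tsum_mult by (subst sum.swap) (simp add: mult_ac add_ac)
  then show ?thesis unfolding tsum_mult
    by (simp only: sum_subtractf[symmetric] fs.scale_left_diff_distrib[symmetric] right_diff_distrib[symmetric])
qed

lemma tsum_commute:
  assumes "\<And>p r. p \<in> terms \<Longrightarrow> r \<in> terms \<Longrightarrow> pairing (x p) (y r) = pairing (y r) (x p)"
  shows "tsum x \<odot> tsum y = tsum y \<odot> tsum x"
proof -
  have "tsum x \<odot> tsum y - tsum y \<odot> tsum x = 0"
    unfolding tsum_commutator using assms
    by (intro sum.neutral ballI) (simp only: q_pair_def diff_self mult_zero_right fs.scale_zero_left)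
  then show ?thesis by (rule right_minus_eq[THEN iffD1])
qed

lemma far_commute:
  assumes "i < n" "j < n" "cartan i j = 0"
  shows "tsum (xE i) \<odot> tsum (xE j) = tsum (xE j) \<odot> tsum (xE i)"
    and "tsum (xF i) \<odot> tsum (xF j) = tsum (xF j) \<odot> tsum (xF i)"
proof -
  have far: "i + 1 < j \<or> j + 1 < i" using assms(3) by (simp add: cartan_far)
  show "tsum (xE i) \<odot> tsum (xE j) = tsum (xE j) \<odot> tsum (xE i)"
    using assms(1,2) far
    by (intro tsum_commute) (auto simp: pairings terms_def vE_def cartan_def)
  show "tsum (xF i) \<odot> tsum (xF j) = tsum (xF j) \<odot> tsum (xF i)"
    using assms(1,2) far
    by (intro tsum_commute) (auto simp: pairings terms_def vF_def cartan_def)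
qed

text \<open>\<open>serre_monomial_sums\<close> leaves only commutation exponents to be compared.
  They depend on the relative position of the copies and, inside a common copy, on the signs; the
  case splits run through these positions.\<close>

lemma serre_tsum:
  assumes "i < n" "j < n" "cartan i j = -1"
  shows "tsum (xE i) \<odot> (tsum (xE i) \<odot> tsum (xE j))
      - fscale (q + inverse q) (tsum (xE i) \<odot> (tsum (xE j) \<odot> tsum (xE i)))
      + tsum (xE j) \<odot> (tsum (xE i) \<odot> tsum (xE i)) = 0"
    and "tsum (xF i) \<odot> (tsum (xF i) \<odot> tsum (xF j))
      - fscale (q + inverse q) (tsum (xF i) \<odot> (tsum (xF j) \<odot> tsum (xF i)))
      + tsum (xF j) \<odot> (tsum (xF i) \<odot> tsum (xF i)) = 0"
proof -
  have adj: "j = i + 1 \<or> i = j + 1" using assms(3) by (auto simp: cartan_adjacent)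
  have qp: "q_pair r p = q powi (pairing r p - pairing p r) * q_pair p r" for p r
    using q_nonzero by (simp add: q_pair_def power_int_add[symmetric])
  have qp2: "q_pair p' p = q powi -2 * q_pair p p'" if "pairing p' p - pairing p p' = -2" for p p'
    using qp[of p' p] that by simp
  show "tsum (xE i) \<odot> (tsum (xE i) \<odot> tsum (xE j))
      - fscale (q + inverse q) (tsum (xE i) \<odot> (tsum (xE j) \<odot> tsum (xE i)))
      + tsum (xE j) \<odot> (tsum (xE i) \<odot> tsum (xE i)) = 0"
  proof (rule serre_monomial_sums[OF q_nonzero, where a = "xE i" and b = "xE j" and A = terms and B = terms
      and u = "\<lambda>p r. pairing (xE j r) (xE i p) - pairing (xE i p) (xE j r)"], goal_cases)
    case (1 p r)
    obtain a s b t where p: "p = (a, s)" "r = (b, t)" by (cases p, cases r)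
    then have bounds: "a < M" "b < M" "s = 1 \<or> s = -1" "t = 1 \<or> t = -1" using 1 by (auto simp: terms_def)
    show ?case using adj bounds(3,4) unfolding p pairings[OF assms(1,2) bounds(1,2)]
      pairings[OF assms(2,1) bounds(2,1)]
      by (cases a b rule: linorder_cases) (auto simp: vE_def cartan_def)
  next
    case 2 show ?case by (rule qp)
  next
    case (3 p p' r)
    obtain a s a' s' b t where p: "p = (a, s)" "p' = (a', s')" "r = (b, t)"
      by (cases p, cases p', cases r)
    then have bounds: "a < M" "a' < M" "b < M" "s = 1 \<or> s = -1" "s' = 1 \<or> s' = -1" "t = 1 \<or> t = -1"
      using 3 by (auto simp: terms_def)
    have 1: "vE j b t i a - vE i a s j b = 1" "vE j b t i a' - vE i a' s' j b = -1"
      using 3(4,5) unfolding p pairings[OF assms(1,2) bounds(1,3)] pairings[OF assms(2,1) bounds(3,1)]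
        pairings[OF assms(1,2) bounds(2,3)] pairings[OF assms(2,1) bounds(3,2)] by simp_all
    have "vE i a' s' i a - vE i a s i a' = - 2"
      using adj 1 bounds(4-6)
      by (cases a b rule: linorder_cases; cases a' b rule: linorder_cases)
        (auto simp: vE_def cartan_def)
    then show ?case unfolding p
      by (intro qp2) (simp add: pairings[OF assms(1,1) bounds(1,2)] pairings[OF assms(1,1) bounds(2,1)])
  qed
  show "tsum (xF i) \<odot> (tsum (xF i) \<odot> tsum (xF j))
      - fscale (q + inverse q) (tsum (xF i) \<odot> (tsum (xF j) \<odot> tsum (xF i)))
      + tsum (xF j) \<odot> (tsum (xF i) \<odot> tsum (xF i)) = 0"
  proof (rule serre_monomial_sums[OF q_nonzero, where a = "xF i" and b = "xF j" and A = terms and B = terms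
      and u = "\<lambda>p r. pairing (xF j r) (xF i p) - pairing (xF i p) (xF j r)"], goal_cases)
    case (1 p r)
    obtain a s b t where p: "p = (a, s)" "r = (b, t)" by (cases p, cases r)
    then have bounds: "a < M" "b < M" "s = 1 \<or> s = -1" "t = 1 \<or> t = -1" using 1 by (auto simp: terms_def)
    show ?case using adj bounds(3,4) unfolding p pairings[OF assms(1,2) bounds(1,2)]
      pairings[OF assms(2,1) bounds(2,1)]
      by (cases a b rule: linorder_cases) (auto simp: vF_def cartan_def)
  next
    case 2 show ?case by (rule qp)
  next
    case (3 p p' r)
    obtain a s a' s' b t where p: "p = (a, s)" "p' = (a', s')" "r = (b, t)"
      by (cases p, cases p', cases r)
    then have bounds: "a < M" "a' < M" "b < M" "s = 1 \<or> s = -1" "s' = 1 \<or> s' = -1" "t = 1 \<or> t = -1"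
      using 3 by (auto simp: terms_def)
    have 1: "vF i a s j b - vF j b t i a = 1" "vF i a' s' j b - vF j b t i a' = -1"
      using 3(4,5) unfolding p pairings[OF assms(1,2) bounds(1,3)] pairings[OF assms(2,1) bounds(3,1)]
        pairings[OF assms(1,2) bounds(2,3)] pairings[OF assms(2,1) bounds(3,2)] by simp_all
    have "vF i a s i a' - vF i a' s' i a = - 2"
      using adj 1 bounds(4-6)
      by (cases a b rule: linorder_cases; cases a' b rule: linorder_cases)
        (auto simp: vF_def cartan_def)
    then show ?case unfolding p
      by (intro qp2) (simp add: pairings[OF assms(1,1) bounds(1,2)] pairings[OF assms(1,1) bounds(2,1)])
  qed
qed

text \<open>Monomials from different copies commute because the torus factors that the coproduct
  attaches to \<open>E\<close> and to \<open>F\<close> compensate; in a common copy equal signs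
  commute as well. The surviving pairs have the same copy and opposite signs.\<close>

lemma E_F_commutator:
  assumes "i < n" "j < n"
  shows "tsum (xE i) \<odot> tsum (xF j) - tsum (xF j) \<odot> tsum (xE i) =
    (\<Sum>a<M. fscale ((of_bool (i = j) - of_bool (j = i + 1)) / (q - inverse q))
      (delta (xE i (a, -1) + xF j (a, 1)) - delta (xE i (a, 1) + xF j (a, -1))))"
proof -
  define f where "f p r = fscale (term_coeff p * term_coeff r *
    (q_pair (xE i p) (xF j r) - q_pair (xF j r) (xE i p))) (delta (xE i p + xF j r))" for p r
  have f0: "f p r = 0" if "p \<in> terms" "r \<in> terms" "fst p \<noteq> fst r \<or> snd p = snd r" for p r
  proof -
    have "pairing (xE i p) (xF j r) = pairing (xF j r) (xE i p)"
      using that assms by (cases p; cases r) (auto simp: pairings terms_def vE_def vF_def cartan_def)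
    then show ?thesis by (simp only: f_def q_pair_def diff_self mult_zero_right fs.scale_zero_left)
  qed
  have inner: "(\<Sum>r\<in>terms. f p r) = f p (fst p, - snd p)" if "p \<in> terms" for p
  proof -
    have "(\<Sum>r\<in>terms. f p r) = (\<Sum>r\<in>{(fst p, - snd p)}. f p r)"
    proof (rule sum.mono_neutral_right)
      show "{(fst p, - snd p)} \<subseteq> terms" using that by (auto simp: terms_def)
      show "\<forall>r\<in>terms - {(fst p, - snd p)}. f p r = 0"
        using that by (auto intro!: f0 simp: terms_def)
    qed simp
    then show ?thesis by simp
  qed
  have "tsum (xE i) \<odot> tsum (xF j) - tsum (xF j) \<odot> tsum (xE i) = (\<Sum>p\<in>terms. \<Sum>r\<in>terms. f p r)"
    unfolding tsum_commutator f_def ..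
  also have "\<dots> = (\<Sum>p\<in>terms. f p (fst p, - snd p))"
    by (rule sum.cong[OF refl inner])
  also have "\<dots> = (\<Sum>a<M. \<Sum>s\<in>{1, -1}. f (a, s) (a, - s))"
    unfolding terms_def sum.cartesian_product by (simp add: case_prod_unfold)
  also have "\<dots> = (\<Sum>a<M. f (a, 1) (a, -1) + f (a, -1) (a, 1))"
    by (rule sum.cong[OF refl]) simp
  also have "\<dots> = (\<Sum>a<M. fscale ((of_bool (i = j) - of_bool (j = i + 1)) / (q - inverse q))
      (delta (xE i (a, -1) + xF j (a, 1)) - delta (xE i (a, 1) + xF j (a, -1))))"
  proof (rule sum.cong[OF refl])
    fix a assume "a \<in> {..<M}"
    then have a: "a < M" by simp
    define d where "d = q - inverse q"
    let ?k = "of_bool (i = j) - of_bool (j = i + 1) :: complex"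
    have d: "d \<noteq> 0" using q_diff_nonzero by (simp add: d_def)
    have "q powi (- vE i a 1 j a) - q powi (vF j a (-1) i a) = ?k * d"
      "q powi (- vE i a (-1) j a) - q powi (vF j a 1 i a) = - ?k * d"
      by (auto simp: vE_def vF_def d_def power_int_minus)
    then have "f (a, 1) (a, -1) = fscale (- (?k / d)) (delta (xE i (a, 1) + xF j (a, -1)))"
      "f (a, -1) (a, 1) = fscale (?k / d) (delta (xE i (a, -1) + xF j (a, 1)))"
      using d by (auto simp: f_def q_pair_def pairings[OF assms(1,2) a a] pairings[OF assms(2,1) a a]
          term_coeff_def simp flip: d_def intro!: arg_cong2[of _ _ _ _ fscale])
    then show "f (a, 1) (a, -1) + f (a, -1) (a, 1) = fscale (?k / (q - inverse q))
      (delta (xE i (a, -1) + xF j (a, 1)) - delta (xE i (a, 1) + xF j (a, -1)))"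
      by (simp only: d_def fs.scale_minus_left fs.scale_right_diff_distrib) (simp only: add.commute diff_conv_add_uminus)
  qed
  finally show ?thesis .
qed

text \<open>The shifts cancel, leaving \<open>K i\<close> on the copies before a cut and its inverse
  behind it. The sign decides on which side of copy \<open>a\<close> the cut lies, so neighbouring
  copies share a monomial.\<close>

lemma xE_xF_sum:
  assumes "s = 1 \<or> s = -1"
  shows "xE i (a, s) + xF i (a, - s) = expo (\<lambda>_ _. 0)
    (\<lambda>j b. if b < (if s = 1 then a else Suc a) then cartan i j else - cartan i j)"
proof -
  have "(\<lambda>j b. (if j = i \<and> b = a then 1 else 0) + (if j = i \<and> b = a then -1 else 0)) = (\<lambda>_ _. 0 :: int)"
    by (auto simp: fun_eq_iff)
  moreover have "(\<lambda>j b. vE i a s j b + vF i a (- s) j b) =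
      (\<lambda>j b. if b < (if s = 1 then a else Suc a) then cartan i j else - cartan i j)"
    using assms by (auto simp: fun_eq_iff vE_def vF_def cartan_def)
  ultimately show ?thesis unfolding xE_def xF_def prod.case expo_add by simp
qed

text \<open>The scalar in \<open>E_F_commutator\<close> is not zero when the second index is
  \<open>Suc i\<close>. Each copy nevertheless contributes nothing, because its two monomials
  coincide.\<close>

lemma xE_xF_sum_next:
  "xE i (a, -1) + xF (Suc i) (a, 1) = xE i (a, 1) + xF (Suc i) (a, -1)"
  unfolding xE_def xF_def prod.case expo_add
  by (intro arg_cong2[of _ _ _ _ expo] ext) (auto simp: vE_def vF_def cartan_def)

lemma expo_cong:
  assumes "\<And>j b. b < M \<Longrightarrow> v j b = v' j b" shows "expo m v = expo m v'"
proof (rule poly_eqI)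
  fix i
  show "coeff (expo m v) i = coeff (expo m v') i"
  proof (cases "M = 0")
    case False
    then show ?thesis using assms by (auto simp: coeff_expo layout_def)
  qed (auto simp: coeff_expo layout_def)
qed

text \<open>The contributions of the copies telescope.\<close>

lemma E_F_commutator_same:
  assumes "i < n"
  shows "tsum (xE i) \<odot> tsum (xF i) - tsum (xF i) \<odot> tsum (xE i) =
    fscale (1 / (q - inverse q)) (delta (xK 1 i) - delta (xK (-1) i))"
proof -
  define \<kappa> where "\<kappa> h = delta (expo (\<lambda>_ _. 0) (\<lambda>j b. if b < h then cartan i j else - cartan i j))" for h
  have "tsum (xE i) \<odot> tsum (xF i) - tsum (xF i) \<odot> tsum (xE i) =
      (\<Sum>a<M. fscale (1 / (q - inverse q)) (\<kappa> (Suc a) - \<kappa> a))"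
    unfolding E_F_commutator[OF assms assms]
    using xE_xF_sum[of 1 i] xE_xF_sum[of "-1" i] by (simp add: \<kappa>_def)
  also have "\<dots> = fscale (1 / (q - inverse q)) (\<Sum>a<M. \<kappa> (Suc a) - \<kappa> a)"
    by (simp only: fs.scale_sum_right)
  also have "(\<Sum>a<M. \<kappa> (Suc a) - \<kappa> a) = \<kappa> M - \<kappa> 0"
    by (rule sum_lessThan_telescope)
  also have "\<kappa> M = delta (xK 1 i)" unfolding \<kappa>_def xK_def by (auto intro!: arg_cong[of _ _ delta] expo_cong)
  also have "\<kappa> 0 = delta (xK (-1) i)" by (simp add: \<kappa>_def xK_def)
  finally show ?thesis .
qed

lemma E_F_commute:
  assumes "i < n" "j < n" "i \<noteq> j"
  shows "tsum (xE i) \<odot> tsum (xF j) = tsum (xF j) \<odot> tsum (xE i)"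
proof -
  have "tsum (xE i) \<odot> tsum (xF j) - tsum (xF j) \<odot> tsum (xE i) = 0"
  proof (cases "j = Suc i")
    case True
    show ?thesis unfolding E_F_commutator[OF assms(1,2)] unfolding True xE_xF_sum_next
      by (simp only: diff_self fs.scale_zero_right sum.neutral_const)
  next
    case False
    then show ?thesis unfolding E_F_commutator[OF assms(1,2)] using assms(3)
      by (intro sum.neutral ballI) (simp add: fs.scale_zero_left)
  qed
  then show ?thesis by (rule right_minus_eq[THEN iffD1])
qed

lemma rep_relations:
  assumes "r \<in> Uq_sl_rel q N" shows "rep r = 0"
proof -
  let ?E = "\<lambda>i. tsum (xE i)" and ?F = "\<lambda>i. tsum (xF i)"
  have E: "rep_word [E i, E j] = ?E i \<odot> ?E j" if "i < n" "j < n" for i j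
    using that by (simp add: torus_image.simps tmult_one_right)
  have F: "rep_word [F i, F j] = ?F i \<odot> ?F j" if "i < n" "j < n" for i j
    using that by (simp add: torus_image.simps tmult_one_right)
  have EF: "rep_word [E i, F j] = ?E i \<odot> ?F j" "rep_word [F j, E i] = ?F j \<odot> ?E i"
    if "i < n" "j < n" for i j
    using that by (simp_all add: torus_image.simps tmult_one_right)
  have E3: "rep_word [E i, E j, E k] = ?E i \<odot> (?E j \<odot> ?E k)"
    and F3: "rep_word [F i, F j, F k] = ?F i \<odot> (?F j \<odot> ?F k)" if "i < n" "j < n" "k < n" for i j k
    using that by (simp_all add: torus_image.simps tmult_one_right)
  have KE: "rep_word [K i, E j, Kinv i] = fscale (q powi cartan i j) (?E j)"
    and KF: "rep_word [K i, F j, Kinv i] = fscale (q powi (- cartan i j)) (?F j)"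
    if "i < n" "j < n" for i j
    using K_conj_tsum[OF that(1), of "xE j" "cartan i j"] K_conj_tsum[OF that(1), of "xF j" "- cartan i j"]
      pairing_xK_terms[OF that] that
    by (simp_all add: torus_image.simps tmult_one_right)
  have single: "rep_word [E i] = ?E i" "rep_word [F i] = ?F i"
    "rep_word [K i] = delta (xK 1 i)" "rep_word [Kinv i] = delta (xK (-1) i)" if "i < n" for i
    using that by (simp_all add: torus_image.simps tmult_one_right)
  have out: "rep_word [g] = 0" if "n \<le> index g" for g
    using that by (cases g) (simp_all add: torus_image.simps)
  note unfold = rep_lin list.map sum_list.Cons sum_list.Nil prod.case fs.scale_one fs.scale_minus_left
    add_0_right
  show ?thesis
    using assms unfolding Uq_sl_rel_def n_def[symmetric] Un_iff mem_Collect_eq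
  proof (elim disjE exE conjE, goal_cases)
    case 1 then show ?case
      by (simp only: unfold rep_K_inverse rep_word_simps(1) right_minus)
  next
    case 2 then show ?case
      by (simp only: unfold rep_K_inverse rep_word_simps(1) right_minus)
  next
    case (3 i j) show ?case
      unfolding 3(1) by (simp only: unfold rep_K_commute[OF 3(2,3)] right_minus)
  next
    case 4 then show ?case by (simp only: unfold KE single right_minus)
  next
    case 5 then show ?case by (simp only: unfold KF single right_minus)
  next
    case (6 i j)
    then show ?case using E_F_commute[OF 6(2-4)] by (simp only: unfold EF right_minus)
  next
    case (7 i)
    have "rep r = (?E i \<odot> ?F i - ?F i \<odot> ?E i)
        - fscale (1 / (q - inverse q)) (delta (xK 1 i) - delta (xK (-1) i))"
      unfolding 7(1) using 7(2)
      by (simp only: unfold EF single minus_divide_left[symmetric] fs.scale_right_diff_distrib)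
        (simp add: algebra_simps)
    then show ?case unfolding E_F_commutator_same[OF 7(2)] by (simp only: diff_self)
  next
    case (8 i j)
    have "rep r = ?E i \<odot> (?E i \<odot> ?E j) - fscale (q + inverse q) (?E i \<odot> (?E j \<odot> ?E i))
        + ?E j \<odot> (?E i \<odot> ?E i)"
      unfolding 8(1) using 8(2,3) by (simp only: unfold E3) (simp only: diff_conv_add_uminus add.assoc)
    then show ?case using serre_tsum(1)[OF 8(2-4)] by (simp only:)
  next
    case (9 i j)
    have "rep r = ?F i \<odot> (?F i \<odot> ?F j) - fscale (q + inverse q) (?F i \<odot> (?F j \<odot> ?F i))
        + ?F j \<odot> (?F i \<odot> ?F i)"
      unfolding 9(1) using 9(2,3) by (simp only: unfold F3) (simp only: diff_conv_add_uminus add.assoc)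
    then show ?case using serre_tsum(2)[OF 9(2-4)] by (simp only:)
  next
    case (10 i j)
    then show ?case using far_commute(1)[OF 10(2-4)] by (simp only: unfold E right_minus)
  next
    case (11 i j)
    then show ?case using far_commute(2)[OF 11(2-4)] by (simp only: unfold F right_minus)
  next
    case (12 g i)
    then have "rep_word [g] = 0" by (intro out) auto
    then show ?case unfolding 12(1) by (simp only: unfold)
  qed
qed

lemma rep_ideal_zero: "a \<in> Uq_ideal \<Longrightarrow> a \<in> FA \<and> rep a = 0"
  by (rule rep_ideal[OF Uq_sl_rel_FA rep_relations])

end

section \<open>Leading exponents of root vectors\<close>

text \<open>For terms of consecutive simple roots this holds exactly if the monomials commute up to
  \<open>inverse q\<close>. In all other cases the factor is \<open>q\<close> and the q-commutator
  in \<open>rootvec\<close> annihilates the pair.\<close>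

definition chain_step :: "nat \<times> int \<Rightarrow> nat \<times> int \<Rightarrow> bool" where
  "chain_step p r \<longleftrightarrow> fst r < fst p \<or> (fst r = fst p \<and> snd p = -1)"

fun chain_exp :: "(nat \<Rightarrow> nat \<times> int \<Rightarrow> 'g::comm_monoid_add) \<Rightarrow> nat \<Rightarrow> (nat \<times> int) list \<Rightarrow> 'g" where
  "chain_exp x k [] = 0"
| "chain_exp x k (p # c) = x k p + chain_exp x (Suc k) c"

lemma poly_positive:
  fixes D :: "int poly"
  assumes "\<exists>i. coeff D i > 0" "\<And>i. coeff D i < 0 \<Longrightarrow> \<exists>j>i. coeff D j > 0"
  shows "D > 0"
proof -
  have "D \<noteq> 0" using assms(1) by auto
  moreover have "\<not> coeff D (degree D) < 0" using assms(2) coeff_eq_0 by fastforce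
  ultimately show ?thesis
    by (simp add: less_poly_def pos_poly_def) (metis leading_coeff_neq_0 linorder_neqE_linordered_idom)
qed

lemma (in twisted_group) tmult_delta_right:
  assumes "y \<in> finsupp" shows "(y \<odot> delta p) r = y (r - p) * \<chi> (r - p) p"
proof -
  let ?A = "insert (r - p) {s. y s \<noteq> 0}"
  have fin: "finite ?A" using assms by (simp add: finsupp_def)
  have "(y \<odot> delta p) r = (\<Sum>s\<in>?A. y s * \<chi> s (r - s) * delta p (r - s))"
    by (rule tmult_superset[OF fin]) auto
  also have "\<dots> = (\<Sum>s\<in>?A. if s = r - p then y s * \<chi> s (r - s) else 0)"
    by (rule sum.cong) (auto simp: delta_def)
  also have "\<dots> = y (r - p) * \<chi> (r - p) p" using fin by (simp add: sum.delta)
  finally show ?thesis .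
qed

text \<open>This treats \<open>E\<^sub>i\<close> and \<open>F\<^sub>i\<close> at once, the latter after reversing the orders of the simple
  roots and of the copies. The readouts \<open>\<mu>\<close> and \<open>\<nu>\<close> recover a chain from the sum of its exponents,
  and \<open>h\<close> compares a chain with the one that stays constantly in copy \<open>k\<close>.\<close>

locale chain_family = uq_sl q N for q N +
  fixes x :: "nat \<Rightarrow> nat \<times> int \<Rightarrow> int poly"
    and \<mu> \<nu> :: "nat \<Rightarrow> nat \<Rightarrow> int poly \<Rightarrow> int" and h :: "nat \<Rightarrow> int poly \<Rightarrow> int"
    and side :: "int poly \<Rightarrow> bool"
  assumes pairing_next: "\<And>k p r. Suc k < n \<Longrightarrow> p \<in> terms \<Longrightarrow> r \<in> terms \<Longrightarrow>
      pairing (x k p) (x (Suc k) r) - pairing (x (Suc k) r) (x k p) = (if chain_step p r then -1 else 1)"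
    and pairing_far: "\<And>k l p r. Suc k < l \<Longrightarrow> l < n \<Longrightarrow> p \<in> terms \<Longrightarrow> r \<in> terms \<Longrightarrow>
      pairing (x k p) (x l r) = pairing (x l r) (x k p)"
    and mu_add: "\<And>k b p r. \<mu> k b (p + r) = \<mu> k b p + \<mu> k b r"
    and nu_add: "\<And>k b p r. \<nu> k b (p + r) = \<nu> k b p + \<nu> k b r"
    and h_add: "\<And>k p r. h k (p + r) = h k p + h k r"
    and mu_x: "\<And>k l b p. k < n \<Longrightarrow> l < n \<Longrightarrow> b < M \<Longrightarrow> p \<in> terms \<Longrightarrow>
      \<mu> k b (x l p) = of_bool (l = k \<and> fst p = b)"
    and nu_same: "\<And>k p. k < n \<Longrightarrow> p \<in> terms \<Longrightarrow> \<nu> k (fst p) (x k p) = - snd p"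
    and nu_later: "\<And>k l b p. k < l \<Longrightarrow> l < n \<Longrightarrow> b < M \<Longrightarrow> p \<in> terms \<Longrightarrow> fst p \<le> b \<Longrightarrow> \<nu> k b (x l p) = 0"
    and h_x: "\<And>k l p. k < n \<Longrightarrow> l < n \<Longrightarrow> p \<in> terms \<Longrightarrow>
      h k (x l p) = (if l = k then idx_height k (fst p) else 0)"
    and side_0: "side 0" and side_add: "\<And>D D'. side D \<Longrightarrow> side D' \<Longrightarrow> side (D + D')"
    and side_x: "\<And>l p r. l < n \<Longrightarrow> p \<in> terms \<Longrightarrow> r \<in> terms \<Longrightarrow> fst r < n \<Longrightarrow> side (x l r - x l p)"
    and h_positive: "\<And>l D. side D \<Longrightarrow> l < n \<Longrightarrow> h l D > 0 \<Longrightarrow> (\<And>l'. l' < l \<Longrightarrow> h l' D = 0) \<Longrightarrow> D > 0"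
begin

inductive chain :: "(nat \<times> int) list \<Rightarrow> bool" where
  single: "p \<in> terms \<Longrightarrow> chain [p]"
| step: "p \<in> terms \<Longrightarrow> chain (r # c) \<Longrightarrow> chain_step p r \<Longrightarrow> chain (p # r # c)"

inductive_cases chain_Cons_Cons: "chain (p # r # c)"

lemma chain_terms: "chain c \<Longrightarrow> set c \<subseteq> terms"
  by (induction rule: chain.induct) auto

lemma chain_decreasing: "chain (p # c) \<Longrightarrow> r \<in> set c \<Longrightarrow> fst r \<le> fst p"
proof (induction c arbitrary: p)
  case (Cons p' c)
  have c: "chain (p' # c)" "chain_step p p'"
    using Cons.prems(1) by (auto elim: chain_Cons_Cons)
  have "fst r \<le> fst p'" using Cons.IH[OF c(1)] Cons.prems(2) by auto
  also have "\<dots> \<le> fst p" using c(2) by (auto simp: chain_step_def)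
  finally show ?case .
qed simp

lemma additive_0: "(\<And>p r. f (p + r) = f p + f r) \<Longrightarrow> f (0 :: int poly) = (0 :: int)"
  by (metis add.right_neutral add_left_cancel)

lemma mu_chain:
  assumes "chain c \<or> c = []" "k + length c \<le> n" "l < n" "b < M"
  shows "\<mu> l b (chain_exp x k c) = of_bool (k \<le> l \<and> l < k + length c \<and> fst (c ! (l - k)) = b)"
  using assms(1,2)
proof (induction c arbitrary: k)
  case Nil then show ?case using additive_0[of "\<mu> l b"] mu_add by simp
next
  case (Cons p c)
  have c: "chain c \<or> c = []" and p: "p \<in> terms"
    using Cons.prems chain_terms[of "p # c"] by (auto elim: chain.cases)
  have "\<mu> l b (chain_exp x k (p # c)) =
      of_bool (k = l \<and> fst p = b) + of_bool (Suc k \<le> l \<and> l < Suc k + length c \<and> fst (c ! (l - Suc k)) = b)"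
    using Cons.prems assms p Cons.IH[OF c, of "Suc k"] by (simp add: mu_add mu_x)
  then show ?case by (cases "l = k") (auto simp: nth_Cons')
qed

lemma nu_chain_0:
  "set c \<subseteq> terms \<Longrightarrow> (\<And>r. r \<in> set c \<Longrightarrow> fst r \<le> b) \<Longrightarrow> k < l \<Longrightarrow> l + length c \<le> n \<Longrightarrow> b < M \<Longrightarrow>
    \<nu> k b (chain_exp x l c) = 0"
proof (induction c arbitrary: l)
  case Nil then show ?case using additive_0[of "\<nu> k b"] nu_add by simp
qed (auto simp: nu_add nu_later)

text \<open>\<open>\<mu>\<close> at the first simple root reveals the copy of the head. In that copy
  \<open>\<nu>\<close> reveals its sign, undisturbed by the later entries because their copies are
  not larger. Hence different chains of the same length cannot produce the same exponent and
  cancel.\<close>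

lemma chain_exp_head:
  assumes "chain (p # c)" "chain (p' # c')" "k + length c < n" "length c' = length c"
    and eq: "chain_exp x k (p # c) = chain_exp x k (p' # c')"
  shows "p = p'"
proof -
  have p: "p \<in> terms" "p' \<in> terms" using assms(1,2) chain_terms by fastforce+
  have b: "fst p < M" using p by simp
  have k: "k < n" using assms(3) by simp
  have "\<mu> k (fst p) (chain_exp x k (p # c)) = 1" "\<mu> k (fst p) (chain_exp x k (p' # c')) = of_bool (fst p' = fst p)"
    using assms k b by (subst mu_chain; simp)+
  then have 1: "fst p' = fst p" unfolding eq by (auto split: if_splits)
  have "\<nu> k (fst p) (chain_exp x k (p # c)) = - snd p"
    using nu_chain_0[of c "fst p" k "Suc k"] chain_terms[OF assms(1)] chain_decreasing[OF assms(1)] assms(3) b p k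
    by (simp add: nu_add nu_same)
  moreover have "\<nu> k (fst p') (chain_exp x k (p' # c')) = - snd p'"
    using nu_chain_0[of c' "fst p'" k "Suc k"] chain_terms[OF assms(2)] chain_decreasing[OF assms(2)] assms(3,4) 1 b p k
      nu_same[OF k p(2)] by (simp add: nu_add)
  ultimately show ?thesis using 1 unfolding eq by (simp add: prod_eq_iff)
qed

lemma pairing_chain_far:
  "set c \<subseteq> terms \<Longrightarrow> p \<in> terms \<Longrightarrow> Suc k < l \<Longrightarrow> l + length c \<le> n \<Longrightarrow>
    pairing (x k p) (chain_exp x l c) = pairing (chain_exp x l c) (x k p)"
proof (induction c arbitrary: l)
  case Nil then show ?case by (simp add: pairing_def)
qed (auto simp: pairing_add pairing_far)

lemma pairing_chain_next:
  assumes "chain (r # c)" "p \<in> terms" "Suc k + length c < n"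
  shows "pairing (x k p) (chain_exp x (Suc k) (r # c)) - pairing (chain_exp x (Suc k) (r # c)) (x k p)
    = (if chain_step p r then -1 else 1)"
proof -
  have "r \<in> terms" "set c \<subseteq> terms" using chain_terms[OF assms(1)] by auto
  then show ?thesis
    using pairing_next[of k p r] pairing_chain_far[of c p k "Suc (Suc k)"] assms
    by (simp add: pairing_add)
qed

lemma term_coeff_nonzero: "p \<in> terms \<Longrightarrow> term_coeff p \<noteq> 0"
  using q_diff_nonzero by (auto simp: term_coeff_def terms_def)

text \<open>Prefixing a term to a chain multiplies its coefficient by the scalar of a q-commutator,
  which is nonzero exactly for a \<open>chain_step\<close>. Since the head can be read off the
  exponent, at most one term contributes to each coefficient.\<close>

lemma rootvec_support:
  assumes e_FA: "\<And>i. e i \<in> FA" and e_rep: "\<And>i. i < n \<Longrightarrow> rep (e i) = tsum (x i)"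
  shows "k + d < n \<Longrightarrow> rep (rootvec q e k d) r \<noteq> 0 \<longleftrightarrow>
    (\<exists>c. chain c \<and> length c = Suc d \<and> r = chain_exp x k c)"
proof (induction d arbitrary: k r)
  case 0
  have val: "rep (e k) s = (\<Sum>p\<in>terms. if x k p = s then term_coeff p else 0)" for s
    unfolding e_rep[OF 0[simplified]] sum_apply
    by (intro sum.cong refl) (simp add: fscale_apply delta_def)
  have inj: "p = p'" if "p \<in> terms" "p' \<in> terms" "x k p = x k p'" for p p'
  proof (rule chain_exp_head)
    show "chain [p]" "chain [p']" using that by (auto intro: chain.single)
    show "chain_exp x k [p] = chain_exp x k [p']" using that by simp
  qed (use 0 in auto)
  show ?case
  proof
    assume "rep (rootvec q e k 0) r \<noteq> 0"
    then have "(\<Sum>p\<in>terms. if x k p = r then term_coeff p else 0) \<noteq> 0" by (simp add: val)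
    then obtain p where "p \<in> terms" "(if x k p = r then term_coeff p else 0) \<noteq> 0"
      by (rule sum.not_neutral_contains_not_neutral)
    then show "\<exists>c. chain c \<and> length c = Suc 0 \<and> r = chain_exp x k c"
      by (intro exI[of _ "[p]"]) (simp add: chain.single split: if_splits)
  next
    assume "\<exists>c. chain c \<and> length c = Suc 0 \<and> r = chain_exp x k c"
    then obtain c where c: "chain c" "length c = Suc 0" "r = chain_exp x k c" by blast
    obtain p where cp: "c = [p]" using c(2) by (cases c) auto
    have p: "p \<in> terms" "r = x k p" using c chain_terms[OF c(1)] by (simp_all add: cp)
    have "rep (e k) r = (\<Sum>p'\<in>{p}. if x k p' = r then term_coeff p' else 0)"
      unfolding val
    proof (rule sum.mono_neutral_right)
      show "\<forall>p'\<in>terms - {p}. (if x k p' = r then term_coeff p' else 0) = 0"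
        using inj p by fastforce
    qed (use p in simp_all)
    then show "rep (rootvec q e k 0) r \<noteq> 0" using p term_coeff_nonzero by simp
  qed
next
  case (Suc d)
  let ?y = "rootvec q e (Suc k) d"
  have k: "k < n" using Suc.prems by simp
  have y_FA: "?y \<in> FA" by (rule rootvec_FA[OF e_FA])
  \<comment> \<open>The contribution of the term \<open>p\<close> of \<open>e k\<close> to the
    coefficient at \<open>r\<close>, taken from both products of the q-commutator.\<close>
  define T where "T p = term_coeff p * (q_pair (x k p) (r - x k p) - q * q_pair (r - x k p) (x k p))
    * rep ?y (r - x k p)" for p
  have "rep (rootvec q e k (Suc d)) = tsum (x k) \<odot> rep ?y - fscale q (rep ?y \<odot> tsum (x k))"
    by (simp only: rootvec_Suc rep_diff rep_mult rep_scale FA_mult FA_scale e_FA y_FA e_rep[OF k])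
  moreover have "(tsum (x k) \<odot> rep ?y) r =
      (\<Sum>p\<in>terms. term_coeff p * (q_pair (x k p) (r - x k p) * rep ?y (r - x k p)))"
    by (simp add: tmult_sum_left finsupp_scale tmult_scale_left sum_apply fscale_apply tmult_delta)
  moreover have "(rep ?y \<odot> tsum (x k)) r =
      (\<Sum>p\<in>terms. term_coeff p * (rep ?y (r - x k p) * q_pair (r - x k p) (x k p)))"
    by (simp add: tmult_sum_right tmult_scale_right sum_apply fscale_apply tmult_delta_right)
  moreover have "T p = term_coeff p * (q_pair (x k p) (r - x k p) * rep ?y (r - x k p))
      - q * (term_coeff p * (rep ?y (r - x k p) * q_pair (r - x k p) (x k p)))" for p
    unfolding T_def by algebra
  ultimately have sum: "rep (rootvec q e k (Suc d)) r = (\<Sum>p\<in>terms. T p)"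
    by (simp only: minus_apply fscale_apply sum_subtractf sum_distrib_left)
  have T: "T p \<noteq> 0 \<longleftrightarrow> (\<exists>c. chain (p # c) \<and> length c = Suc d \<and> r = chain_exp x k (p # c))"
    if p: "p \<in> terms" for p
  proof -
    \<comment> \<open>Entries behind \<open>p'\<close> belong to roots not adjacent to
      \<open>k\<close> and commute with \<open>p\<close>. So the scalar is
      \<open>inverse q - q\<close> or \<open>q - q\<close>, up to a unit, according to the pair
      \<open>p\<close>, \<open>p'\<close> alone.\<close>
    have factor: "q_pair (x k p) s - q * q_pair s (x k p) \<noteq> 0 \<longleftrightarrow> chain_step p p'"
      if s: "s = chain_exp x (Suc k) (p' # c)" "chain (p' # c)" "length c = d" for s p' c
    proof -
      have "pairing (x k p) s = (if chain_step p p' then -1 else 1) + pairing s (x k p)"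
        using pairing_chain_next[of p' c p k] s p Suc.prems
        by (simp only: s(1)) (simp del: chain_exp.simps)
      then have eq: "q_pair (x k p) s = q powi (if chain_step p p' then -1 else 1) * q_pair s (x k p)"
        unfolding q_pair_def using q_nonzero by (simp only: power_int_add simp_thms)
      have "q_pair (x k p) s - q * q_pair s (x k p) =
          (if chain_step p p' then - (q - inverse q) * q_pair s (x k p) else 0)"
        unfolding eq by (simp add: power_int_minus algebra_simps)
      then show ?thesis using q_diff_nonzero chi_nonzero[of s "x k p"] by simp
    qed
    show ?thesis
    proof
      assume T: "T p \<noteq> 0"
      then obtain c where c: "chain c" "length c = Suc d" "r - x k p = chain_exp x (Suc k) c"
        using Suc.IH[of "Suc k" "r - x k p"] Suc.prems by (auto simp: T_def)
      then obtain p' c' where c': "c = p' # c'" by (cases c) auto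
      have "chain_step p p'" using factor[of "r - x k p" p' c'] T c c' by (auto simp: T_def)
      then have "chain (p # c)" using c(1) c' p by (auto intro: chain.intros)
      moreover have "r = chain_exp x k (p # c)" using c(3) by (simp add: algebra_simps)
      ultimately show "\<exists>c. chain (p # c) \<and> length c = Suc d \<and> r = chain_exp x k (p # c)"
        using c(2) by blast
    next
      assume "\<exists>c. chain (p # c) \<and> length c = Suc d \<and> r = chain_exp x k (p # c)"
      then obtain c where c: "chain (p # c)" "length c = Suc d" "r = chain_exp x k (p # c)" by blast
      obtain p' c' where c': "c = p' # c'" using c(2) by (cases c) auto
      have ch: "chain c" "chain_step p p'" using c(1) c' by (auto elim: chain_Cons_Cons)
      have r: "r - x k p = chain_exp x (Suc k) c" using c(3) by simp
      then have "rep ?y (r - x k p) \<noteq> 0" using Suc.IH[of "Suc k"] Suc.prems ch c(2) by auto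
      moreover have "q_pair (x k p) (r - x k p) - q * q_pair (r - x k p) (x k p) \<noteq> 0"
        using factor[of "r - x k p" p' c'] r c' ch c(2) by simp
      ultimately show "T p \<noteq> 0" using term_coeff_nonzero[OF p] by (simp add: T_def)
    qed
  qed
  show ?case
  proof
    assume "rep (rootvec q e k (Suc d)) r \<noteq> 0"
    then obtain p where "p \<in> terms" "T p \<noteq> 0"
      unfolding sum by (auto elim: sum.not_neutral_contains_not_neutral)
    then obtain c where "chain (p # c)" "length c = Suc d" "r = chain_exp x k (p # c)" using T by blast
    then show "\<exists>c. chain c \<and> length c = Suc (Suc d) \<and> r = chain_exp x k c"
      by (intro exI[of _ "p # c"]) simp
  next
    assume "\<exists>c. chain c \<and> length c = Suc (Suc d) \<and> r = chain_exp x k c"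
    then obtain p c where c: "chain (p # c)" "length c = Suc d" "r = chain_exp x k (p # c)"
      by (auto simp: length_Suc_conv)
    have p: "p \<in> terms" using chain_terms[OF c(1)] by simp
    have "T p' = 0" if p': "p' \<in> terms - {p}" for p'
    proof (rule ccontr)
      assume "T p' \<noteq> 0"
      then obtain c' where "chain (p' # c')" "length c' = Suc d" "r = chain_exp x k (p' # c')"
        using \<open>T p' \<noteq> 0\<close> T[of p'] p' by blast
      then have "p = p'" using chain_exp_head[OF c(1), of p' c' k] c Suc.prems by simp
      then show False using p' by simp
    qed
    then have "(\<Sum>p\<in>terms. T p) = (\<Sum>p\<in>{p}. T p)"
      using p by (intro sum.mono_neutral_right) auto
    moreover have "T p \<noteq> 0" using T[OF p] c by blast
    ultimately show "rep (rootvec q e k (Suc d)) r \<noteq> 0" unfolding sum by simp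
  qed
qed

lemma constant_chain: "a < M \<Longrightarrow> chain (replicate (Suc d) (a, -1))"
  by (induction d) (auto intro!: chain.intros simp: terms_def chain_step_def)

lemma h_chain:
  "set c \<subseteq> terms \<Longrightarrow> k + length c \<le> n \<Longrightarrow> l < n \<Longrightarrow>
   h l (chain_exp x k c) = (if k \<le> l \<and> l < k + length c then idx_height l (fst (c ! (l - k))) else 0)"
proof (induction c arbitrary: k)
  case Nil then show ?case using additive_0[of "h l"] h_add by simp
next
  case (Cons p c)
  have "h l (chain_exp x k (p # c)) = (if k = l then idx_height l (fst p) else 0) +
      (if Suc k \<le> l \<and> l < Suc k + length c then idx_height l (fst (c ! (l - Suc k))) else 0)"
    using Cons.prems Cons.IH[of "Suc k"] by (simp add: h_add h_x)
  then show ?case by (cases "l = k") (auto simp: nth_Cons')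
qed

lemma side_chain:
  "set c \<subseteq> terms \<Longrightarrow> set c' \<subseteq> terms \<Longrightarrow> length c' = length c \<Longrightarrow> k + length c \<le> n \<Longrightarrow>
    (\<And>r. r \<in> set c' \<Longrightarrow> fst r < n) \<Longrightarrow> side (chain_exp x k c' - chain_exp x k c)"
proof (induction c arbitrary: c' k)
  case Nil then show ?case by (simp add: side_0)
next
  case (Cons p c)
  obtain r d where d: "c' = r # d" using Cons.prems(3) by (cases c') auto
  have "side ((x k r - x k p) + (chain_exp x (Suc k) d - chain_exp x (Suc k) c))"
    using Cons.prems d by (intro side_add side_x Cons.IH) auto
  then show ?case by (simp add: d algebra_simps)
qed

text \<open>The first entry outside copy \<open>k\<close> decides. At the head every other copy has
  smaller weight; further along, monotonicity forces the copy below \<open>k\<close>, where the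
  weight is smaller too. All earlier entries give equal weights.\<close>

lemma chain_exp_less:
  assumes "chain c" "length c = Suc d" "k + d < n" and ex: "\<exists>i\<le>d. fst (c ! i) \<noteq> k"
  shows "chain_exp x k c < chain_exp x k (replicate (Suc d) (k, -1))"
proof -
  let ?c' = "replicate (Suc d) (k, -1 :: int)"
  have kM: "k < M" using assms(3) by (simp add: M_def)
  have terms: "set c \<subseteq> terms" "set ?c' \<subseteq> terms"
    using chain_terms assms(1) constant_chain[OF kM] by blast+
  define i where "i = (LEAST i. i \<le> d \<and> fst (c ! i) \<noteq> k)"
  have i: "i \<le> d" "fst (c ! i) \<noteq> k" using LeastI_ex[OF ex] by (auto simp: i_def)
  have below: "fst (c ! j) = k" if "j < i" for j
    using not_less_Least[of j "\<lambda>i. i \<le> d \<and> fst (c ! i) \<noteq> k"] that i by (auto simp: i_def)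
  let ?D = "chain_exp x k ?c' - chain_exp x k c"
  have hdiff: "h l (p - r) = h l p - h l r" for l p r
    using h_add[of l "p - r" r] by simp
  have hD: "h l ?D = (if k \<le> l \<and> l < k + Suc d then idx_height l k - idx_height l (fst (c ! (l - k))) else 0)"
    if "l < n" for l
  proof -
    have "l - k < Suc d" if "k \<le> l" "l < k + Suc d" using that by linarith
    then show ?thesis
      using that assms terms by (simp add: hdiff h_chain del: replicate.simps)
  qed
  have less: "idx_height (k + i) (fst (c ! i)) < idx_height (k + i) k"
  proof (cases i)
    case 0 then show ?thesis using i(2) by (auto simp: idx_height_def)
  next
    case (Suc j)
    obtain p c0 where c: "c = p # c0" using assms(2) by (cases c) auto
    have "fst p = k" using below[of 0] Suc c by simp
    moreover have "c ! i \<in> set c0" using i(1) assms(2) c Suc by simp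
    ultimately have "fst (c ! i) \<le> k" using chain_decreasing[of p c0] assms(1) c by auto
    then show ?thesis using i(2) by (auto simp: idx_height_def)
  qed
  have "?D > 0"
  proof (rule h_positive)
    show "side ?D" using terms assms by (intro side_chain) auto
    show "k + i < n" using i assms by simp
    show "h (k + i) ?D > 0" using hD[of "k + i"] i less assms by (simp del: replicate.simps)
    show "h l ?D = 0" if "l < k + i" for l
      using hD[of l] below[of "l - k"] that i assms by (auto simp del: replicate.simps)
  qed
  then show ?thesis by simp
qed

text \<open>The comparison forces the leading chain to stay in copy \<open>k\<close> but leaves the
  sign of its last entry open. Hence only the shift coordinates of the leading exponent are given;
  they are all that independence needs.\<close>

lemma rootvec_leads:
  assumes e_FA: "\<And>i. e i \<in> FA" and e_rep: "\<And>i. i < n \<Longrightarrow> rep (e i) = tsum (x i)"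
    and kd: "k + d < n"
  shows "\<exists>\<gamma>. leads (rep (rootvec q e k d)) \<gamma> \<and>
    (\<forall>l<n. \<forall>b<M. \<mu> l b \<gamma> = of_bool (k \<le> l \<and> l \<le> k + d \<and> b = k))"
proof -
  let ?y = "rep (rootvec q e k d)" and ?c' = "replicate (Suc d) (k, -1 :: int)"
  note supp = rootvec_support[OF e_FA e_rep kd, simplified]
  have kM: "k < M" using kd by (simp add: M_def)
  have c'y: "?y (chain_exp x k ?c') \<noteq> 0"
    using supp constant_chain[OF kM, of d] by (metis length_replicate)
  then have "?y \<noteq> 0" by (metis zero_fun_apply)
  then obtain \<gamma> where \<gamma>: "leads ?y \<gamma>" using leads_exists[OF rep_finsupp] by blast
  then obtain c where c: "chain c" "length c = Suc d" "\<gamma> = chain_exp x k c"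
    using supp by (auto simp: leads_def)
  have "\<forall>i\<le>d. fst (c ! i) = k"
    using chain_exp_less[OF c(1,2) kd] \<gamma> c'y c(3) unfolding leads_def by (metis leD)
  then have "\<mu> l b \<gamma> = of_bool (k \<le> l \<and> l \<le> k + d \<and> b = k)" if "l < n" "b < M" for l b
    unfolding c(3) using c(1,2) kd that by (subst mu_chain) auto
  then show ?thesis using \<gamma> by blast
qed

end

section \<open>Dimensions and leading exponents\<close>

definition lead_set :: "('g::linorder \<Rightarrow> complex) set \<Rightarrow> 'g set" where
  "lead_set S = {p. \<exists>x\<in>S. leads x p}"

text \<open>Among the summands with nonzero coefficient, the one with the largest leading exponent
  cannot be cancelled by the others.\<close>

lemma combination_leads:
  assumes "finite A" "\<And>i. i \<in> A \<Longrightarrow> leads (f i) (l i)" "inj_on l A"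
    and x: "x = (\<Sum>i\<in>A. fscale (c i) (f i))"
  shows "x r \<noteq> 0 \<Longrightarrow> \<exists>i\<in>A. c i \<noteq> 0 \<and> r \<le> l i" "leads x p \<Longrightarrow> p \<in> l ` A"
    "x = 0 \<Longrightarrow> i \<in> A \<Longrightarrow> c i = 0"
proof -
  have apply_x: "x r = (\<Sum>i\<in>A. c i * f i r)" for r
    unfolding x by (simp add: sum_apply fscale_apply)
  show upper: "\<exists>i\<in>A. c i \<noteq> 0 \<and> r \<le> l i" if "x r \<noteq> 0" for r
  proof -
    have "(\<Sum>i\<in>A. c i * f i r) \<noteq> 0" using that apply_x by simp
    then obtain i where "i \<in> A" "c i * f i r \<noteq> 0" by (rule sum.not_neutral_contains_not_neutral)
    then show ?thesis using assms(2)[of i] by (auto simp: leads_def)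
  qed
  let ?A = "{i \<in> A. c i \<noteq> 0}"
  have top: "\<exists>i\<in>?A. x (l i) \<noteq> 0 \<and> (\<forall>j\<in>?A. l j \<le> l i)" if "?A \<noteq> {}"
  proof -
    have "Max (l ` ?A) \<in> l ` ?A" using that assms(1) by (intro Max_in) auto
    then obtain i where i: "i \<in> ?A" "l i = Max (l ` ?A)" by auto
    have max: "l j \<le> l i" if "j \<in> ?A" for j
      unfolding i(2) using that assms(1) by (intro Max_ge) auto
    have "c j * f j (l i) = 0" if "j \<in> A - {i}" for j
    proof (rule ccontr)
      assume nz: "c j * f j (l i) \<noteq> 0"
      then have "l i \<le> l j" "l j \<le> l i" using assms(2)[of j] max[of j] that by (auto simp: leads_def)
      then have "i = j" using inj_onD[OF assms(3), of i j] i(1) that by auto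
      then show False using that by simp
    qed
    then have "x (l i) = (\<Sum>j\<in>{i}. c j * f j (l i))"
      unfolding apply_x using i assms(1) by (intro sum.mono_neutral_right) auto
    then have "x (l i) \<noteq> 0" using i assms(2)[of i] by (auto simp: leads_def)
    then show ?thesis using i(1) max by blast
  qed
  show "p \<in> l ` A" if p: "leads x p"
  proof -
    have "x p \<noteq> 0" using p by (simp add: leads_def)
    then have "?A \<noteq> {}" using upper by blast
    then obtain i where i: "i \<in> A" "x (l i) \<noteq> 0" "\<And>j. j \<in> A \<Longrightarrow> c j \<noteq> 0 \<Longrightarrow> l j \<le> l i" using top by blast
    then have "l i \<le> p" using p by (auto simp: leads_def)
    moreover have "p \<le> l i" using upper[OF \<open>x p \<noteq> 0\<close>] i(3) by (meson order_trans)
    ultimately show ?thesis using i(1) by auto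
  qed
  show "c i = 0" if "x = 0" "i \<in> A"
  proof (rule ccontr)
    assume "c i \<noteq> 0"
    then have "?A \<noteq> {}" using that by blast
    then show False using top that(1) by (metis zero_fun_apply)
  qed
qed

lemma leads_independent:
  assumes "\<And>p. p \<in> P \<Longrightarrow> leads (f p) p"
  shows "fs.independent (f ` P)" and "inj_on f P"
proof -
  show inj: "inj_on f P" using assms leads_unique by (metis inj_onI)
  show "fs.independent (f ` P)"
    unfolding fs.independent_explicit_module
  proof (intro allI impI)
    fix t u v assume t: "finite t" "t \<subseteq> f ` P" "(\<Sum>v\<in>t. fscale (u v) v) = 0" "v \<in> t"
    define Q where "Q = {p \<in> P. f p \<in> t}"
    have Q: "t = f ` Q" "inj_on f Q" using t(2) inj by (auto simp: Q_def intro: inj_on_subset)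
    have fin: "finite Q" using t(1) Q finite_image_iff by metis
    have "(\<Sum>p\<in>Q. fscale (u (f p)) (f p)) = 0"
      using t(3) unfolding Q(1) by (simp only: sum.reindex[OF Q(2)] comp_def)
    moreover obtain p where "p \<in> Q" "v = f p" using t(4) Q(1) by auto
    moreover have "leads (f p) (id p)" if "p \<in> Q" for p using that assms by (simp add: Q_def)
    ultimately show "u v = 0"
      using combination_leads(3)[OF fin, of f id "\<Sum>p\<in>Q. fscale (u (f p)) (f p)" "\<lambda>p. u (f p)" p] by auto
  qed
qed

text \<open>Gaussian elimination: one element chosen for each leading exponent gives an independent
  family, and reduction of leading terms shows that it spans.\<close>

lemma card_lead_set:
  assumes "finite Y" "Y \<subseteq> finsupp"
  shows "finite (lead_set (fs.span Y))" "card (lead_set (fs.span Y)) = fs.dim Y"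
proof -
  let ?L = "lead_set (fs.span Y)"
  have span_fin: "fs.span Y \<subseteq> finsupp"
    using assms(2) finsupp_subspace by (rule fs.span_minimal)
  have supp: "fs.span Y \<subseteq> {x. \<forall>r. x r \<noteq> 0 \<longrightarrow> r \<in> (\<Union>y\<in>Y. {r. y r \<noteq> 0})}"
    by (rule fs.span_minimal) (auto simp: fs.subspace_def fscale_apply, metis add.right_neutral)
  have "finite (\<Union>y\<in>Y. {r. y r \<noteq> 0})" using assms by (auto simp: finsupp_def)
  moreover have "?L \<subseteq> (\<Union>y\<in>Y. {r. y r \<noteq> 0})"
    using supp by (force simp: lead_set_def leads_def)
  ultimately show finL: "finite ?L" by (rule rev_finite_subset)
  have "\<forall>p\<in>?L. \<exists>x. x \<in> fs.span Y \<and> leads x p" by (auto simp: lead_set_def)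
  then obtain f where f: "\<And>p. p \<in> ?L \<Longrightarrow> f p \<in> fs.span Y \<and> leads (f p) p"
    using bchoice by metis
  have indep: "fs.independent (f ` ?L)" and inj: "inj_on f ?L"
    by (rule leads_independent, use f in blast)+
  have sub: "f ` ?L \<subseteq> fs.span Y" using f by blast
  \<comment> \<open>The induction measure counts the leading exponents that lie below some point of
    the support. Subtracting a multiple of \<open>f p\<close> pushes the support strictly below
    \<open>p\<close> and removes \<open>p\<close> from the count.\<close>
  have "x \<in> fs.span (f ` ?L)" if "x \<in> fs.span Y" for x
    using that
  proof (induction "card {p \<in> ?L. \<exists>r. x r \<noteq> 0 \<and> p \<le> r}" arbitrary: x rule: less_induct)
    case less
    show ?case
    proof (cases "x = 0")
      case True then show ?thesis by (simp only: fs.span_zero)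
    next
      case False
      then obtain p where p: "leads x p" using leads_exists span_fin less.prems by blast
      then have pL: "p \<in> ?L" using less.prems by (auto simp: lead_set_def)
      define c where "c = x p / f p p"
      define z where "z = x - fscale c (f p)"
      have z: "z \<in> fs.span Y"
        unfolding z_def using less.prems f[OF pL] by (intro fs.span_diff fs.span_scale) auto
      have fp: "leads (f p) p" using f pL by blast
      have zp: "z p = 0" using fp by (simp add: z_def c_def fscale_apply leads_def)
      have z_less: "r < p" if "z r \<noteq> 0" for r
      proof -
        have "x r \<noteq> 0 \<or> f p r \<noteq> 0" using that by (auto simp: z_def fscale_apply)
        then have "r \<le> p" using p fp by (auto simp: leads_def)
        moreover have "r \<noteq> p" using that zp by auto
        ultimately show ?thesis by simp
      qed
      have "{p' \<in> ?L. \<exists>r. z r \<noteq> 0 \<and> p' \<le> r} \<subset> {p' \<in> ?L. \<exists>r. x r \<noteq> 0 \<and> p' \<le> r}"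
      proof (rule psubsetI)
        have xp: "x p \<noteq> 0" using p by (simp add: leads_def)
        show "{p' \<in> ?L. \<exists>r. z r \<noteq> 0 \<and> p' \<le> r} \<subseteq> {p' \<in> ?L. \<exists>r. x r \<noteq> 0 \<and> p' \<le> r}"
          using z_less xp by (blast intro: order_trans less_imp_le)
        have "p \<in> {p' \<in> ?L. \<exists>r. x r \<noteq> 0 \<and> p' \<le> r}" using pL xp by blast
        moreover have "p \<notin> {p' \<in> ?L. \<exists>r. z r \<noteq> 0 \<and> p' \<le> r}" using z_less by (auto dest: leD)
        ultimately show "{p' \<in> ?L. \<exists>r. z r \<noteq> 0 \<and> p' \<le> r} \<noteq> {p' \<in> ?L. \<exists>r. x r \<noteq> 0 \<and> p' \<le> r}" by blast
      qed
      then have "z \<in> fs.span (f ` ?L)"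
        using finL z by (intro less.hyps psubset_card_mono) auto
      then have "z + fscale c (f p) \<in> fs.span (f ` ?L)"
        by (rule fs.span_add[OF _ fs.span_scale[OF fs.span_base[OF imageI[OF pL]]]])
      then show ?thesis by (simp only: z_def diff_add_cancel)
    qed
  qed
  then have "fs.span (f ` ?L) = fs.span Y"
    using fs.span_minimal[OF sub fs.subspace_span] by blast
  then have "fs.dim Y = fs.dim (f ` ?L)" by (metis fs.dim_span)
  also have "\<dots> = card (f ` ?L)" using indep by (rule fs.dim_eq_card_independent)
  also have "\<dots> = card ?L" using inj by (rule card_image)
  finally show "card ?L = fs.dim Y" by simp
qed

text \<open>With kernel \<open>I\<close> on \<open>FA\<close>, \<open>\<phi>\<close> induces an
  injection of the quotient. Independence modulo \<open>I\<close> thus turns into independence of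
  images, and the supremum over subsets into the dimension known to the library.\<close>

lemma dim_mod_eq_dim_image:
  fixes \<phi> :: "'g fa \<Rightarrow> 'b \<Rightarrow> complex"
  assumes "finite X" "X \<subseteq> FA"
    and add: "\<And>f g. f \<in> FA \<Longrightarrow> g \<in> FA \<Longrightarrow> \<phi> (f + g) = \<phi> f + \<phi> g"
    and scale: "\<And>c f. \<phi> (fscale c f) = fscale c (\<phi> f)"
    and ker: "\<And>f. f \<in> FA \<Longrightarrow> \<phi> f = 0 \<longleftrightarrow> f \<in> I"
  shows "dim_mod I X = fs.dim (\<phi> ` X)"
proof -
  have \<phi>_sum: "\<phi> (\<Sum>b\<in>B. fscale (c b) b) = (\<Sum>b\<in>B. fscale (c b) (\<phi> b))"
    if "finite B" "B \<subseteq> FA" for B c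
    using that
  proof (induction B rule: finite_induct)
    case empty
    have "\<phi> (fscale 0 0) = fscale 0 (\<phi> 0)" by (rule scale)
    then show ?case by (simp only: fs.scale_zero_left sum.empty)
  next
    case (insert b B)
    then have "\<phi> (fscale (c b) b + (\<Sum>b\<in>B. fscale (c b) b)) = fscale (c b) (\<phi> b) + \<phi> (\<Sum>b\<in>B. fscale (c b) b)"
      by (subst add) (auto intro!: FA_sum FA_scale simp: scale)
    then show ?case using insert by (simp only: sum.insert[OF insert(1,2)] insert_subset simp_thms)
  qed
  have pointwise: "(\<lambda>w. \<Sum>b\<in>B. c b * b w) = (\<Sum>b\<in>B. fscale (c b) b)" for B :: "'g fa set" and c
    by (rule ext) (simp add: sum_apply fscale_apply)
  have indep: "indep_mod I B \<longleftrightarrow> (\<forall>c. (\<Sum>b\<in>B. fscale (c b) (\<phi> b)) = 0 \<longrightarrow> (\<forall>b\<in>B. c b = 0))"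
    if "B \<subseteq> X" for B
  proof -
    have B: "finite B" "B \<subseteq> FA" using that assms(1,2) finite_subset by auto
    have "(\<Sum>b\<in>B. fscale (c b) b) \<in> I \<longleftrightarrow> (\<Sum>b\<in>B. fscale (c b) (\<phi> b)) = 0" for c
      unfolding \<phi>_sum[OF B, symmetric] using B by (intro ker[symmetric] FA_sum FA_scale) auto
    then show ?thesis unfolding indep_mod_def pointwise using B by simp
  qed
  have inj: "inj_on \<phi> B" "fs.independent (\<phi> ` B)" if B: "B \<subseteq> X" "indep_mod I B" for B
  proof -
    have fin: "finite B" using B(1) assms(1) finite_subset by auto
    note zero = B(2)[unfolded indep[OF B(1)], rule_format]
    show injB: "inj_on \<phi> B"
    proof (rule inj_onI, rule ccontr)
      fix a b assume ab: "a \<in> B" "b \<in> B" "\<phi> a = \<phi> b" "a \<noteq> b"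
      \<comment> \<open>Coefficients in \<open>indep_mod\<close> are indexed by the elements
        themselves, so two elements with the same image would satisfy a relation with coefficients 1
        and -1.\<close>
      define c where "c x = (if x = a then 1 else if x = b then -1 else 0 :: complex)" for x
      have "(\<Sum>x\<in>B. fscale (c x) (\<phi> x)) = (\<Sum>x\<in>{a, b}. fscale (c x) (\<phi> x))"
        using ab fin by (intro sum.mono_neutral_right) (auto simp: c_def fs.scale_zero_left)
      also have "\<dots> = fscale (c a) (\<phi> a) + fscale (c b) (\<phi> b)" using ab(4) by simp
      also have "\<dots> = fscale (1 + - 1) (\<phi> b)"
        unfolding ab(3) fs.scale_left_distrib[symmetric] using ab(4) by (simp add: c_def)
      also have "\<dots> = 0" by (simp only: add.right_inverse fs.scale_zero_left)
      finally have "c a = 0" using zero[of c a] ab by simp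
      then show False by (simp add: c_def)
    qed
    show "fs.independent (\<phi> ` B)"
      unfolding fs.independent_explicit_finite_subsets[of "\<phi> ` B"]
    proof (intro allI impI ballI)
      fix S u v assume S: "S \<subseteq> \<phi> ` B" "finite S" "(\<Sum>v\<in>S. fscale (u v) v) = 0" "v \<in> S"
      define u' where "u' v = (if v \<in> S then u v else 0)" for v
      have "(\<Sum>b\<in>B. fscale (u' (\<phi> b)) (\<phi> b)) = (\<Sum>v\<in>\<phi> ` B. fscale (u' v) v)"
        by (simp only: sum.reindex[OF injB] comp_def)
      also have "\<dots> = (\<Sum>v\<in>S. fscale (u' v) v)"
        using S fin by (intro sum.mono_neutral_right) (auto simp: u'_def fs.scale_zero_left)
      also have "\<dots> = (\<Sum>v\<in>S. fscale (u v) v)" by (intro sum.cong refl) (simp add: u'_def)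
      finally have "(\<Sum>b\<in>B. fscale (u' (\<phi> b)) (\<phi> b)) = 0" using S(3) by simp
      moreover obtain b where "b \<in> B" "v = \<phi> b" using S by auto
      ultimately have "u' v = 0" using zero[of "\<lambda>b. u' (\<phi> b)" b] by simp
      then show "u v = 0" using S(4) by (simp add: u'_def)
    qed
  qed
  let ?C = "card ` {B. B \<subseteq> X \<and> indep_mod I B}"
  have fin: "finite (\<phi> ` X)" using assms(1) by simp
  have upper: "k \<le> fs.dim (\<phi> ` X)" if k: "k \<in> ?C" for k
  proof -
    obtain B where B: "B \<subseteq> X" "indep_mod I B" "k = card B"
      using k by blast
    have "k = card (\<phi> ` B)" using inj(1)[OF B(1,2)] B(3) by (simp add: card_image)
    also have "\<dots> \<le> fs.dim (\<phi> ` X)"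
    proof -
      obtain C where C: "\<phi> ` B \<subseteq> C" "C \<subseteq> \<phi> ` X" "fs.independent C" "\<phi> ` X \<subseteq> fs.span C"
        by (rule fs.maximal_independent_subset_extend[OF image_mono[OF B(1)] inj(2)[OF B(1,2)]])
      have "card (\<phi> ` B) \<le> card C" using C fin finite_subset by (intro card_mono) auto
      also have "\<dots> = fs.dim (\<phi> ` X)" using C(2,4,3) by (rule fs.basis_card_eq_dim)
      finally show ?thesis .
    qed
    finally show ?thesis .
  qed
  have attained: "fs.dim (\<phi> ` X) \<in> ?C"
  proof -
    obtain C where C: "C \<subseteq> \<phi> ` X" "fs.independent C" "\<phi> ` X \<subseteq> fs.span C" "card C = fs.dim (\<phi> ` X)"
      by (rule fs.basis_exists)
    obtain B where B: "B \<subseteq> X" "inj_on \<phi> B" "\<phi> ` B = C" using C(1)[unfolded subset_image_inj] by metis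
    have "indep_mod I B" unfolding indep[OF B(1)]
    proof (intro allI impI ballI)
      fix c b assume *: "(\<Sum>b\<in>B. fscale (c b) (\<phi> b)) = 0" "b \<in> B"
      define u where "u v = c (the_inv_into B \<phi> v)" for v
      have u: "u (\<phi> b) = c b" if "b \<in> B" for b using that B(2) by (simp add: u_def the_inv_into_f_f)
      have "(\<Sum>v\<in>C. fscale (u v) v) = (\<Sum>b\<in>B. fscale (u (\<phi> b)) (\<phi> b))"
        unfolding B(3)[symmetric] by (simp only: sum.reindex[OF B(2)] comp_def)
      also have "\<dots> = (\<Sum>b\<in>B. fscale (c b) (\<phi> b))" by (rule sum.cong) (simp_all add: u)
      also have "\<dots> = 0" by (rule *(1))
      finally have "(\<Sum>v\<in>C. fscale (u v) v) = 0" .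
      moreover have "finite C" using C(1) fin by (rule finite_subset)
      moreover have "\<phi> b \<in> C" using B(3) *(2) by auto
      ultimately have "u (\<phi> b) = 0"
        using fs.independentD[OF C(2) _ subset_refl] by metis
      then show "c b = 0" using u *(2) by simp
    qed
    moreover have "card B = fs.dim (\<phi> ` X)" using C(4) B card_image by metis
    ultimately show ?thesis using B(1) by (metis (mono_tags, lifting) image_eqI mem_Collect_eq)
  qed
  show ?thesis unfolding dim_mod_def
    by (rule cSup_eq_maximum) (use attained upper in auto)
qed

section \<open>Leading exponents of the spanning monomials\<close>

context uq_sl
begin

lemma coeff_expo_v: "j < n \<Longrightarrow> b < M \<Longrightarrow> coeff (expo m v) (j * M + b) = v j b"
  using index_less[of j b] by (auto simp: coeff_expo layout_def)

lemma coeff_expo_m: "j < n \<Longrightarrow> b < M \<Longrightarrow> coeff (expo m v) (M * n + (j * M + b)) = m j b"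
  using index_less[of j b] by (auto simp: coeff_expo layout_def)

lemma coeff_expo_wF: "k < n \<Longrightarrow> coeff (expo m v) (2 * (M * n) + (n - 1 - k)) = wF m k"
  by (auto simp: coeff_expo layout_def)

lemma coeff_expo_wE: "k < n \<Longrightarrow> coeff (expo m v) (2 * (M * n) + n + (n - 1 - k)) = wE m k"
  by (auto simp: coeff_expo layout_def)

lemma wE_unit: "a < M \<Longrightarrow> wE (\<lambda>j b. if j = i \<and> b = a then c else 0) k = (if k = i then c * idx_height k a else 0)"
proof -
  assume a: "a < M"
  have "wE (\<lambda>j b. if j = i \<and> b = a then c else 0) k
      = (\<Sum>b<M. if b = a then (if k = i then c * idx_height k a else 0) else 0)"
    unfolding wE_def by (intro sum.cong) auto
  then show ?thesis using a by simp
qed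

lemma wF_unit:
  assumes "a < M" "i < n" "k < n"
  shows "wF (\<lambda>j b. if j = i \<and> b = a then c else 0) k = (if k = n - 1 - i then - (c * idx_height k (M - 1 - a)) else 0)"
proof -
  have "(\<Sum>b<M. idx_height k b * (if n - 1 - k = i \<and> M - 1 - b = a then c else 0))
      = (\<Sum>b<M. if b = M - 1 - a then (if k = n - 1 - i then c * idx_height k (M - 1 - a) else 0) else 0)"
    using assms by (intro sum.cong) auto
  then show ?thesis using assms by (simp add: wF_def)
qed

text \<open>The weights \<open>wE\<close> form the top block of coefficients, stored backwards so
  that the smallest simple root is compared first. The side condition only says that nothing lies
  above this block.\<close>

lemma chain_family_E:
  "chain_family q N xE (\<lambda>k b p. coeff p (M * n + (k * M + b))) (\<lambda>k b p. coeff p (k * M + b))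
     (\<lambda>k p. coeff p (2 * (M * n) + n + (n - 1 - k))) (\<lambda>D. \<forall>i\<ge>2 * (M * n) + 2 * n. coeff D i = 0)"
proof unfold_locales
  fix k p r assume "Suc k < n" "p \<in> terms" "r \<in> terms"
  then show "pairing (xE k p) (xE (Suc k) r) - pairing (xE (Suc k) r) (xE k p) = (if chain_step p r then - 1 else 1)"
    by (cases p; cases r) (auto simp: pairings terms_def vE_def cartan_def chain_step_def)
next
  fix k l p r assume "Suc k < l" "l < n" "p \<in> terms" "r \<in> terms"
  then show "pairing (xE k p) (xE l r) = pairing (xE l r) (xE k p)"
    by (cases p; cases r) (auto simp: pairings terms_def vE_def cartan_def)
next
  fix k l b p assume "k < n" "l < n" "b < M" "p \<in> terms"
  then show "coeff (xE l p) (M * n + (k * M + b)) = of_bool (l = k \<and> fst p = b)"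
    by (cases p) (auto simp: xE_def coeff_expo_m)
next
  fix k p assume "k < n" "p \<in> terms"
  then show "coeff (xE k p) (k * M + fst p) = - snd p"
    by (cases p) (auto simp: xE_def coeff_expo_v terms_def vE_def)
next
  fix k l b p assume "k < l" "l < n" "b < M" "p \<in> terms" "fst p \<le> b"
  then show "coeff (xE l p) (k * M + b) = 0"
    by (cases p) (auto simp: xE_def coeff_expo_v terms_def vE_def cartan_def)
next
  fix k l p assume "k < n" "l < n" "p \<in> terms"
  then show "coeff (xE l p) (2 * (M * n) + n + (n - 1 - k)) = (if l = k then idx_height k (fst p) else 0)"
    unfolding xE_def by (cases p) (simp only: prod.case coeff_expo_wE, auto simp: wE_unit terms_def)
next
  fix l p r assume "p \<in> terms" "r \<in> terms"
  then show "\<forall>i\<ge>2 * (M * n) + 2 * n. coeff (xE l r - xE l p) i = 0"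
    by (cases p; cases r) (auto simp: xE_def coeff_expo)
next
  fix l and D :: "int poly"
  assume side: "\<forall>i\<ge>2 * (M * n) + 2 * n. coeff D i = 0" and l: "l < n"
    and pos: "0 < coeff D (2 * (M * n) + n + (n - 1 - l))"
    and zero: "\<And>l'. l' < l \<Longrightarrow> coeff D (2 * (M * n) + n + (n - 1 - l')) = 0"
  show "D > 0"
  proof (rule poly_positive)
    show "\<exists>i. 0 < coeff D i" using pos by blast
    fix i assume neg: "coeff D i < 0"
    have "i < 2 * (M * n) + n + (n - 1 - l)"
    proof (rule ccontr)
      assume ge: "\<not> i < 2 * (M * n) + n + (n - 1 - l)"
      have "i < 2 * (M * n) + 2 * n" using side neg by (metis less_irrefl not_le)
      moreover have "i \<noteq> 2 * (M * n) + n + (n - 1 - l)" using pos neg by auto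
      \<comment> \<open>Solves the position \<open>i\<close> for the simple root stored there; it
        comes before \<open>l\<close>, where the difference is already known to be zero.\<close>
      ultimately have "i = 2 * (M * n) + n + (n - 1 - (2 * (M * n) + 2 * n - 1 - i))"
        "2 * (M * n) + 2 * n - 1 - i < l" using ge l by linarith+
      then show False using zero neg by (metis less_irrefl)
    qed
    then show "\<exists>j>i. 0 < coeff D j" using pos by blast
  qed
qed (simp_all)

text \<open>For \<open>F\<close> the torus factors sit behind the chosen copy rather than before it.
  Reversing copies and simple roots restores decreasing chains.\<close>

definition xF_mirror :: "nat \<Rightarrow> nat \<times> int \<Rightarrow> int poly" where
  "xF_mirror k = (\<lambda>(a, s). xF (n - 1 - k) (M - 1 - a, s))"

lemma coeff_xF_mirror_high:
  assumes "l < n" "a < M" "i \<ge> 2 * (M * n) + n" "i < 2 * (M * n) + 2 * n"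
  shows "coeff (xF_mirror l (a, s)) i =
    (if i = 2 * (M * n) + n + l then - idx_height (n - 1 - l) (M - 1 - a) else 0)"
proof -
  define k where "k = 2 * (M * n) + 2 * n - 1 - i"
  have k: "k < n" "i = 2 * (M * n) + n + (n - 1 - k)" using assms by (auto simp: k_def)
  have "k = n - 1 - l \<longleftrightarrow> i = 2 * (M * n) + n + l" using k assms(1) by auto
  then show ?thesis
    unfolding k(2) xF_mirror_def xF_def prod.case coeff_expo_wE[OF k(1)]
    using assms by (subst wE_unit) (auto simp: k)
qed

lemma coeff_xF_mirror:
  assumes "k < n" "l < n" "a < M" "b < M"
  shows "coeff (xF_mirror l (a, s)) (M * n + ((n - 1 - k) * M + (M - 1 - b))) = (if l = k \<and> a = b then -1 else 0)"
    and "coeff (xF_mirror l (a, s)) ((n - 1 - k) * M + (M - 1 - b)) = vF (n - 1 - l) (M - 1 - a) s (n - 1 - k) (M - 1 - b)"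
proof -
  have 1: "n - 1 - k < n" "M - 1 - b < M" using assms by auto
  have 2: "n - 1 - k = n - 1 - l \<and> M - 1 - b = M - 1 - a \<longleftrightarrow> l = k \<and> a = b" using assms by auto
  show "coeff (xF_mirror l (a, s)) (M * n + ((n - 1 - k) * M + (M - 1 - b))) = (if l = k \<and> a = b then -1 else 0)"
    unfolding xF_mirror_def xF_def prod.case coeff_expo_m[OF 1] 2 ..
  show "coeff (xF_mirror l (a, s)) ((n - 1 - k) * M + (M - 1 - b)) = vF (n - 1 - l) (M - 1 - a) s (n - 1 - k) (M - 1 - b)"
    unfolding xF_mirror_def xF_def prod.case coeff_expo_v[OF 1] ..
qed

text \<open>Here the deciding block \<open>wF\<close> lies below \<open>wE\<close>, so the side
  condition must ensure that \<open>wE\<close> does not decide against the constant chain. It uses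
  mirrored copies below \<open>n\<close>, that is, true copies from \<open>n\<close> on, where
  \<open>wE\<close> vanishes, whereas every \<open>F\<close> term has nonpositive
  \<open>wE\<close>.\<close>

lemma chain_family_F:
  "chain_family q N xF_mirror
     (\<lambda>k b p. - coeff p (M * n + ((n - 1 - k) * M + (M - 1 - b))))
     (\<lambda>k b p. - coeff p ((n - 1 - k) * M + (M - 1 - b)))
     (\<lambda>k p. coeff p (2 * (M * n) + (n - 1 - k)))
     (\<lambda>D. (\<forall>i\<ge>2 * (M * n) + 2 * n. coeff D i = 0) \<and> (\<forall>i\<ge>2 * (M * n) + n. coeff D i \<ge> 0))"
proof unfold_locales
  fix k p r assume "Suc k < n" "p \<in> terms" "r \<in> terms"
  then show "pairing (xF_mirror k p) (xF_mirror (Suc k) r) - pairing (xF_mirror (Suc k) r) (xF_mirror k p)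
      = (if chain_step p r then - 1 else 1)"
    by (cases p; cases r) (auto simp: xF_mirror_def pairings terms_def vF_def cartan_def chain_step_def)
next
  fix k l p r assume "Suc k < l" "l < n" "p \<in> terms" "r \<in> terms"
  then show "pairing (xF_mirror k p) (xF_mirror l r) = pairing (xF_mirror l r) (xF_mirror k p)"
    by (cases p; cases r) (auto simp: xF_mirror_def pairings terms_def vF_def cartan_def)
next
  fix k l b p assume "k < n" "l < n" "b < M" "p \<in> terms"
  then show "- coeff (xF_mirror l p) (M * n + ((n - 1 - k) * M + (M - 1 - b))) = of_bool (l = k \<and> fst p = b)"
    unfolding terms_def by (cases p) (simp only: mem_Sigma_iff lessThan_iff coeff_xF_mirror fst_conv, simp)
next
  fix k p assume "k < n" "p \<in> terms"
  then show "- coeff (xF_mirror k p) ((n - 1 - k) * M + (M - 1 - fst p)) = - snd p"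
    unfolding terms_def
    by (cases p) (simp only: mem_Sigma_iff lessThan_iff coeff_xF_mirror fst_conv snd_conv, simp add: vF_def)
next
  fix k l b p assume "k < l" "l < n" "b < M" "p \<in> terms" "fst p \<le> b"
  then show "- coeff (xF_mirror l p) ((n - 1 - k) * M + (M - 1 - b)) = 0"
    unfolding terms_def
    by (cases p) (simp only: mem_Sigma_iff lessThan_iff coeff_xF_mirror fst_conv, auto simp: vF_def cartan_def)
next
  fix k l p assume "k < n" "l < n" "p \<in> terms"
  then show "coeff (xF_mirror l p) (2 * (M * n) + (n - 1 - k)) = (if l = k then idx_height k (fst p) else 0)"
    unfolding xF_mirror_def xF_def
    by (cases p) (simp only: prod.case coeff_expo_wF, auto simp: wF_unit terms_def)
next
  fix l p r assume l: "l < n" and pr: "p \<in> terms" "r \<in> terms" and r: "fst r < n"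
  obtain a s b t where e: "p = (a, s)" "r = (b, t)" by (cases p, cases r)
  have ab: "a < M" "b < n" "b < M" using pr r by (auto simp: e terms_def)
  show "(\<forall>i\<ge>2 * (M * n) + 2 * n. coeff (xF_mirror l r - xF_mirror l p) i = 0) \<and>
      (\<forall>i\<ge>2 * (M * n) + n. coeff (xF_mirror l r - xF_mirror l p) i \<ge> 0)"
  proof (intro conjI allI impI)
    fix i assume "i \<ge> 2 * (M * n) + 2 * n"
    then show "coeff (xF_mirror l r - xF_mirror l p) i = 0" by (simp add: e xF_mirror_def xF_def coeff_expo)
  next
    fix i assume i: "i \<ge> 2 * (M * n) + n"
    show "coeff (xF_mirror l r - xF_mirror l p) i \<ge> 0"
    proof (cases "i < 2 * (M * n) + 2 * n")
      case True
      have "idx_height (n - 1 - l) (M - 1 - b) = 0" using ab l by (auto simp: idx_height_def M_def)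
      moreover have "idx_height (n - 1 - l) (M - 1 - a) \<ge> 0" by (simp add: idx_height_def)
      ultimately show ?thesis
        unfolding e coeff_diff coeff_xF_mirror_high[OF l ab(1) i True] coeff_xF_mirror_high[OF l ab(3) i True]
        by simp
    qed (simp add: e xF_mirror_def xF_def coeff_expo)
  qed
next
  fix l and D :: "int poly"
  assume side: "(\<forall>i\<ge>2 * (M * n) + 2 * n. coeff D i = 0) \<and> (\<forall>i\<ge>2 * (M * n) + n. coeff D i \<ge> 0)"
    and l: "l < n" and pos: "0 < coeff D (2 * (M * n) + (n - 1 - l))"
    and zero: "\<And>l'. l' < l \<Longrightarrow> coeff D (2 * (M * n) + (n - 1 - l')) = 0"
  show "D > 0"
  proof (rule poly_positive)
    show "\<exists>i. 0 < coeff D i" using pos by blast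
    fix i assume neg: "coeff D i < 0"
    have "i < 2 * (M * n) + (n - 1 - l)"
    proof (rule ccontr)
      assume ge: "\<not> i < 2 * (M * n) + (n - 1 - l)"
      have "i < 2 * (M * n) + n" using side neg by (metis not_less)
      moreover have "i \<noteq> 2 * (M * n) + (n - 1 - l)" using pos neg by auto
      ultimately have "i = 2 * (M * n) + (n - 1 - (2 * (M * n) + n - 1 - i))"
        "2 * (M * n) + n - 1 - i < l" using ge l by linarith+
      then show False using zero neg by (metis less_irrefl)
    qed
    then show "\<exists>j>i. 0 < coeff D j" using pos by blast
  qed
qed (auto)

lemma tsum_xF_mirror: "i < n \<Longrightarrow> tsum (xF (n - 1 - i)) = tsum (xF_mirror i)"
proof (rule sum.reindex_bij_witness[of terms "\<lambda>(a, s). (M - 1 - a, s)" "\<lambda>(a, s). (M - 1 - a, s)" terms])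
  fix p assume "p \<in> terms"
  then obtain a s where p: "p = (a, s)" "a < M" "s \<in> {1, -1}" by (cases p) (auto simp: terms_def)
  have 1: "M - 1 - (M - 1 - a) = a" using p(2) by linarith
  show "(case case p of (a, s) \<Rightarrow> (M - 1 - a, s) of (a, s) \<Rightarrow> (M - 1 - a, s)) = p"
    by (simp only: p(1) prod.case 1)
  then show "(case case p of (a, s) \<Rightarrow> (M - 1 - a, s) of (a, s) \<Rightarrow> (M - 1 - a, s)) = p" .
  show "(case p of (a, s) \<Rightarrow> (M - 1 - a, s)) \<in> terms"
    using p by (auto simp: terms_def)
  then show "(case p of (a, s) \<Rightarrow> (M - 1 - a, s)) \<in> terms" .
  show "fscale (term_coeff (case p of (a, s) \<Rightarrow> (M - 1 - a, s)))
      (delta (xF_mirror i (case p of (a, s) \<Rightarrow> (M - 1 - a, s)))) = fscale (term_coeff p) (delta (xF (n - 1 - i) p))"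
    by (simp only: p(1) prod.case xF_mirror_def 1 term_coeff_def snd_conv)
qed

lemma rootvec_E_leads:
  assumes "k + d < n"
  shows "\<exists>\<gamma>. leads (rep (rootvec q (\<lambda>i. word [E i]) k d)) \<gamma> \<and>
    (\<forall>l<n. \<forall>b<M. coeff \<gamma> (M * n + (l * M + b)) = of_bool (k \<le> l \<and> l \<le> k + d \<and> b = k))"
proof -
  interpret chain_family q N xE "\<lambda>k b p. coeff p (M * n + (k * M + b))" "\<lambda>k b p. coeff p (k * M + b)"
     "\<lambda>k p. coeff p (2 * (M * n) + n + (n - 1 - k))" "\<lambda>D. \<forall>i\<ge>2 * (M * n) + 2 * n. coeff D i = 0"
    by (rule chain_family_E)
  show ?thesis
    by (rule rootvec_leads[OF _ _ assms]) (simp_all add: torus_image.simps tmult_one_right)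
qed

lemma rootvec_F_leads:
  assumes "k + d < n"
  shows "\<exists>\<gamma>. leads (rep (rootvec q (\<lambda>i. word [F (n - 1 - i)]) k d)) \<gamma> \<and>
    (\<forall>l<n. \<forall>b<M. - coeff \<gamma> (M * n + ((n - 1 - l) * M + (M - 1 - b))) = of_bool (k \<le> l \<and> l \<le> k + d \<and> b = k))"
proof -
  interpret chain_family q N xF_mirror
     "\<lambda>k b p. - coeff p (M * n + ((n - 1 - k) * M + (M - 1 - b)))"
     "\<lambda>k b p. - coeff p ((n - 1 - k) * M + (M - 1 - b))"
     "\<lambda>k p. coeff p (2 * (M * n) + (n - 1 - k))"
     "\<lambda>D. (\<forall>i\<ge>2 * (M * n) + 2 * n. coeff D i = 0) \<and> (\<forall>i\<ge>2 * (M * n) + n. coeff D i \<ge> 0)"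
    by (rule chain_family_F)
  have "rep (word [F (n - 1 - i)]) = tsum (xF_mirror i)" if "i < n" for i
    using that tsum_xF_mirror[OF that] by (simp add: torus_image.simps tmult_one_right)
  then show ?thesis
    by (intro rootvec_leads[OF _ _ assms]) simp_all
qed

end

section \<open>A discrete isoperimetric inequality\<close>

definition shift :: "'i \<Rightarrow> ('i \<Rightarrow> int) \<Rightarrow> 'i \<Rightarrow> int" where
  "shift i x = x(i := x i + 1)"

text \<open>Every line in direction \<open>j\<close> that meets \<open>S\<close> has a topmost point
  in \<open>S\<close>, and shifting that point leaves \<open>S\<close>.\<close>

lemma card_shift_direction:
  assumes fin: "finite S"
  shows "card (S \<union> shift j ` S) \<ge> card S + card ((\<lambda>x. x(j := 0)) ` S)"
proof -
  define top where "top p = Max ((\<lambda>x. x j) ` {x \<in> S. x(j := 0) = p})" for p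
  let ?P = "(\<lambda>x. x(j := 0)) ` S" and ?new = "\<lambda>p. p(j := top p + 1)"
  have top: "top p \<in> (\<lambda>x. x j) ` {x \<in> S. x(j := 0) = p}" if "p \<in> ?P" for p
    unfolding top_def using that fin by (intro Max_in) auto
  have le: "x j \<le> top (x(j := 0))" if "x \<in> S" for x
    unfolding top_def using that fin by (intro Max_ge) auto
  have p0: "p j = 0" if "p \<in> ?P" for p using that by auto
  have "inj_on ?new ?P"
  proof (rule inj_onI)
    fix p p' assume "p \<in> ?P" "p' \<in> ?P" "?new p = ?new p'"
    then show "p = p'" using p0 by (metis fun_upd_triv fun_upd_upd)
  qed
  then have card: "card (?new ` ?P) = card ?P" by (rule card_image)
  have sub: "?new ` ?P \<subseteq> shift j ` S"
  proof
    fix y assume "y \<in> ?new ` ?P"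
    then obtain p where p: "p \<in> ?P" "y = ?new p" by auto
    then obtain x where x: "x \<in> S" "x(j := 0) = p" "x j = top p" using top by fastforce
    then have "x = p(j := top p)" by (metis fun_upd_triv fun_upd_upd)
    then have "y = shift j x" using p(2) by (simp add: shift_def)
    then show "y \<in> shift j ` S" using x by auto
  qed
  have disj: "S \<inter> ?new ` ?P = {}"
  proof -
    have False if "p \<in> ?P" "?new p \<in> S" for p
    proof -
      have "(?new p)(j := 0) = p" using p0[OF that(1)] by (simp add: fun_upd_idem)
      then show False using le[OF that(2)] by simp
    qed
    then show ?thesis by blast
  qed
  have "card S + card ?P = card (S \<union> ?new ` ?P)"
    using fin disj card by (simp add: card_Un_disjoint)
  also have "\<dots> \<le> card (S \<union> shift j ` S)"
    using fin sub by (intro card_mono) auto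
  finally show ?thesis .
qed

text \<open>Induction on the number of directions. A large projection along \<open>j\<close> gives
  enough new points by \<open>card_shift_direction\<close>. A small one bounds every slice, and
  small slices expand well in the remaining directions; their expansions stay disjoint.\<close>

theorem discrete_isoperimetry:
  assumes "finite D" "D \<noteq> {}" "finite S" "S \<noteq> {}"
    and "\<And>x y i. x \<in> S \<Longrightarrow> y \<in> S \<Longrightarrow> i \<notin> D \<Longrightarrow> x i = y i"
  shows "real (card (S \<union> (\<Union>i\<in>D. shift i ` S)))
    \<ge> real (card S) + real (card S) powr ((real (card D) - 1) / real (card D))"
  using assms
proof (induction D arbitrary: S rule: finite_ne_induct)
  case (singleton j)
  have "card S + card ((\<lambda>x. x(j := 0)) ` S) \<le> card (S \<union> shift j ` S)"
    by (rule card_shift_direction) fact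
  moreover have "card ((\<lambda>x. x(j := 0)) ` S) > 0"
    using singleton by (simp add: card_gt_0_iff)
  moreover have "card S > 0" using singleton by (simp add: card_gt_0_iff)
  ultimately show ?case by simp
next
  case (insert j D)
  define d where "d = card D"
  have d: "d > 0" "card (insert j D) = Suc d" using insert by (auto simp: d_def card_gt_0_iff)
  define s where "s = real (card S)"
  have s: "s \<ge> 1" using insert.prems by (simp add: s_def Suc_le_eq card_gt_0_iff)
  let ?P = "(\<lambda>x. x(j := 0)) ` S" and ?U = "S \<union> (\<Union>i\<in>insert j D. shift i ` S)"
  have finU: "finite ?U" using insert by auto
  have exponent: "(real (card (insert j D)) - 1) / real (card (insert j D)) = real d / (real d + 1)"
    using d by simp
  show ?case
  \<comment> \<open>The threshold is the required gain itself. It is also the balance point: if the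
    projection has fewer points, the slices yield the same gain.\<close>
  proof (cases "real (card ?P) \<ge> s powr (real d / (real d + 1))")
    case True
    have "card S + card ?P \<le> card (S \<union> shift j ` S)"
      using insert.prems by (intro card_shift_direction)
    also have "\<dots> \<le> card ?U" using finU by (intro card_mono) auto
    finally show ?thesis using True unfolding exponent s_def by linarith
  next
    case False
    define p where "p = real (card ?P)"
    have p: "p > 0" "p < s powr (real d / (real d + 1))"
      using insert.prems False by (auto simp: p_def card_gt_0_iff)
    define slice where "slice t = {x \<in> S. x j = t}" for t
    define B where "B t = slice t \<union> (\<Union>i\<in>D. shift i ` slice t)" for t
    let ?T = "(\<lambda>x. x j) ` S"
    have finT: "finite ?T" and fin_slice: "finite (slice t)" for t
      using insert.prems by (auto simp: slice_def)
    have finB: "finite (B t)" for t using fin_slice insert.hyps by (auto simp: B_def)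
    have B_j: "x j = t" if "x \<in> B t" for x t
    proof -
      have "j \<notin> D" using insert.hyps by simp
      then show ?thesis using that by (auto simp: B_def slice_def shift_def)
    qed
    have BU: "B t \<subseteq> ?U" for t by (auto simp: B_def slice_def)
    \<comment> \<open>A slice injects into the projection and so has at most \<open>p\<close>
      points. Its own gain, size to the power \<open>1 - 1 / d\<close>, is therefore at least its
      size times \<open>p\<close> to the power \<open>- 1 / d\<close>, a bound that can be summed
      over slices.\<close>
    have card_B: "real (card (B t)) \<ge> real (card (slice t)) + real (card (slice t)) * p powr (- 1 / real d)"
      if t: "t \<in> ?T" for t
    proof -
      have ne: "slice t \<noteq> {}" using t by (auto simp: slice_def)
      then have pos: "real (card (slice t)) > 0" using fin_slice by (simp add: card_gt_0_iff)
      have "inj_on (\<lambda>x. x(j := 0)) (slice t)"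
        by (rule inj_onI) (metis (mono_tags, lifting) slice_def fun_upd_triv fun_upd_upd mem_Collect_eq)
      then have "card (slice t) = card ((\<lambda>x. x(j := 0)) ` slice t)" by (simp add: card_image)
      also have "\<dots> \<le> card ?P" using insert.prems by (intro card_mono) (auto simp: slice_def)
      finally have le: "real (card (slice t)) \<le> p" by (simp add: p_def)
      have "real (card (slice t)) + real (card (slice t)) powr ((real (card D) - 1) / real (card D))
          \<le> real (card (B t))"
        unfolding B_def
      proof (rule insert.IH[OF fin_slice ne])
        fix x y i assume "x \<in> slice t" "y \<in> slice t" "i \<notin> D"
        then show "x i = y i" using insert.prems(3)[of x y i] by (cases "i = j") (auto simp: slice_def)
      qed
      moreover have "(real (card D) - 1) / real (card D) = 1 + - 1 / real d"
        using d by (simp add: d_def diff_divide_distrib)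
      moreover have "real (card (slice t)) powr (1 + - 1 / real d)
          = real (card (slice t)) * real (card (slice t)) powr (- 1 / real d)"
        unfolding powr_add using pos by simp
      moreover have "p powr (- 1 / real d) \<le> real (card (slice t)) powr (- 1 / real d)"
        using le pos by (intro powr_mono2') auto
      ultimately show ?thesis using pos by (simp add: mult_left_mono order_trans[rotated])
    qed
    have card_S: "(\<Sum>t\<in>?T. real (card (slice t))) = s"
    proof -
      have "S = (\<Union>t\<in>?T. slice t)" by (auto simp: slice_def)
      also have "card \<dots> = (\<Sum>t\<in>?T. card (slice t))"
        using finT fin_slice by (intro card_UN_disjoint) (auto simp: slice_def)
      finally show ?thesis by (simp add: s_def)
    qed
    have "s + s * p powr (- 1 / real d) = (\<Sum>t\<in>?T. real (card (slice t)) + real (card (slice t)) * p powr (- 1 / real d))"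
      by (simp add: sum.distrib card_S sum_distrib_right[symmetric])
    also have "\<dots> \<le> (\<Sum>t\<in>?T. real (card (B t)))" by (intro sum_mono card_B)
    also have "\<dots> = real (card (\<Union>t\<in>?T. B t))"
    proof -
      have "B t \<inter> B u = {}" if "t \<noteq> u" for t u using B_j that by blast
      then show ?thesis using finT finB by (subst card_UN_disjoint) auto
    qed
    also have "\<dots> \<le> real (card ?U)" using finU BU by (auto intro!: card_mono)
    finally have main: "s + s * p powr (- 1 / real d) \<le> real (card ?U)" .
    have "s powr (real d / (real d + 1)) = s * (s powr (real d / (real d + 1))) powr (- 1 / real d)"
    proof -
      define u v where "u = real d / (real d + 1)" and "v = - 1 / real d"
      have "u = 1 + u * v" using d by (simp add: u_def v_def field_simps)
      then have "s powr u = s powr 1 * s powr (u * v)" by (metis powr_add)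
      then have "s powr u = s * s powr (u * v)" using s by simp
      then have "s powr u = s * (s powr u) powr v" unfolding powr_powr .
      then show ?thesis by (simp only: u_def v_def)
    qed
    also have "\<dots> \<le> s * p powr (- 1 / real d)"
      using p s by (intro mult_left_mono powr_mono2') auto
    finally show ?thesis using main unfolding exponent s_def by linarith
  qed
qed

section \<open>Growth estimates\<close>

lemma powr_Suc_diff_le:
  assumes "d \<ge> 1" "m > 0"
  shows "(real m + 1) powr d - real m powr d \<le> d * 2 powr (d - 1) * real m powr (d - 1)"
proof -
  have "\<exists>z. real m < z \<and> z < real m + 1 \<and>
      (real m + 1) powr d - real m powr d = (real m + 1 - real m) * (d * z powr (d - 1))"
    using assms by (intro MVT2) (auto intro!: has_real_derivative_powr)
  then obtain z where z: "real m < z" "z < real m + 1"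
    "(real m + 1) powr d - real m powr d = d * z powr (d - 1)" by auto
  have "z powr (d - 1) \<le> (2 * real m) powr (d - 1)"
    using z assms by (intro powr_mono2) auto
  also have "\<dots> = 2 powr (d - 1) * real m powr (d - 1)"
    by (rule powr_mult)
  finally show ?thesis using z(3) assms by (simp add: mult.assoc mult_left_mono)
qed

text \<open>A discrete form of the differential inequality for
  \<open>D' = c * D powr ((d - 1) / d)\<close>, whose solutions grow like the power \<open>d\<close>
  of \<open>m\<close>.\<close>

lemma growth_lower_bound:
  fixes D :: "nat \<Rightarrow> real"
  assumes "c > 0" "d \<ge> 1" and D1: "\<And>m. D m \<ge> 1"
    and step: "\<And>m. D (Suc m) \<ge> D m + c * D m powr ((d - 1) / d)"
  shows "\<exists>\<epsilon>>0. \<forall>m. D m \<ge> (\<epsilon> * real m) powr d"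
proof -
  define K where "K = d * 2 powr (d - 1)"
  have K: "K > 0" using assms by (simp add: K_def)
  \<comment> \<open>The bound 1 settles \<open>m = 1\<close>. The bound \<open>c / K\<close> makes
    the increment of the comparison function, at most
    \<open>\<epsilon> * K * (\<epsilon> * m) powr (d - 1)\<close>, no larger than the increment of
    \<open>D\<close>.\<close>
  define \<epsilon> where "\<epsilon> = min 1 (c / K)"
  have \<epsilon>: "\<epsilon> > 0" "\<epsilon> \<le> 1" "\<epsilon> * K \<le> c"
    using assms K by (auto simp: \<epsilon>_def min_def field_simps)
  have "D m \<ge> (\<epsilon> * real m) powr d" for m
  proof (induction m)
    case 0 show ?case using order_trans[OF zero_le_one D1[of 0]] assms(2) by simp
  next
    case (Suc m)
    show ?case
    proof (cases "m = 0")
      case True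
      have "\<epsilon> powr d \<le> 1 powr d" using \<epsilon> assms by (intro powr_mono2) auto
      then show ?thesis using D1[of "Suc 0"] True by simp
    next
      case False
      let ?t = "\<epsilon> * real m"
      have t: "?t > 0" using False \<epsilon> by simp
      have "?t powr (d - 1) = (?t powr d) powr ((d - 1) / d)"
        using assms by (simp add: powr_powr)
      also have "\<dots> \<le> D m powr ((d - 1) / d)"
        using Suc assms by (intro powr_mono2) auto
      finally have "?t powr d + c * ?t powr (d - 1) \<le> D (Suc m)"
        using step[of m] Suc assms(1) by (smt (verit) mult_left_mono)
      moreover have "(\<epsilon> * real (Suc m)) powr d \<le> ?t powr d + c * ?t powr (d - 1)"
      proof -
        have e: "\<epsilon> powr d = \<epsilon> * \<epsilon> powr (d - 1)"
          using \<epsilon> by (simp add: powr_mult_base)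
        have "(\<epsilon> * real (Suc m)) powr d = \<epsilon> powr d * (real m + 1) powr d"
          by (simp add: powr_mult add.commute)
        also have "\<dots> \<le> \<epsilon> powr d * (real m powr d + K * real m powr (d - 1))"
          using powr_Suc_diff_le[of d m] assms False by (intro mult_left_mono) (auto simp: K_def)
        also have "\<dots> = ?t powr d + (\<epsilon> * K) * (\<epsilon> powr (d - 1) * real m powr (d - 1))"
          by (simp add: powr_mult e algebra_simps)
        also have "\<dots> \<le> ?t powr d + c * (\<epsilon> powr (d - 1) * real m powr (d - 1))"
          using \<epsilon>(3) by (intro add_left_mono mult_right_mono) auto
        finally show ?thesis by (simp add: powr_mult)
      qed
      ultimately show ?thesis by linarith
    qed
  qed
  then show ?thesis using \<epsilon>(1) by blast
qed

lemma growth_exponent_le: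
  fixes D :: "nat \<Rightarrow> real"
  assumes "\<epsilon> > 0" "C > 0" "e > 0"
    and lower: "\<And>m. D m \<ge> (\<epsilon> * real m) powr d"
    and upper: "\<And>m. m > 0 \<Longrightarrow> D m \<le> (C * real m) powr e"
  shows "d \<le> e"
proof (rule ccontr)
  assume "\<not> d \<le> e"
  then have de: "d - e > 0" by simp
  define L where "L = C powr e / \<epsilon> powr d"
  have L: "L > 0" using assms by (simp add: L_def)
  obtain m where m: "real m > max 1 (L powr (1 / (d - e)))" using reals_Archimedean2 by blast
  then have m0: "m > 0" by (cases m) auto
  have "L = (L powr (1 / (d - e))) powr (d - e)" using L de by (simp add: powr_powr)
  also have "\<dots> < real m powr (d - e)" using m de by (intro powr_less_mono2) auto
  finally have "L * real m powr e < real m powr (d - e) * real m powr e" using m0 by simp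
  then have "L * real m powr e < real m powr d" by (simp flip: powr_add)
  then have "C powr e * real m powr e < \<epsilon> powr d * real m powr d"
    using assms(1) by (simp add: L_def field_simps)
  then have "(C * real m) powr e < (\<epsilon> * real m) powr d" by (simp add: powr_mult)
  then show False using lower[of m] upper[OF m0] by simp
qed

lemma log_ratio_tendsto:
  "((\<lambda>m. e * (ln C + ln (real m)) / ln (real m)) \<longlongrightarrow> e) sequentially"
proof -
  have lim: "filterlim (\<lambda>m. ln (real m)) at_top sequentially"
    by (rule filterlim_compose[OF ln_at_top filterlim_real_sequentially])
  have "((\<lambda>m. e * (ln C / ln (real m) + 1)) \<longlongrightarrow> e * (0 + 1)) sequentially"
    by (intro tendsto_intros real_tendsto_divide_at_top[OF tendsto_const lim])
  moreover have "eventually (\<lambda>m. e * (ln C / ln (real m) + 1) = e * (ln C + ln (real m)) / ln (real m)) sequentially"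
    using eventually_gt_at_top[of 1] by eventually_elim (simp add: field_simps)
  ultimately show ?thesis by (rule Lim_transform_eventually[THEN back_subst[of "\<lambda>x. (_ \<longlongrightarrow> x) sequentially"]]) simp
qed

lemma limsup_growth_le:
  assumes "C > 0" "e > 0" and upper: "\<And>m. m > 0 \<Longrightarrow> D m \<le> (C * real m) powr e" and "\<And>m. D m \<ge> 1"
  shows "limsup (\<lambda>m. ereal (ln (D m) / ln (real m))) \<le> ereal e"
proof -
  have "eventually (\<lambda>m. ereal (ln (D m) / ln (real m)) \<le> ereal (e * (ln C + ln (real m)) / ln (real m))) sequentially"
    using eventually_gt_at_top[of 1]
  proof eventually_elim
    case (elim m)
    have "ln (D m) \<le> ln ((C * real m) powr e)"
      using upper[of m] assms(4)[of m] elim by (intro ln_mono) auto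
    also have "\<dots> = e * (ln C + ln (real m))" using assms elim by (simp add: ln_powr ln_mult)
    finally show ?case using elim by (simp add: divide_right_mono)
  qed
  then have "limsup (\<lambda>m. ereal (ln (D m) / ln (real m)))
      \<le> limsup (\<lambda>m. ereal (e * (ln C + ln (real m)) / ln (real m)))"
    by (rule Limsup_mono)
  also have "\<dots> = ereal e"
    by (intro lim_imp_Limsup) (auto intro: log_ratio_tendsto)
  finally show ?thesis .
qed

lemma limsup_growth_ge:
  assumes "\<epsilon> > 0" "e > 0" and lower: "\<And>m. D m \<ge> (\<epsilon> * real m) powr e"
  shows "limsup (\<lambda>m. ereal (ln (D m) / ln (real m))) \<ge> ereal e"
proof -
  have "eventually (\<lambda>m. ereal (e * (ln \<epsilon> + ln (real m)) / ln (real m)) \<le> ereal (ln (D m) / ln (real m))) sequentially"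
    using eventually_gt_at_top[of 1]
  proof eventually_elim
    case (elim m)
    have "e * (ln \<epsilon> + ln (real m)) = ln ((\<epsilon> * real m) powr e)"
      using assms elim by (simp add: ln_powr ln_mult)
    also have "\<dots> \<le> ln (D m)"
      using lower[of m] assms elim by (intro ln_mono) auto
    finally show ?case using elim by (simp add: divide_right_mono)
  qed
  then have "limsup (\<lambda>m. ereal (e * (ln \<epsilon> + ln (real m)) / ln (real m)))
      \<le> limsup (\<lambda>m. ereal (ln (D m) / ln (real m)))"
    by (rule Limsup_mono)
  moreover have "limsup (\<lambda>m. ereal (e * (ln \<epsilon> + ln (real m)) / ln (real m))) = ereal e"
    by (intro lim_imp_Limsup) (auto intro: log_ratio_tendsto)
  ultimately show ?thesis by simp
qed

section \<open>Faithfulness of the representation\<close>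

lemma sum_list_spread:
  fixes g :: "'r \<Rightarrow> int poly"
  shows "distinct rs \<Longrightarrow> sum_list (map g (spread c rs)) = (\<Sum>r\<in>set rs. smult (int (c r)) (g r))"
proof (induction rs)
  case (Cons r rs)
  have "sum_list (map g (replicate k r)) = smult (int k) (g r)" for k
    by (induction k) (simp_all add: smult_add_left)
  with Cons show ?case by simp
qed simp

context uq_sl
begin

definition pbw_gen :: "pbw_index \<Rightarrow> gen fa" where
  "pbw_gen i = (case i of
     FR r \<Rightarrow> case_prod (rootvec q (\<lambda>i. word [F (n - 1 - i)])) r
   | KR i \<Rightarrow> word [K i]
   | ER r \<Rightarrow> case_prod (rootvec q (\<lambda>i. word [E i])) r)"

lemma pbw_gen_FA [simp]: "pbw_gen i \<in> FA"
  by (auto simp: pbw_gen_def rootvec_FA split: pbw_index.split)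

definition gen_lead :: "pbw_index \<Rightarrow> int poly" where
  "gen_lead i = (THE p. leads (rep (pbw_gen i)) p)"

lemma gen_lead_eq: "leads (rep (pbw_gen i)) p \<Longrightarrow> gen_lead i = p"
  unfolding gen_lead_def using leads_unique by blast

lemma rep_K: "i < n \<Longrightarrow> rep (word [K i]) = delta (xK 1 i)"
  by (simp add: torus_image.simps tmult_one_right)

lemma gen_lead_K: "i < n \<Longrightarrow> gen_lead (KR i) = xK 1 i"
  by (rule gen_lead_eq) (simp add: pbw_gen_def rep_K leads_delta del: rep_of_word)

lemma gen_lead:
  assumes "i \<in> pbw_indices n" shows "leads (rep (pbw_gen i)) (gen_lead i)"
proof -
  have "\<exists>p. leads (rep (pbw_gen i)) p"
  proof (cases i)
    case (FR r) then show ?thesis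
      using assms rootvec_F_leads[of "fst r" "snd r"] by (cases r) (auto simp: pbw_indices_def pbw_gen_def)
  next
    case (ER r) then show ?thesis
      using assms rootvec_E_leads[of "fst r" "snd r"] by (cases r) (auto simp: pbw_indices_def pbw_gen_def)
  next
    case (KR j) then show ?thesis
      using assms leads_delta[of "xK 1 j"]
      by (auto simp: pbw_indices_def pbw_gen_def rep_K simp del: rep_of_word)
  qed
  then show ?thesis using gen_lead_eq by blast
qed

lemma coeff_gen_lead_E:
  assumes "k + d < n" "l < n" "b < M"
  shows "coeff (gen_lead (ER (k, d))) (M * n + (l * M + b)) = of_bool (k \<le> l \<and> l \<le> k + d \<and> b = k)"
  using rootvec_E_leads[OF assms(1)] gen_lead_eq[of "ER (k, d)"] assms by (auto simp: pbw_gen_def)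

lemma coeff_gen_lead_F:
  assumes "k + d < n" "l < n" "b < M"
  shows "coeff (gen_lead (FR (k, d))) (M * n + ((n - 1 - l) * M + (M - 1 - b)))
    = - of_bool (k \<le> l \<and> l \<le> k + d \<and> b = k)"
proof -
  obtain \<gamma> where g: "leads (rep (pbw_gen (FR (k, d)))) \<gamma>"
    "- coeff \<gamma> (M * n + ((n - 1 - l) * M + (M - 1 - b))) = of_bool (k \<le> l \<and> l \<le> k + d \<and> b = k)"
    using rootvec_F_leads[OF assms(1)] assms(2,3) unfolding pbw_gen_def by (simp only: pbw_index.case prod.case) blast
  then show ?thesis unfolding gen_lead_eq[OF g(1)] by linarith
qed

lemma coeff_xK_m: "j < n \<Longrightarrow> b < M \<Longrightarrow> coeff (xK c i) (M * n + (j * M + b)) = 0"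
  by (simp only: xK_def coeff_expo_m)

lemma coeff_xK_v: "j < n \<Longrightarrow> b < M \<Longrightarrow> coeff (xK c i) (j * M + b) = c * cartan i j"
  by (simp only: xK_def coeff_expo_v)

definition pbw_lead :: "(pbw_index \<Rightarrow> int) \<Rightarrow> int poly" where
  "pbw_lead x = (\<Sum>i\<in>pbw_indices n. smult (x i) (gen_lead i))"

lemma finite_roots: "finite {(k, d). k + d < (n::nat)}"
  using set_roots[of n] by (metis finite_set)

lemma finite_pbw_indices: "finite (pbw_indices n)"
  unfolding pbw_indices_def using finite_roots by auto

lemma sum_pbw_indices:
  "(\<Sum>i\<in>pbw_indices n. f i) = (\<Sum>r | case r of (k, d) \<Rightarrow> k + d < n. f (FR r)) + (\<Sum>i<n. f (KR i))
    + (\<Sum>r | case r of (k, d) \<Rightarrow> k + d < n. f (ER r))" for f :: "pbw_index \<Rightarrow> 'a::comm_monoid_add"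
proof -
  have inj: "inj_on FR A" "inj_on KR B" "inj_on ER A" for A B by (auto intro: inj_onI)
  have "(\<Sum>i\<in>pbw_indices n. f i) = (\<Sum>i\<in>FR ` {(k, d). k + d < n} \<union> KR ` {..<n}. f i)
      + (\<Sum>i\<in>ER ` {(k, d). k + d < n}. f i)"
    unfolding pbw_indices_def using finite_roots by (intro sum.union_disjoint) auto
  also have "(\<Sum>i\<in>FR ` {(k, d). k + d < n} \<union> KR ` {..<n}. f i)
      = (\<Sum>i\<in>FR ` {(k, d). k + d < n}. f i) + (\<Sum>i\<in>KR ` {..<n}. f i)"
    using finite_roots by (intro sum.union_disjoint) auto
  finally show ?thesis by (simp add: sum.reindex[OF inj(1)] sum.reindex[OF inj(2)] sum.reindex[OF inj(3)])
qed

lemma leads_fa_prod: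
  assumes "\<And>i. i \<in> set is \<Longrightarrow> g i \<in> FA \<and> leads (rep (g i)) (l i)"
  shows "leads (rep (fa_prod g is)) (sum_list (map l is))"
  using assms
proof (induction "is")
  case Nil show ?case by (simp add: leads_delta)
next
  case (Cons i "is")
  then have "leads (rep (g i) \<odot> rep (fa_prod g is)) (l i + sum_list (map l is))"
    by (intro leads_tmult) auto
  moreover have "fa_prod g is \<in> FA" using Cons.prems by (intro FA_prod) auto
  ultimately show ?case using Cons.prems by (simp add: rep_mult)
qed

lemma leads_root_prod:
  assumes "\<And>r. r \<in> set (roots n) \<Longrightarrow> C r \<in> pbw_indices n"
  shows "leads (rep (fa_prod (\<lambda>r. pbw_gen (C r)) (spread c (roots n))))
    (\<Sum>r | case r of (k, d) \<Rightarrow> k + d < n. smult (int (c r)) (gen_lead (C r)))"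
proof -
  have "leads (rep (fa_prod (\<lambda>r. pbw_gen (C r)) (spread c (roots n))))
      (sum_list (map (\<lambda>r. gen_lead (C r)) (spread c (roots n))))"
    using assms gen_lead set_spread[of c "roots n"] by (intro leads_fa_prod) auto
  then show ?thesis using sum_list_spread[OF distinct_roots, of "\<lambda>r. gen_lead (C r)" c n]
    by (simp add: set_roots case_prod_unfold)
qed

lemma xK_neg: "xK (-1) i = - xK 1 i"
  using xK_inverse[of 1 i] by (metis minus_unique)

lemma leads_torus_word: "leads (rep (word (torus_word n z))) (\<Sum>i<n. smult (z i) (gen_lead (KR i)))"
proof -
  define l where "l g = (case g of K i \<Rightarrow> xK 1 i | Kinv i \<Rightarrow> xK (-1) i | _ \<Rightarrow> 0)" for g
  have rep1: "rep (word [g]) = torus_image g" for g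
    by (simp add: tmult_one_right G_finsupp)
  have "leads (rep (fa_prod (\<lambda>g. word [id g]) (torus_word n z))) (sum_list (map l (torus_word n z)))"
  proof (rule leads_fa_prod)
    fix g assume "g \<in> set (torus_word n z)"
    from set_torus_word[OF this] show "word [id g] \<in> FA \<and> leads (rep (word [id g])) (l g)"
      unfolding id_apply rep1 by (cases g) (simp_all add: torus_image.simps l_def leads_delta)
  qed
  moreover have "fa_prod (\<lambda>g. word [id g]) (torus_word n z) = word (torus_word n z)"
    using fa_prod_word[of id "torus_word n z"] by simp
  moreover have "sum_list (map l (torus_word m z)) = (\<Sum>i<m. smult (z i) (xK 1 i))" for m
  proof (induction m)
    case (Suc m)
    have r: "sum_list (replicate k p) = smult (int k) p" for k and p :: "int poly"
      by (induction k) (simp_all add: smult_add_left)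
    have "sum_list (map l (torus_block z m)) = smult (z m) (xK 1 m)"
      by (cases "z m \<ge> 0") (simp_all add: torus_block_def l_def r xK_neg)
    then show ?case using Suc by (simp add: torus_word_def)
  qed (simp add: torus_word_def)
  moreover have "(\<Sum>i<n. smult (z i) (xK 1 i)) = (\<Sum>i<n. smult (z i) (gen_lead (KR i)))"
    by (intro sum.cong) (auto simp: gen_lead_K)
  ultimately show ?thesis by simp
qed

lemma pbw_FA: "pbw q n x \<in> FA"
  unfolding pbw_def by (intro FA_mult FA_prod; clarsimp simp: rootvec_FA)

lemma leads_pbw:
  assumes "\<And>r. x (FR r) \<ge> 0" "\<And>r. x (ER r) \<ge> 0"
  shows "leads (rep (pbw q n x)) (pbw_lead x)"
proof -
  let ?P = "fa_prod (\<lambda>r. pbw_gen (FR r)) (spread (\<lambda>r. nat (x (FR r))) (roots n))"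
  let ?Q = "word (torus_word n (\<lambda>i. x (KR i)))"
  let ?R = "fa_prod (\<lambda>r. pbw_gen (ER r)) (spread (\<lambda>r. nat (x (ER r))) (roots n))"
  have FAs: "?P \<in> FA" "?R \<in> FA" by (auto intro: FA_prod)
  have "pbw q n x = ?P \<star> (?Q \<star> ?R)"
    by (simp add: pbw_def pbw_gen_def case_prod_unfold)
  then have "rep (pbw q n x) = rep ?P \<odot> (rep ?Q \<odot> rep ?R)"
    by (simp only: rep_mult FAs FA_mult word_FA)
  moreover have "leads (rep ?P \<odot> (rep ?Q \<odot> rep ?R))
     ((\<Sum>r | case r of (k, d) \<Rightarrow> k + d < n. smult (int (nat (x (FR r)))) (gen_lead (FR r))) +
     ((\<Sum>i<n. smult (x (KR i)) (gen_lead (KR i))) +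
      (\<Sum>r | case r of (k, d) \<Rightarrow> k + d < n. smult (int (nat (x (ER r)))) (gen_lead (ER r)))))"
    by (intro leads_tmult leads_root_prod leads_torus_word rep_finsupp)
      (auto simp: set_roots pbw_indices_def)
  ultimately show ?thesis
    unfolding pbw_lead_def sum_pbw_indices using assms by (simp add: add.assoc)
qed

lemma coeff_pbw_lead: "coeff (pbw_lead x) i = (\<Sum>j\<in>pbw_indices n. x j * coeff (gen_lead j) i)"
  by (simp add: pbw_lead_def coeff_sum)

text \<open>Consecutive tail sums differ by one term. Tail sums arise because the shift coordinate
  of simple root \<open>b + t\<close> in the copy assigned to \<open>b\<close> counts every root
  that starts at \<open>b\<close> and reaches \<open>b + t\<close>.\<close>

lemma tail_sums_zero:
  fixes y :: "nat \<Rightarrow> int"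
  assumes "\<And>t. t < m \<Longrightarrow> (\<Sum>d\<in>{t..<m}. y d) = 0" "t < m"
  shows "y t = 0"
proof -
  have "(\<Sum>d\<in>{t..<m}. y d) = y t + (\<Sum>d\<in>{Suc t..<m}. y d)"
    using assms(2) by (rule sum.atLeast_Suc_lessThan)
  moreover have "(\<Sum>d\<in>{Suc t..<m}. y d) = 0"
    using assms(1)[of "Suc t"] by (cases "Suc t < m") auto
  ultimately show ?thesis using assms by simp
qed

lemma sum_roots_column:
  fixes y :: "nat \<times> nat \<Rightarrow> int"
  assumes "b < n" "b \<le> l" "l < n"
  shows "(\<Sum>r | case r of (k, d) \<Rightarrow> k + d < n. y r * of_bool (fst r \<le> l \<and> l \<le> fst r + snd r \<and> b = fst r))
     = (\<Sum>d\<in>{l - b..<n - b}. y (b, d))"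
proof -
  have "(\<Sum>r | case r of (k, d) \<Rightarrow> k + d < n. y r * of_bool (fst r \<le> l \<and> l \<le> fst r + snd r \<and> b = fst r))
     = (\<Sum>r\<in>Pair b ` {l - b..<n - b}. y r)"
    using finite_roots assms
    by (intro sum.mono_neutral_cong_right) (auto simp: image_iff less_diff_conv le_diff_conv add.commute)
  also have "\<dots> = (\<Sum>d\<in>{l - b..<n - b}. y (b, d))"
    by (subst sum.reindex) (auto intro: inj_onI)
  finally show ?thesis .
qed

text \<open>The rows say that the second differences of \<open>y\<close> vanish, so \<open>y\<close>
  is linear in the index, and it is zero at both ends.\<close>

lemma cartan_kernel:
  fixes y :: "nat \<Rightarrow> int"
  assumes "\<And>j. j < n \<Longrightarrow> (\<Sum>i<n. y i * cartan i j) = 0" "i < n"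
  shows "y i = 0"
proof -
  \<comment> \<open>\<open>y\<close> shifted by one and extended by zero at both ends, so that the
    first and last row look like all others.\<close>
  define Z where "Z j = (case j of 0 \<Rightarrow> 0 | Suc k \<Rightarrow> if k < n then y k else 0)" for j
  have Z_simps: "Z 0 = 0" "Z (Suc k) = (if k < n then y k else 0)" for k
    by (simp_all add: Z_def)
  have row: "2 * Z (Suc j) - Z j - Z (Suc (Suc j)) = 0" if j: "j < n" for j
  proof -
    have "(\<Sum>i<n. y i * cartan i j) = (\<Sum>i<n. (if i = j then 2 * y i else 0)
        - (if Suc i = j then y i else 0) - (if i = Suc j then y i else 0))"
      by (intro sum.cong refl) (simp add: cartan_def)
    also have "\<dots> = (\<Sum>i<n. if i = j then 2 * y i else 0) - (\<Sum>i<n. if Suc i = j then y i else 0)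
        - (\<Sum>i<n. if i = Suc j then y i else 0)"
      by (simp only: sum_subtractf)
    also have "(\<Sum>i<n. if Suc i = j then y i else 0) = Z j"
      using j by (cases j) (simp_all add: Z_simps)
    finally show ?thesis using assms(1)[OF j] j by (simp add: Z_simps)
  qed
  have "j \<le> n \<Longrightarrow> Z j = int j * Z 1 \<and> Z (Suc j) = (int j + 1) * Z 1" for j
  proof (induction j)
    case (Suc j)
    then have "Z j = int j * Z 1" "Z (Suc j) = (int j + 1) * Z 1" "j < n" by auto
    then show ?case using row[of j] by (simp add: algebra_simps)
  qed (simp add: Z_simps)
  note lin = this
  have "(int n + 1) * Z 1 = 0" using lin[of n] by (simp add: Z_simps)
  then have "Z 1 = 0" by simp
  then show ?thesis using lin[of i] assms(2) by (simp add: Z_simps)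
qed

text \<open>Triangular elimination: shift coordinates in the lower copies see only the
  \<open>E\<close> root vectors, those in the upper copies then give the \<open>F\<close> exponents.
  The \<open>K i\<close> have no shift part and are recovered last, from the diagonal
  coordinates.\<close>

lemma pbw_lead_zero:
  assumes zero: "pbw_lead y = 0" and i: "i \<in> pbw_indices n"
  shows "y i = 0"
proof -
  have nM: "M = 2 * n" by (simp add: M_def)
  let ?R = "{r. case r of (k, d) \<Rightarrow> k + d < n}"
  have E0: "y (ER (b, t)) = 0" if bt: "b + t < n" for b t
  proof (rule tail_sums_zero[of "n - b" "\<lambda>d. y (ER (b, d))"])
    fix t assume t: "t < n - b"
    let ?i = "M * n + ((b + t) * M + b)"
    have b: "b < M" "b < n" using t by (auto simp: nM)
    have l: "b + t < n" using t by auto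
    \<comment> \<open>Leading shifts of \<open>F\<close> root vectors lie in copies
      \<open>M - 1 - k\<close> with \<open>k < n\<close>, hence not in copy
      \<open>b < n\<close>.\<close>
    have F: "coeff (gen_lead (FR r)) ?i = 0" if rR: "r \<in> ?R" for r
    proof -
      obtain k d where r: "r = (k, d)" "k + d < n" using rR by auto
      have "n - 1 - (n - 1 - (b + t)) = b + t" "M - 1 - (M - 1 - b) = b" using l b by auto
      then show ?thesis
        using coeff_gen_lead_F[OF r(2), of "n - 1 - (b + t)" "M - 1 - b"] l b r by (auto simp: nM)
    qed
    have "0 = coeff (pbw_lead y) ?i" by (simp add: zero)
    also have "\<dots> = (\<Sum>r\<in>?R. y (ER r) * of_bool (fst r \<le> b + t \<and> b + t \<le> fst r + snd r \<and> b = fst r))"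
      unfolding coeff_pbw_lead sum_pbw_indices
      using F l b by (simp add: gen_lead_K coeff_xK_m) (intro sum.cong refl, auto simp: coeff_gen_lead_E)
    also have "\<dots> = (\<Sum>d\<in>{b + t - b..<n - b}. y (ER (b, d)))"
      by (rule sum_roots_column) (use b l in auto)
    finally show "(\<Sum>d\<in>{t..<n - b}. y (ER (b, d))) = 0" by simp
  qed (use bt in auto)
  have F0: "y (FR (b, t)) = 0" if bt: "b + t < n" for b t
  proof (rule tail_sums_zero[of "n - b" "\<lambda>d. y (FR (b, d))"])
    fix t assume t: "t < n - b"
    let ?i = "M * n + ((n - 1 - (b + t)) * M + (M - 1 - b))"
    have b: "b < M" "b < n" using t by (auto simp: nM)
    have l: "b + t < n" using t by auto
    have "0 = coeff (pbw_lead y) ?i" by (simp add: zero)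
    also have "\<dots> = - (\<Sum>r\<in>?R. y (FR r) * of_bool (fst r \<le> b + t \<and> b + t \<le> fst r + snd r \<and> b = fst r))"
    proof -
      have 1: "(\<Sum>r\<in>?R. y (ER r) * coeff (gen_lead (ER r)) ?i) = 0"
        using E0 by (intro sum.neutral) auto
      have 2: "(\<Sum>i<n. y (KR i) * coeff (gen_lead (KR i)) ?i) = 0"
        using l b by (intro sum.neutral ballI) (simp only: lessThan_iff gen_lead_K, subst coeff_xK_m, auto)
      have 3: "(\<Sum>r\<in>?R. y (FR r) * coeff (gen_lead (FR r)) ?i)
          = (\<Sum>r\<in>?R. - (y (FR r) * of_bool (fst r \<le> b + t \<and> b + t \<le> fst r + snd r \<and> b = fst r)))"
      proof (intro sum.cong refl)
        fix r assume "r \<in> ?R"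
        then obtain k d where r: "r = (k, d)" "k + d < n" by auto
        show "y (FR r) * coeff (gen_lead (FR r)) ?i
          = - (y (FR r) * of_bool (fst r \<le> b + t \<and> b + t \<le> fst r + snd r \<and> b = fst r))"
          unfolding r(1) coeff_gen_lead_F[OF r(2) l b(1)] by simp
      qed
      show ?thesis unfolding coeff_pbw_lead sum_pbw_indices 1 2 3 by (simp add: sum_negf)
    qed
    also have "\<dots> = - (\<Sum>d\<in>{b + t - b..<n - b}. y (FR (b, d)))"
      by (subst sum_roots_column) (use b l in auto)
    finally show "(\<Sum>d\<in>{t..<n - b}. y (FR (b, d))) = 0" by simp
  qed (use bt in auto)
  have K0: "y (KR i) = 0" if "i < n" for i
  proof (rule cartan_kernel[of "\<lambda>i. y (KR i)", OF _ that])
    fix j assume j: "j < n"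
    have "0 = coeff (pbw_lead y) (j * M + 0)" by (simp add: zero)
    also have "\<dots> = (\<Sum>i<n. y (KR i) * cartan i j)"
    proof -
      have 1: "(\<Sum>r\<in>?R. y (ER r) * coeff (gen_lead (ER r)) (j * M + 0)) = 0"
        "(\<Sum>r\<in>?R. y (FR r) * coeff (gen_lead (FR r)) (j * M + 0)) = 0"
        using E0 F0 by (auto intro!: sum.neutral)
      have 2: "(\<Sum>i<n. y (KR i) * coeff (gen_lead (KR i)) (j * M + 0)) = (\<Sum>i<n. y (KR i) * cartan i j)"
        using j by (intro sum.cong refl) (simp only: lessThan_iff gen_lead_K, subst coeff_xK_v, auto simp: nM)
      show ?thesis unfolding coeff_pbw_lead sum_pbw_indices 1 2 by simp
    qed
    finally show "(\<Sum>i<n. y (KR i) * cartan i j) = 0" by simp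
  qed
  show ?thesis using i E0 F0 K0 by (auto simp: pbw_indices_def)
qed

lemma pbw_lead_inj:
  assumes "pbw_lead x = pbw_lead y" "\<And>i. i \<notin> pbw_indices n \<Longrightarrow> x i = y i"
  shows "x = y"
proof
  fix i
  have "pbw_lead (\<lambda>i. x i - y i) = 0"
    using assms(1) by (simp add: pbw_lead_def smult_diff_left sum_subtractf)
  then show "x i = y i" using pbw_lead_zero[of "\<lambda>i. x i - y i" i] assms(2)[of i] by (cases "i \<in> pbw_indices n") auto
qed

end

section \<open>Kernel and dimension counts\<close>

lemma two_card_roots: "2 * card {(k, d). k + d < (n::nat)} = n * (n + 1)"
proof -
  have "card {(k, d). k + d < n} = length (roots n)"
    using distinct_card[OF distinct_roots[of n]] by (simp add: set_roots)
  moreover have "2 * length (roots n) = n * (n + 1)"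
    by (induction n) (simp add: roots_def, simp add: roots_Suc)
  ultimately show ?thesis by simp
qed

lemma pbw_exponents_mono: "m \<le> m' \<Longrightarrow> pbw_exponents n m \<subseteq> pbw_exponents n m'"
  unfolding pbw_exponents_def by (auto intro: order_trans)

lemma finite_pbw_exponents:
  assumes "finite (pbw_indices n)"
  shows "finite (pbw_exponents n m)"
    and "card (pbw_exponents n m) \<le> (2 * m + 1) ^ card (pbw_indices n)"
proof -
  let ?P = "PiE (pbw_indices n) (\<lambda>_. {- int m..int m})"
  have inj: "inj_on (\<lambda>x. restrict x (pbw_indices n)) (pbw_exponents n m)"
  proof (rule inj_onI)
    fix x y assume xy: "x \<in> pbw_exponents n m" "y \<in> pbw_exponents n m"
      "restrict x (pbw_indices n) = restrict y (pbw_indices n)"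
    show "x = y"
    proof
      fix i show "x i = y i"
        using xy by (cases "i \<in> pbw_indices n") (auto simp: pbw_exponents_def dest: fun_cong[of _ _ i])
    qed
  qed
  have sub: "(\<lambda>x. restrict x (pbw_indices n)) ` pbw_exponents n m \<subseteq> ?P"
    by (auto simp: pbw_exponents_def abs_le_iff minus_le_iff)
  have fin: "finite ?P" using assms by (intro finite_PiE) auto
  show "finite (pbw_exponents n m)" using finite_imageD[OF finite_subset[OF sub fin] inj] .
  have "card (pbw_exponents n m) \<le> card ?P" using inj sub fin by (rule card_inj_on_le)
  also have "\<dots> = (2 * m + 1) ^ card (pbw_indices n)"
  proof -
    have "card {- int m..int m} = 2 * m + 1" by (simp add: nat_add_distrib nat_mult_distrib)
    then show ?thesis using assms by (simp only: card_PiE prod_constant)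
  qed
  finally show "card (pbw_exponents n m) \<le> (2 * m + 1) ^ card (pbw_indices n)" .
qed

definition word_length_le :: "nat \<Rightarrow> 'g fa \<Rightarrow> bool" where
  "word_length_le l f \<longleftrightarrow> (\<forall>w. f w \<noteq> 0 \<longrightarrow> length w \<le> l)"

lemma word_length_le_mult:
  assumes "word_length_le l f" "word_length_le l' g" shows "word_length_le (l + l') (f \<star> g)"
  unfolding word_length_le_def
proof (intro allI impI)
  fix w assume "(f \<star> g) w \<noteq> 0"
  then obtain i where "i \<le> length w" "f (take i w) * g (drop i w) \<noteq> 0"
    unfolding fa_mult_def by (auto elim!: sum.not_neutral_contains_not_neutral)
  then have "length (take i w) \<le> l" "length (drop i w) \<le> l'" "i \<le> length w"
    using assms by (auto simp: word_length_le_def)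
  then show "length w \<le> l + l'" by simp
qed

lemma prods_word_length:
  assumes "\<And>s. s \<in> S \<Longrightarrow> word_length_le L s" "f \<in> prods S m"
  shows "word_length_le (m * L) f"
  using assms(2)
proof (induction m arbitrary: f)
  case 0 then show ?case by (auto simp: word_length_le_def fa_one_def)
next
  case (Suc m)
  then obtain a b where "f = a \<star> b" "a \<in> prods S m" "b \<in> S" by (auto simp: set_mult_def)
  then show ?case using word_length_le_mult[of "m * L" a L b] Suc.IH assms(1) by (simp add: add.commute)
qed

lemma frame_word_length:
  assumes "finite S" "S \<subseteq> FA" shows "\<exists>L. \<forall>s\<in>S. word_length_le L s"
proof -
  have "finite (\<Union>s\<in>S. {w. s w \<noteq> 0})" using assms by (auto simp: FA_def)
  then obtain L where "\<forall>w\<in>(\<Union>s\<in>S. {w. s w \<noteq> 0}). length w \<le> L"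
    using finite_imageI[of _ length] by (metis finite_nat_set_iff_bounded_le imageI)
  then show ?thesis by (auto simp: word_length_le_def)
qed

lemma set_mult_finite: "finite S \<Longrightarrow> finite T \<Longrightarrow> finite (set_mult S T)"
proof -
  assume "finite S" "finite T"
  moreover have "set_mult S T = (\<lambda>(a, b). a \<star> b) ` (S \<times> T)" by (auto simp: set_mult_def)
  ultimately show ?thesis by simp
qed

lemma set_mult_FA: "S \<subseteq> FA \<Longrightarrow> T \<subseteq> FA \<Longrightarrow> set_mult S T \<subseteq> FA"
  by (auto simp: set_mult_def intro: FA_mult)

lemma prods_finite: "finite S \<Longrightarrow> finite (prods S m)"
  by (induction m) (auto intro: set_mult_finite)

lemma prods_FA: "S \<subseteq> FA \<Longrightarrow> prods S m \<subseteq> FA"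
  by (induction m) (auto intro: FA_one set_mult_FA[THEN subsetD])

text \<open>Powers are built by appending factors on the right while expansion multiplies on the
  left; associativity reconciles the two.\<close>

lemma set_mult_prods: "set_mult S (prods S m) = prods S (Suc m)"
proof (induction m)
  case 0 show ?case by (auto simp: set_mult_def)
next
  case (Suc m)
  have "set_mult S (set_mult (prods S m) S) = set_mult (set_mult S (prods S m)) S"
    unfolding set_mult_def by (auto simp: fa_mult_assoc) (metis fa_mult_assoc)+
  then show ?case using Suc by simp
qed

lemma one_in_prods: "fa_one \<in> S \<Longrightarrow> fa_one \<in> prods S m"
  by (induction m) (auto simp: set_mult_def intro!: exI[of _ fa_one])

context uq_sl
begin

lemma normal_form:
  assumes "f \<in> FA" "word_length_le l f"
  obtains a b where "f = a + b" "a \<in> fs.span (pbw q n ` pbw_exponents n l)" "b \<in> Uq_ideal"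
proof -
  let ?X = "pbw q n ` pbw_exponents n l"
  have f: "f = (\<Sum>w | f w \<noteq> 0. fscale (f w) (word w))"
    using assms(1) by (intro fa_expand) (auto simp: FA_def)
  have "word w \<in> spanI ?X" if "f w \<noteq> 0" for w
  proof -
    have "length w \<le> l" using that assms(2) by (simp add: word_length_le_def)
    then have "pbw q n ` pbw_exponents n (length w) \<subseteq> ?X"
      by (intro image_mono pbw_exponents_mono)
    then show ?thesis using pbw_span[of w] spanI_mono by blast
  qed
  then have "(\<Sum>w | f w \<noteq> 0. fscale (f w) (word w)) \<in> spanI ?X"
    unfolding spanI_def by (intro fs.span_sum fs.span_scale) auto
  then have "f \<in> spanI ?X" using f by (rule ssubst[rotated])
  then obtain a b where "f = a + b" "a \<in> fs.span ?X" "b \<in> fs.span Uq_ideal"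
    unfolding spanI_def fs.span_Un by blast
  moreover have "fs.span Uq_ideal = Uq_ideal" using I_subspace by (simp add: fs.span_eq_iff)
  ultimately show ?thesis using that by blast
qed

text \<open>Distinct exponent vectors give distinct leading exponents by
  \<open>pbw_lead_inj\<close>, so \<open>combination_leads\<close> applies to any combination of PBW
  monomials.\<close>

lemma rep_span_pbw:
  assumes "a \<in> fs.span (pbw q n ` pbw_exponents n l)"
  shows "a \<in> FA" and "rep a \<in> fs.span (rep ` pbw q n ` pbw_exponents n l)"
    and "rep a = 0 \<Longrightarrow> a = 0" and "leads (rep a) p \<Longrightarrow> p \<in> pbw_lead ` pbw_exponents n l"
proof -
  let ?X = "pbw_exponents n l" and ?A = "pbw q n ` pbw_exponents n l"
  define lA where "lA v = (THE p. leads (rep v) p)" for v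
  have lead: "leads (rep (pbw q n x)) (pbw_lead x)" if "x \<in> ?X" for x
    using that by (intro leads_pbw) (auto simp: pbw_exponents_def)
  have lA: "lA (pbw q n x) = pbw_lead x" if "x \<in> ?X" for x
    unfolding lA_def using lead[OF that] leads_unique by blast
  have fin: "finite ?A" using finite_pbw_exponents(1)[OF finite_pbw_indices] by simp
  obtain u where u: "a = (\<Sum>v\<in>?A. fscale (u v) v)"
    using assms unfolding fs.span_finite[OF fin] by blast
  have AFA: "?A \<subseteq> FA" using pbw_FA by auto
  show "a \<in> FA" unfolding u using AFA by (intro FA_sum FA_scale) auto
  have "rep (\<Sum>v\<in>?A. fscale (u v) v) = (\<Sum>v\<in>?A. rep (fscale (u v) v))"
    using AFA by (intro rep_sum FA_scale) auto
  then have rep_a: "rep a = (\<Sum>v\<in>?A. fscale (u v) (rep v))"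
    unfolding u[symmetric] rep_scale .
  show "rep a \<in> fs.span (rep ` ?A)"
    unfolding rep_a by (intro fs.span_sum fs.span_scale fs.span_base imageI)
  have leadA: "\<And>v. v \<in> ?A \<Longrightarrow> leads (rep v) (lA v)"
    using lead lA by auto
  have inj: "inj_on lA ?A"
  proof (rule inj_onI)
    fix v w assume vw: "v \<in> ?A" "w \<in> ?A" "lA v = lA w"
    then obtain x y where xy: "v = pbw q n x" "w = pbw q n y" "x \<in> ?X" "y \<in> ?X" by blast
    have "x = y"
    proof (rule pbw_lead_inj)
      show "pbw_lead x = pbw_lead y" using vw(3) xy lA by simp
      show "x i = y i" if "i \<notin> pbw_indices n" for i using xy(3,4) that by (simp add: pbw_exponents_def)
    qed
    then show "v = w" using xy by simp
  qed
  note comb = combination_leads[OF fin leadA inj rep_a]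
  show "a = 0" if "rep a = 0"
  proof -
    have "u v = 0" if v: "v \<in> ?A" for v
      by (rule comb(3)[OF _ \<open>rep a = 0\<close> v])
    then show ?thesis unfolding u by (intro sum.neutral ballI) (simp only: fs.scale_zero_left)
  qed
  show "p \<in> pbw_lead ` ?X" if p: "leads (rep a) p"
  proof -
    have "p \<in> lA ` ?A" by (rule comb(2)[OF _ p])
    then show ?thesis using lA by auto
  qed
qed

lemma FA_word_length: "f \<in> FA \<Longrightarrow> \<exists>l. word_length_le l f"
  using frame_word_length[of "{f}"] by simp

lemma rep_normal_form:
  assumes "f \<in> FA" "f = a + b" "a \<in> fs.span (pbw q n ` pbw_exponents n l)" "b \<in> Uq_ideal"
  shows "rep f = rep a"
  using rep_add[OF rep_span_pbw(1)[OF assms(3)], of b] rep_ideal_zero[OF assms(4)] assms(2)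
  by (simp only: add_0_right)

text \<open>Spanning and independence meet here. An element is congruent to a combination of PBW
  monomials with the same image, and if this image vanishes, so does the combination.\<close>

lemma rep_kernel: "f \<in> FA \<Longrightarrow> rep f = 0 \<longleftrightarrow> f \<in> Uq_ideal"
proof
  assume f: "f \<in> FA" "rep f = 0"
  obtain l where "word_length_le l f" using FA_word_length f by blast
  then obtain a b where ab: "f = a + b" "a \<in> fs.span (pbw q n ` pbw_exponents n l)" "b \<in> Uq_ideal"
    using normal_form f by blast
  then have "a = 0" using rep_span_pbw(3)[OF ab(2)] rep_normal_form[OF f(1) ab] f(2) by simp
  then show "f \<in> Uq_ideal" using ab by simp
qed (use rep_ideal_zero in auto)

lemma rep_lead_range:
  assumes "f \<in> FA" "leads (rep f) p"
  shows "\<exists>x. (\<forall>i. i \<notin> pbw_indices n \<longrightarrow> x i = 0) \<and> p = pbw_lead x"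
proof -
  obtain l where "word_length_le l f" using FA_word_length assms by blast
  then obtain a b where ab: "f = a + b" "a \<in> fs.span (pbw q n ` pbw_exponents n l)" "b \<in> Uq_ideal"
    using normal_form assms by blast
  have "p \<in> pbw_lead ` pbw_exponents n l"
    using rep_span_pbw(4)[OF ab(2)] rep_normal_form[OF assms(1) ab] assms(2) by simp
  then show ?thesis by (auto simp: pbw_exponents_def)
qed

lemma dim_mod_eq_dim: "finite X \<Longrightarrow> X \<subseteq> FA \<Longrightarrow> dim_mod Uq_ideal X = fs.dim (rep ` X)"
  by (rule dim_mod_eq_dim_image) (auto simp: rep_add rep_scale rep_kernel)

lemma dim_mod_eq_card:
  assumes "finite X" "X \<subseteq> FA"
  shows "finite (lead_set (fs.span (rep ` X)))" "card (lead_set (fs.span (rep ` X))) = dim_mod Uq_ideal X"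
proof -
  have "rep ` X \<subseteq> finsupp" by auto
  then show "finite (lead_set (fs.span (rep ` X)))" "card (lead_set (fs.span (rep ` X))) = dim_mod Uq_ideal X"
    using card_lead_set[of "rep ` X"] assms by (simp_all add: dim_mod_eq_dim)
qed

lemma dim_mod_growth:
  assumes "S \<subseteq> FA" "\<And>s. s \<in> S \<Longrightarrow> word_length_le L s" "finite S"
  shows "dim_mod Uq_ideal (prods S m) \<le> (2 * (m * L) + 1) ^ card (pbw_indices n)"
proof -
  let ?X = "pbw_exponents n (m * L)"
  have PFA: "prods S m \<subseteq> FA" using assms by (intro prods_FA)
  have fin: "finite ?X" by (rule finite_pbw_exponents(1)[OF finite_pbw_indices])
  have "rep f \<in> fs.span (rep ` pbw q n ` ?X)" if f: "f \<in> prods S m" for f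
  proof -
    have fFA: "f \<in> FA" using f PFA by blast
    have "word_length_le (m * L) f" using prods_word_length[OF assms(2) f] .
    then obtain a b where ab: "f = a + b" "a \<in> fs.span (pbw q n ` ?X)" "b \<in> Uq_ideal"
      using normal_form fFA by blast
    show ?thesis unfolding rep_normal_form[OF fFA ab] by (rule rep_span_pbw(2)[OF ab(2)])
  qed
  then have "fs.dim (rep ` prods S m) \<le> card (rep ` pbw q n ` ?X)"
    using fin by (intro fs.dim_le_card) auto
  also have "\<dots> \<le> card ?X" unfolding image_image by (rule card_image_le[OF fin])
  also have "\<dots> \<le> (2 * (m * L) + 1) ^ card (pbw_indices n)"
    by (rule finite_pbw_exponents(2)[OF finite_pbw_indices])
  finally show ?thesis using prods_finite[OF assms(3)] PFA by (simp add: dim_mod_eq_dim)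
qed

lemma dim_mod_prods_ge_1:
  assumes "frame S" shows "dim_mod Uq_ideal (prods S m) \<ge> 1"
proof -
  have S: "finite (prods S m)" "prods S m \<subseteq> FA" "fa_one \<in> prods S m"
    using assms prods_finite[of S m] prods_FA[of S m] one_in_prods[of S m] by (simp_all add: frame_def)
  have "delta 0 \<in> fs.span (rep ` prods S m)"
    using S(3) rep_one by (metis fs.span_base imageI)
  then have "0 \<in> lead_set (fs.span (rep ` prods S m))"
    using leads_delta by (auto simp: lead_set_def)
  then have "card (lead_set (fs.span (rep ` prods S m))) > 0"
    using dim_mod_eq_card(1)[OF S(1,2)] by (auto simp: card_gt_0_iff)
  then show ?thesis using dim_mod_eq_card(2)[OF S(1,2)] by simp
qed

lemma pbw_lead_shift: "i \<in> pbw_indices n \<Longrightarrow> pbw_lead (shift i x) = gen_lead i + pbw_lead x"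
proof -
  assume i: "i \<in> pbw_indices n"
  have "pbw_lead (shift i x) = (\<Sum>j\<in>pbw_indices n. smult (x j) (gen_lead j) + (if j = i then gen_lead i else 0))"
    unfolding pbw_lead_def by (intro sum.cong) (auto simp: shift_def smult_add_left)
  then show ?thesis using i finite_pbw_indices by (simp add: sum.distrib pbw_lead_def add.commute)
qed

text \<open>Root vectors are included besides simple generators, so that left multiplication
  realizes a unit shift in each coordinate direction of the lattice of leading exponents.\<close>

definition pbw_frame :: "gen fa set" where
  "pbw_frame = insert fa_one (pbw_gen ` pbw_indices n)"

lemma frame_pbw_frame: "frame pbw_frame"
  using finite_pbw_indices by (auto simp: frame_def pbw_frame_def FA_one)

lemma pbw_indices_nonempty: "pbw_indices n \<noteq> {}"
proof -
  have "KR 0 \<in> pbw_indices n" using N_ge_2 by (simp add: pbw_indices_def n_def)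
  then show ?thesis by blast
qed

text \<open>Leading exponents of the span of \<open>T\<close> are pulled back to a finite set of
  integer vectors. Multiplication by a PBW generator shifts that set by a unit vector, and
  \<open>discrete_isoperimetry\<close> counts the outcome.\<close>

lemma pbw_frame_expands:
  assumes "fdsub Uq_ideal T"
  defines "e \<equiv> real (card (pbw_indices n))"
  shows "real (dim_mod Uq_ideal (set_mult pbw_frame T)) \<ge>
    real (dim_mod Uq_ideal T) + real (dim_mod Uq_ideal T) powr ((e - 1) / e)"
proof -
  have T: "finite T" "T \<subseteq> FA" "dim_mod Uq_ideal T > 0" using assms(1) by (auto simp: fdsub_def)
  let ?ST = "set_mult pbw_frame T"
  have "finite pbw_frame" "pbw_frame \<subseteq> FA" using frame_pbw_frame by (auto simp: frame_def)
  then have ST: "finite ?ST" "?ST \<subseteq> FA"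
    using T set_mult_finite[of pbw_frame T] set_mult_FA[of pbw_frame T] by auto
  let ?L = "lead_set (fs.span (rep ` T))" and ?L' = "lead_set (fs.span (rep ` ?ST))"
  note L = dim_mod_eq_card[OF T(1,2)] and L' = dim_mod_eq_card[OF ST]
  let ?Z = "{x :: pbw_index \<Rightarrow> int. \<forall>i. i \<notin> pbw_indices n \<longrightarrow> x i = 0}"
  define A where "A = {x \<in> ?Z. pbw_lead x \<in> ?L}"
  have injZ: "inj_on pbw_lead ?Z" by (rule inj_onI, rule pbw_lead_inj) auto
  have injA: "inj_on pbw_lead A" by (rule inj_on_subset[OF injZ]) (auto simp: A_def)
  have "?L \<subseteq> pbw_lead ` A"
  proof
    fix p assume p: "p \<in> ?L"
    then obtain y where y: "y \<in> fs.span (rep ` T)" "leads y p" by (auto simp: lead_set_def)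
    have "fs.subspace (rep ` FA)"
      unfolding fs.subspace_def
    proof (intro conjI ballI allI)
      show "0 \<in> rep ` FA" by (rule image_eqI[of _ _ 0]) (simp_all only: rep_zero FA_zero)
      fix c x assume "x \<in> rep ` FA"
      then obtain f where f: "f \<in> FA" "x = rep f" by blast
      show "fscale c x \<in> rep ` FA"
        using f by (intro image_eqI[of _ _ "fscale c f"]) (simp_all only: rep_scale FA_scale)
      fix y assume "y \<in> rep ` FA"
      then obtain g where "g \<in> FA" "y = rep g" by blast
      with f show "x + y \<in> rep ` FA"
        by (intro image_eqI[of _ _ "f + g"]) (simp_all only: rep_add FA_add)
    qed
    then have "fs.span (rep ` T) \<subseteq> rep ` FA" using T(2) by (intro fs.span_minimal) auto
    then obtain f where "f \<in> FA" "y = rep f" using y by blast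
    then obtain x where "\<forall>i. i \<notin> pbw_indices n \<longrightarrow> x i = 0" "p = pbw_lead x"
      using rep_lead_range y(2) by blast
    then show "p \<in> pbw_lead ` A" using p by (auto simp: A_def)
  qed
  then have LA: "?L = pbw_lead ` A" by (auto simp: A_def)
  then have cardA: "card A = dim_mod Uq_ideal T" using L(2) card_image[OF injA] by simp
  have finA: "finite A" using L(1) LA finite_imageD injA by metis
  have neA: "A \<noteq> {}" using cardA T(3) by auto
  let ?U = "A \<union> (\<Union>i\<in>pbw_indices n. shift i ` A)"
  have iso: "real (card ?U) \<ge> real (card A) + real (card A) powr ((e - 1) / e)"
    unfolding e_def
    by (rule discrete_isoperimetry[OF finite_pbw_indices pbw_indices_nonempty finA neA]) (auto simp: A_def)
  have UZ: "?U \<subseteq> ?Z" by (auto simp: A_def shift_def)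
  have "pbw_lead ` ?U \<subseteq> ?L'"
  proof -
    have "T \<subseteq> ?ST"
    proof
      fix t assume "t \<in> T"
      then show "t \<in> ?ST" unfolding set_mult_def pbw_frame_def
        by (intro CollectI exI[of _ fa_one] exI[of _ t]) simp
    qed
    then have "?L \<subseteq> ?L'" using fs.span_mono[OF image_mono, of T ?ST rep] by (auto simp: lead_set_def)
    moreover have "pbw_lead (shift i x) \<in> ?L'" if i: "i \<in> pbw_indices n" and x: "x \<in> A" for i x
    proof -
      obtain y where y: "y \<in> fs.span (rep ` T)" "leads y (pbw_lead x)"
        using x by (auto simp: A_def lead_set_def)
      have "fs.subspace {y. rep (pbw_gen i) \<odot> y \<in> fs.span (rep ` ?ST)}"
        by (auto simp: fs.subspace_def tmult_add_right tmult_scale_right fs.span_zero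
            intro: fs.span_add fs.span_scale)
      moreover have "rep ` T \<subseteq> {y. rep (pbw_gen i) \<odot> y \<in> fs.span (rep ` ?ST)}"
      proof (intro subsetI CollectI)
        fix z assume "z \<in> rep ` T"
        then obtain t where t: "t \<in> T" "z = rep t" by blast
        have "pbw_gen i \<star> t \<in> ?ST" using i t by (auto simp: set_mult_def pbw_frame_def)
        moreover have "rep (pbw_gen i \<star> t) = rep (pbw_gen i) \<odot> z" using t T(2) by (auto simp: rep_mult)
        ultimately show "rep (pbw_gen i) \<odot> z \<in> fs.span (rep ` ?ST)" by (metis fs.span_base imageI)
      qed
      ultimately have "rep (pbw_gen i) \<odot> y \<in> fs.span (rep ` ?ST)"
        using fs.span_minimal y(1) by blast
      moreover have "leads (rep (pbw_gen i) \<odot> y) (gen_lead i + pbw_lead x)"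
        by (rule leads_tmult[OF rep_finsupp gen_lead[OF i] y(2)])
      ultimately show ?thesis unfolding pbw_lead_shift[OF i] by (auto simp: lead_set_def)
    qed
    ultimately show ?thesis using LA by blast
  qed
  then have "card (pbw_lead ` ?U) \<le> card ?L'" using L'(1) by (rule card_mono[rotated])
  moreover have "card (pbw_lead ` ?U) = card ?U" by (rule card_image[OF inj_on_subset[OF injZ UZ]])
  ultimately show ?thesis using iso cardA L'(2) by simp
qed

section \<open>The values of both dimensions\<close>

lemma card_pbw_indices: "card (pbw_indices n) = N\<^sup>2 - 1"
proof -
  have inj: "inj_on FR A" "inj_on KR B" "inj_on ER A" for A B by (auto intro: inj_onI)
  let ?r = "card {(k, d). k + d < n}"
  have "card (pbw_indices n) = card (FR ` {(k, d). k + d < n} \<union> KR ` {..<n}) + card (ER ` {(k, d). k + d < n})"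
    unfolding pbw_indices_def using finite_roots by (intro card_Un_disjoint) auto
  also have "card (FR ` {(k, d). k + d < n} \<union> KR ` {..<n}) = card (FR ` {(k, d). k + d < n}) + card (KR ` {..<n})"
    using finite_roots by (intro card_Un_disjoint) auto
  finally have "card (pbw_indices n) = 2 * ?r + n" by (simp add: card_image inj)
  also have "\<dots> = n * (n + 1) + n" by (simp only: two_card_roots)
  also have "\<dots> = (n + 1)\<^sup>2 - 1" by (simp add: power2_eq_square)
  finally show ?thesis using N_ge_2 by (simp add: n_def)
qed

lemma dim_growth_bounds:
  assumes "frame S"
  shows "real (dim_mod Uq_ideal (prods S m)) \<ge> 1"
    and "\<exists>C>0. \<forall>m>0. real (dim_mod Uq_ideal (prods S m)) \<le> (C * real m) powr real (N\<^sup>2 - 1)"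
proof -
  show "real (dim_mod Uq_ideal (prods S m)) \<ge> 1" using dim_mod_prods_ge_1[OF assms, of m] by simp
  have S: "finite S" "S \<subseteq> FA" using assms by (auto simp: frame_def)
  obtain L where L: "\<And>s. s \<in> S \<Longrightarrow> word_length_le L s" using frame_word_length[OF S] by blast
  show "\<exists>C>0. \<forall>m>0. real (dim_mod Uq_ideal (prods S m)) \<le> (C * real m) powr real (N\<^sup>2 - 1)"
  proof (intro exI[of _ "2 * real L + 1"] conjI allI impI)
    fix m :: nat assume m: "m > 0"
    have "dim_mod Uq_ideal (prods S m) \<le> (2 * (m * L) + 1) ^ (N\<^sup>2 - 1)"
      using dim_mod_growth[OF S(2) L S(1), of m] by (simp only: card_pbw_indices)
    also have "\<dots> \<le> ((2 * L + 1) * m) ^ (N\<^sup>2 - 1)"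
      using m by (intro power_mono) (auto simp: algebra_simps)
    finally have "real (dim_mod Uq_ideal (prods S m)) \<le> real (((2 * L + 1) * m) ^ (N\<^sup>2 - 1))"
      by (simp only: of_nat_le_iff)
    also have "\<dots> = ((2 * real L + 1) * real m) powr real (N\<^sup>2 - 1)"
    proof -
      have pos: "(2 * real L + 1) * real m > 0" using m by (intro mult_pos_pos) auto
      show ?thesis
        by (simp only: powr_realpow[OF pos] of_nat_power of_nat_mult of_nat_add of_nat_numeral of_nat_1)
    qed
    finally show "real (dim_mod Uq_ideal (prods S m)) \<le> ((2 * real L + 1) * real m) powr real (N\<^sup>2 - 1)" .
  qed auto
qed

lemma fdsub_prods: "frame S \<Longrightarrow> fdsub Uq_ideal (prods S m)"
  using dim_mod_prods_ge_1[of S m] prods_finite[of S m] prods_FA[of S m] by (simp add: fdsub_def frame_def)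

lemma dimension_positive: "real (N\<^sup>2 - 1) \<ge> 1" "real (N\<^sup>2 - 1) > 0"
proof -
  have "2 * 2 \<le> N * N" using N_ge_2 by (intro mult_le_mono)
  then show "real (N\<^sup>2 - 1) \<ge> 1" by (simp add: power2_eq_square)
  then show "real (N\<^sup>2 - 1) > 0" by linarith
qed

lemma dim_growth_from_expansion:
  assumes "frame S" "d \<ge> 1" "c > 0"
    and "\<And>T. fdsub Uq_ideal T \<Longrightarrow> real (dim_mod Uq_ideal (set_mult S T)) \<ge>
      real (dim_mod Uq_ideal T) + c * real (dim_mod Uq_ideal T) powr ((d - 1) / d)"
  shows "\<exists>\<epsilon>>0. \<forall>m. real (dim_mod Uq_ideal (prods S m)) \<ge> (\<epsilon> * real m) powr d"
proof (rule growth_lower_bound[OF assms(3,2)])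
  fix m
  show "real (dim_mod Uq_ideal (prods S m)) \<ge> 1" by (rule dim_growth_bounds(1)[OF assms(1)])
  show "real (dim_mod Uq_ideal (prods S (Suc m))) \<ge> real (dim_mod Uq_ideal (prods S m))
      + c * real (dim_mod Uq_ideal (prods S m)) powr ((d - 1) / d)"
    using assms(4)[OF fdsub_prods[OF assms(1), of m]] unfolding set_mult_prods .
qed

lemma pbw_frame_expansion:
  "fdsub Uq_ideal T \<Longrightarrow> real (dim_mod Uq_ideal (set_mult pbw_frame T)) \<ge>
    real (dim_mod Uq_ideal T) + 1 * real (dim_mod Uq_ideal T) powr ((real (N\<^sup>2 - 1) - 1) / real (N\<^sup>2 - 1))"
  using pbw_frame_expands[of T] by (simp only: card_pbw_indices mult_1)

lemma GK_eq: "GK (Uq_sl_rel q N) = ereal (real (N\<^sup>2 - 1))"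
proof (rule antisym)
  show "GK (Uq_sl_rel q N) \<le> ereal (real (N\<^sup>2 - 1))"
    unfolding GK_def
  proof (rule SUP_least)
    fix S :: "gen fa set" assume "S \<in> {S. frame S}"
    then have S: "frame S" by simp
    obtain C where C: "C > 0" "\<And>m. m > 0 \<Longrightarrow> real (dim_mod Uq_ideal (prods S m)) \<le> (C * real m) powr real (N\<^sup>2 - 1)"
      using dim_growth_bounds(2)[OF S] by blast
    show "limsup (\<lambda>m. ereal (ln (real (dim_mod Uq_ideal (prods S m))) / ln (real m))) \<le> ereal (real (N\<^sup>2 - 1))"
      by (rule limsup_growth_le[OF C(1) dimension_positive(2) C(2) dim_growth_bounds(1)[OF S]])
  qed
  obtain \<epsilon> where e: "\<epsilon> > 0" "\<And>m. real (dim_mod Uq_ideal (prods pbw_frame m)) \<ge> (\<epsilon> * real m) powr real (N\<^sup>2 - 1)"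
    using dim_growth_from_expansion[OF frame_pbw_frame dimension_positive(1) zero_less_one pbw_frame_expansion] by blast
  have "ereal (real (N\<^sup>2 - 1)) \<le> limsup (\<lambda>m. ereal (ln (real (dim_mod Uq_ideal (prods pbw_frame m))) / ln (real m)))"
    by (rule limsup_growth_ge[OF e(1) dimension_positive(2) e(2)])
  also have "\<dots> \<le> GK (Uq_sl_rel q N)"
    unfolding GK_def by (rule SUP_upper) (simp add: frame_pbw_frame)
  finally show "ereal (real (N\<^sup>2 - 1)) \<le> GK (Uq_sl_rel q N)" .
qed

lemma LD_eq: "LD (Uq_sl_rel q N) = ereal (real (N\<^sup>2 - 1))"
proof -
  let ?e = "real (N\<^sup>2 - 1)"
  define B where "B S = {ereal d | d. d > 0 \<and> (\<exists>c>0. \<forall>T. fdsub Uq_ideal T \<longrightarrow>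
      real (dim_mod Uq_ideal (set_mult S T)) \<ge>
      real (dim_mod Uq_ideal T) + c * real (dim_mod Uq_ideal T) powr ((d - 1) / d))}" for S
  have "\<not> (\<forall>S. frame S \<longrightarrow> (\<exists>T. fdsub Uq_ideal T \<and> dim_mod Uq_ideal (set_mult S T) = dim_mod Uq_ideal T))"
  proof
    assume "\<forall>S. frame S \<longrightarrow> (\<exists>T. fdsub Uq_ideal T \<and> dim_mod Uq_ideal (set_mult S T) = dim_mod Uq_ideal T)"
    then obtain T where T: "fdsub Uq_ideal T" "dim_mod Uq_ideal (set_mult pbw_frame T) = dim_mod Uq_ideal T"
      using frame_pbw_frame by blast
    have "real (dim_mod Uq_ideal T) powr ((?e - 1) / ?e) > 0" using T(1) by (simp add: fdsub_def)
    then show False using pbw_frame_expansion[OF T(1)] T(2) by simp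
  qed
  then have LD: "LD (Uq_sl_rel q N) = (SUP S\<in>{S. frame S}. Sup (B S))"
    by (simp only: LD_def Let_def if_False B_def)
  show ?thesis unfolding LD
  proof (rule antisym)
    show "(SUP S\<in>{S. frame S}. Sup (B S)) \<le> ereal ?e"
    proof (intro SUP_least Sup_least)
      fix S :: "gen fa set" and x assume "S \<in> {S. frame S}" "x \<in> B S"
      then obtain d c where S: "frame S" and d: "x = ereal d" "d > 0" "c > 0"
        "\<And>T. fdsub Uq_ideal T \<Longrightarrow> real (dim_mod Uq_ideal (set_mult S T)) \<ge>
          real (dim_mod Uq_ideal T) + c * real (dim_mod Uq_ideal T) powr ((d - 1) / d)"
        unfolding B_def by blast
      \<comment> \<open>The growth comparison requires \<open>d \<ge> 1\<close>; smaller values lie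
        below the dimension anyway.\<close>
      have "d \<le> ?e"
      proof (cases "d \<ge> 1")
        case True
        obtain \<epsilon> where e: "\<epsilon> > 0" "\<And>m. real (dim_mod Uq_ideal (prods S m)) \<ge> (\<epsilon> * real m) powr d"
          using dim_growth_from_expansion[OF S True d(3,4)] by blast
        obtain C where C: "C > 0" "\<And>m. m > 0 \<Longrightarrow> real (dim_mod Uq_ideal (prods S m)) \<le> (C * real m) powr ?e"
          using dim_growth_bounds(2)[OF S] by blast
        show ?thesis
          by (rule growth_exponent_le[OF e(1) C(1) dimension_positive(2) e(2) C(2)])
      qed (use dimension_positive in linarith)
      then show "x \<le> ereal ?e" by (simp add: d(1))
    qed
    have "ereal ?e \<in> B pbw_frame"
      unfolding B_def
      by (intro CollectI exI[of _ ?e] conjI refl exI[of _ 1] allI impI dimension_positive(2)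
          zero_less_one pbw_frame_expansion)
    then have "ereal ?e \<le> Sup (B pbw_frame)" by (rule Sup_upper)
    also have "\<dots> \<le> (SUP S\<in>{S. frame S}. Sup (B S))"
      by (rule SUP_upper) (simp add: frame_pbw_frame)
    finally show "ereal ?e \<le> (SUP S\<in>{S. frame S}. Sup (B S))" .
  qed
qed

end

theorem theorem6p5:
  fixes q :: complex and N :: nat
  assumes "q \<noteq> 0"
    and "\<forall>n::nat. n > 0 \<longrightarrow> q ^ n \<noteq> 1"
    and "N \<ge> 2"
  shows "LD_stable (Uq_sl_rel q N) \<and> LD (Uq_sl_rel q N) = ereal (real (N\<^sup>2 - 1))"
proof -
  interpret uq_sl q N using assms by unfold_locales auto
  show ?thesis by (simp add: LD_stable_def LD_eq GK_eq)
qed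

end
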